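(* Let $G = \mathrm{PSL}(2,29)$, and let $G_1, G_2$ be subgroups of $G$, both isomorphic to the alternating group $A_5$, that are not conjugate in $G$. Let $\Gamma$ be the group with presentation $$\Gamma = \langle x,y,z \mid x^2,\ y^2,\ z^3,\ (yz)^2,\ (zx)^5,\ (xy)^3 \rangle.$$ Then there exist a finite quotient group $Q$ of $\Gamma$ and a surjective homomorphism $Q \to G$ for which the pre-images of $G_1$ and $G_2$ in $Q$ are not isomorphic.
   Context: Geometrically, $\Gamma$ is the index-$2$ subgroup of orientation-preserving isometries in the group generated by reflections in the faces of the hyperbolic tetrahedron $T \subset \mathbb{H}^3$ described by the $(3,5,3)$-Coxeter diagram; the presentation above is a presentation of this Kleinian group. *)

theory Defs
  imports "HOL-Algebra.Sym_Groups" "HOL-Algebra.Coset"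
begin

text \<open>SL(2, Z/pZ): 2x2 matrices (a,b,c,d) = [[a,b],[c,d]] with entries in {0..p-1}
  (representatives of Z/pZ) and determinant 1 mod p; multiplication is matrix product mod p.\<close>

definition SL2 :: "int \<Rightarrow> (int \<times> int \<times> int \<times> int) monoid" where
  "SL2 p = \<lparr> carrier = {(a,b,c,d). a \<in> {0..<p} \<and> b \<in> {0..<p} \<and> c \<in> {0..<p} \<and> d \<in> {0..<p}
                                   \<and> (a*d - b*c) mod p = 1 mod p},
             mult = (\<lambda>(a,b,c,d) (e,f,g,h).
                       ((a*e + b*g) mod p, (a*f + b*h) mod p, (c*e + d*g) mod p, (c*f + d*h) mod p)),
             one = (1 mod p, 0, 0, 1 mod p) \<rparr>"

definition PSL2 :: "int \<Rightarrow> (int \<times> int \<times> int \<times> int) set monoid" where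
  "PSL2 p = SL2 p Mod {(1 mod p, 0, 0, 1 mod p), ((-1) mod p, 0, 0, (-1) mod p)}"

definition conjugate_subgroups :: "('a, 'b) monoid_scheme \<Rightarrow> 'a set \<Rightarrow> 'a set \<Rightarrow> bool" where
  "conjugate_subgroups G H K \<longleftrightarrow>
     (\<exists>g \<in> carrier G. K = (\<lambda>h. g \<otimes>\<^bsub>G\<^esub> h \<otimes>\<^bsub>G\<^esub> inv\<^bsub>G\<^esub> g) ` H)"

text \<open>A finite quotient of
  Gamma = < x,y,z | x^2, y^2, z^3, (yz)^2, (zx)^5, (xy)^3 >
  is, by the universal property of the presentation, the same as a finite group Q
  together with elements x,y,z generating Q and satisfying the relators
  (the images of the generators under the quotient map Gamma \<rightarrow> Q).\<close>

definition Gamma_quotient :: "('a, 'b) monoid_scheme \<Rightarrow> bool" where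
  "Gamma_quotient Q \<longleftrightarrow> group Q \<and> finite (carrier Q) \<and>
     (\<exists>x \<in> carrier Q. \<exists>y \<in> carrier Q. \<exists>z \<in> carrier Q.
        x [^]\<^bsub>Q\<^esub> (2::nat) = \<one>\<^bsub>Q\<^esub> \<and>
        y [^]\<^bsub>Q\<^esub> (2::nat) = \<one>\<^bsub>Q\<^esub> \<and>
        z [^]\<^bsub>Q\<^esub> (3::nat) = \<one>\<^bsub>Q\<^esub> \<and>
        (y \<otimes>\<^bsub>Q\<^esub> z) [^]\<^bsub>Q\<^esub> (2::nat) = \<one>\<^bsub>Q\<^esub> \<and>
        (z \<otimes>\<^bsub>Q\<^esub> x) [^]\<^bsub>Q\<^esub> (5::nat) = \<one>\<^bsub>Q\<^esub> \<and>
        (x \<otimes>\<^bsub>Q\<^esub> y) [^]\<^bsub>Q\<^esub> (3::nat) = \<one>\<^bsub>Q\<^esub> \<and>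
        generate Q {x, y, z} = carrier Q)"

end

theory Submission
imports Defs "HOL-Algebra.SimpleGroups" "HOL-Computational_Algebra.Primes"
begin

text \<open>
  Let \<open>\<Gamma>\<close> act on the 203 cosets of a subgroup \<open>H \<cong> A\<^sub>5\<close> of \<open>G = PSL(2,29)\<close>, through a suitable
  epimorphism \<open>\<Gamma> \<rightarrow> G\<close>. The preimage \<open>\<Gamma>\<^sub>H\<close> of \<open>H\<close> has, besides the obvious one, epimorphisms onto
  \<open>A\<^sub>5\<close> that do not factor through \<open>H\<close>. One of them induces a homomorphism of \<open>\<Gamma>\<close> into the wreath product
  of \<open>A\<^sub>5\<close> with the permutations of the cosets; together with \<open>\<Gamma> \<rightarrow> G\<close> it has a finite image \<open>Q\<close>, and the kernel
  \<open>K\<close> of \<open>Q \<rightarrow> G\<close> is a subdirect product in \<open>A\<^sub>5^203\<close>.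

  The preimage of \<open>H\<close> in \<open>Q\<close> has two different epimorphisms onto \<open>A\<^sub>5\<close>, so at least one of any two
  that correspond to them under an isomorphism is nontrivial on \<open>K\<close>. Since \<open>A\<^sub>5\<close> is simple and not abelian, the kernel of
  such a map on \<open>K\<close> is the kernel of the projection to one of the 203 factors, and these kernels are pairwise distinct.
  A subgroup of \<open>Q\<close> that contains \<open>K\<close> and has such an epimorphism therefore fixes a coset.
  But a subgroup of \<open>G\<close> of order 60 that fixes a coset is a conjugate of \<open>H\<close>.

  Every subgroup of \<open>G\<close> that is isomorphic to \<open>A\<^sub>5\<close> is the image of \<open>H\<close> under conjugation by an
  element of \<open>GL(2,29)\<close>, because pairs of matrices with prescribed traces are conjugate there;
  so it is enough to treat one \<open>H\<close>.
\<close>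

section \<open>Extensions labelled by a simple group\<close>

text \<open>The two classes of A5 in \<open>G\<close> are interchanged by an automorphism coming
  from GL(2,29), so \<open>G\<close> itself treats both alike, and the preimages of
  \<open>G1\<close> and \<open>G2\<close> always have the same order. The asymmetry has to be built
  in: the labels live on the cosets of one chosen subgroup, which fixes a point, while the other
  subgroup fixes none of the 203 = 12180 / 60 points. The same \<open>Q\<close> serves every pair
  \<open>G1\<close>, \<open>G2\<close>; only the epimorphism to \<open>G\<close> is twisted by an
  automorphism. An abstract isomorphism of the preimages need not respect the projection to
  \<open>G\<close>, nor map \<open>K\<close> to itself. For this reason the argument speaks about
  all epimorphisms onto A5 at once, and recovers a point of the action from the kernel of such a
  map. That the 203 coordinate kernels are distinct is not tested pair by pair: one element of
  \<open>K\<close> with five trivial labels is enough, since 203 = 7 * 29 has no divisor from 2 to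
  5.\<close>

lemma (in group) conj_eq_one_iff:
  assumes "x \<in> carrier G" "y \<in> carrier G"
  shows "x \<otimes> y \<otimes> inv x = \<one> \<longleftrightarrow> y = \<one>"
proof -
  have "x \<otimes> y \<otimes> inv x = \<one> \<longleftrightarrow> x \<otimes> y = x"
    using assms inv_solve_right[of "\<one>" "x \<otimes> y" x] by auto
  then show ?thesis using assms by simp
qed

lemma (in group_hom) normal_image:
  assumes "N \<lhd> G" and "h ` carrier G = carrier H"
  shows "h ` N \<lhd> H"
proof (rule H.normal_invI)
  interpret N: normal N G by fact
  show "subgroup (h ` N) H" by (rule subgroup_img_is_subgroup[OF N.subgroup_axioms])
  fix x y assume "x \<in> carrier H" "y \<in> h ` N"
  then obtain g n where g: "g \<in> carrier G" "x = h g" and n: "n \<in> N" "y = h n"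
    using assms(2) by (metis imageE)
  have nc: "n \<in> carrier G" using n N.subset by auto
  have "x \<otimes>\<^bsub>H\<^esub> y \<otimes>\<^bsub>H\<^esub> inv\<^bsub>H\<^esub> x = h (g \<otimes> n \<otimes> inv g)"
    using g n nc by simp
  then show "x \<otimes>\<^bsub>H\<^esub> y \<otimes>\<^bsub>H\<^esub> inv\<^bsub>H\<^esub> x \<in> h ` N"
    using N.inv_op_closed2[OF g(1) n(1)] by simp
qed

lemma (in group_hom) subgroup_preimage:
  assumes "subgroup K H"
  shows "subgroup {g \<in> carrier G. h g \<in> K} G"
proof (rule G.subgroupI)
  show "{g \<in> carrier G. h g \<in> K} \<noteq> {}"
    using G.one_closed hom_one subgroup.one_closed[OF assms] by force
qed (auto intro: subgroup.m_closed[OF assms] subgroup.m_inv_closed[OF assms])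

text \<open>If \<open>F\<close> killed no \<open>N i\<close>, it would be onto on each of them.
  Commutators of elements of two normal subgroups lie in both, so in a nonabelian simple group being
  onto survives intersections, and \<open>F\<close> would be onto on the trivial intersection of all
  \<open>N i\<close>. Hence \<open>F\<close> kills some \<open>N i\<close>, and simplicity of the
  quotient by \<open>N i\<close> turns inclusion into equality. For a cyclic group of prime order
  this fails: the sum map on its square has a kernel different from both coordinate kernels.\<close>

lemma (in simple_group) kernel_of_subdirect_product:
  assumes noncomm: "a \<in> carrier G" "b \<in> carrier G" "a \<otimes> b \<noteq> b \<otimes> a"
    and K: "group K" and I: "finite I"
    and f: "\<And>i. i \<in> I \<Longrightarrow> f i \<in> hom K G" "\<And>i. i \<in> I \<Longrightarrow> f i ` carrier K = carrier G"
    and joint: "\<And>k. \<lbrakk>k \<in> carrier K; \<And>i. i \<in> I \<Longrightarrow> f i k = \<one>\<rbrakk> \<Longrightarrow> k = \<one>\<^bsub>K\<^esub>"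
    and F: "F \<in> hom K G" "F ` carrier K = carrier G"
  shows "\<exists>i\<in>I. kernel K G (f i) = kernel K G F"
proof -
  interpret K: group K by fact
  interpret F: group_hom K G F using F(1) by (unfold_locales) auto
  have fh: "group_hom K G (f i)" if "i \<in> I" for i
    using f(1)[OF that] by unfold_locales auto
  define N where "N i = kernel K G (f i)" for i
  have normal_N: "N i \<lhd> K" if "i \<in> I" for i
    unfolding N_def by (rule group_hom.normal_kernel[OF fh[OF that]])
  have dich: "h ` M = carrier G \<or> h ` M = {\<one>}"
    if "group_hom K G h" "M \<lhd> K" "h ` carrier K = carrier G" for h M
    using no_real_normal_subgroup[OF group_hom.normal_image[OF that(1,2,3)]] by auto
  have meet: "F ` (A \<inter> B) = carrier G"
    if A: "A \<lhd> K" "F ` A = carrier G" and B: "B \<lhd> K" "F ` B = carrier G" for A B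
  proof (rule ccontr)
    assume "F ` (A \<inter> B) \<noteq> carrier G"
    then have triv: "F ` (A \<inter> B) = {\<one>}"
      using dich[OF F.group_hom_axioms K.normal_subgroup_intersect[OF A(1) B(1)] F(2)] by auto
    interpret A: normal A K by fact
    interpret B: normal B K by fact
    obtain x y where x: "x \<in> A" "F x = a" and y: "y \<in> B" "F y = b"
      using A(2) B(2) noncomm(1,2) by (metis imageE)
    have c: "x \<in> carrier K" "y \<in> carrier K" using x y A.subset B.subset by auto
    \<comment> \<open>This commutator of preimages of \<open>a\<close> and \<open>b\<close> lies in
      both normal subgroups; a trivial image would make \<open>a\<close> and \<open>b\<close>
      commute.\<close>
    let ?c = "x \<otimes>\<^bsub>K\<^esub> y \<otimes>\<^bsub>K\<^esub> inv\<^bsub>K\<^esub> x \<otimes>\<^bsub>K\<^esub> inv\<^bsub>K\<^esub> y"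
    have "x \<otimes>\<^bsub>K\<^esub> (y \<otimes>\<^bsub>K\<^esub> inv\<^bsub>K\<^esub> x \<otimes>\<^bsub>K\<^esub> inv\<^bsub>K\<^esub> y) \<in> A"
      using A.m_closed[OF x(1) A.inv_op_closed2[OF c(2) A.m_inv_closed[OF x(1)]]] .
    then have "?c \<in> A" using c by (simp add: K.m_assoc)
    moreover have "?c \<in> B"
      using B.m_closed[OF B.inv_op_closed2[OF c(1) y(1)] B.m_inv_closed[OF y(1)]] .
    ultimately have "F ?c = \<one>" using triv by auto
    then have "a \<otimes> b \<otimes> inv a \<otimes> inv b = \<one>" using c x y by simp
    then have "a \<otimes> b = b \<otimes> a"
      using noncomm(1,2) by (metis inv_equality inv_inv inv_mult_group m_assoc m_closed inv_closed)
    with noncomm(3) show False by simp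
  qed
  have "\<exists>i\<in>I. F ` N i = {\<one>}"
  proof (rule ccontr)
    assume "\<not> ?thesis"
    then have full: "F ` N i = carrier G" if "i \<in> I" for i
      using that dich[OF F.group_hom_axioms normal_N F(2)] by auto
    have "F ` (carrier K \<inter> (\<Inter>i\<in>J. N i)) = carrier G \<and> carrier K \<inter> (\<Inter>i\<in>J. N i) \<lhd> K"
      if "J \<subseteq> I" for J
      using finite_subset[OF that I] that
    proof (induction J rule: finite_induct)
      case empty
      then show ?case using F(2) K.normal_invI[OF K.subgroup_self] by simp
    next
      case (insert j J)
      then have IH: "F ` (carrier K \<inter> (\<Inter>i\<in>J. N i)) = carrier G" "carrier K \<inter> (\<Inter>i\<in>J. N i) \<lhd> K"
        and j: "j \<in> I" by auto
      have eq: "carrier K \<inter> (\<Inter>i\<in>insert j J. N i) = (carrier K \<inter> (\<Inter>i\<in>J. N i)) \<inter> N j" by auto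
      show ?case
        unfolding eq using meet[OF IH(2,1) normal_N[OF j] full[OF j]]
          K.normal_subgroup_intersect[OF IH(2) normal_N[OF j]] by blast
    qed
    from this[of I] have "F ` (carrier K \<inter> (\<Inter>i\<in>I. N i)) = carrier G" by simp
    moreover have "carrier K \<inter> (\<Inter>i\<in>I. N i) \<subseteq> {\<one>\<^bsub>K\<^esub>}"
      using joint by (auto simp: N_def kernel_def)
    ultimately have "carrier G \<subseteq> F ` {\<one>\<^bsub>K\<^esub>}" by (metis image_mono)
    then have "carrier G \<subseteq> {\<one>}" by simp
    then show False using simple_not_triv by auto
  qed
  then obtain i where i: "i \<in> I" "F ` N i = {\<one>}" by auto
  interpret fi: group_hom K G "f i" by (rule fh[OF i(1)])
  have le: "N i \<subseteq> kernel K G F" using i by (auto simp: kernel_def N_def)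
  \<comment> \<open>Otherwise \<open>K\<close> would be the product of \<open>N i\<close> and the
    kernel of \<open>F\<close>, and \<open>F\<close> would be trivial.\<close>
  have "f i ` kernel K G F \<noteq> carrier G"
  proof
    assume full: "f i ` kernel K G F = carrier G"
    have "F k = \<one>" if k: "k \<in> carrier K" for k
    proof -
      have "f i k \<in> f i ` kernel K G F" using full fi.hom_closed[OF k] by simp
      then obtain r where r: "r \<in> carrier K" "F r = \<one>" "f i k = f i r"
        by (auto simp: kernel_def)
      then have "k \<otimes>\<^bsub>K\<^esub> inv\<^bsub>K\<^esub> r \<in> N i" using k by (simp add: N_def kernel_def)
      then have "F (k \<otimes>\<^bsub>K\<^esub> inv\<^bsub>K\<^esub> r) = \<one>" using i(2) by auto
      then show ?thesis using k r by simp
    qed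
    then have "carrier G \<subseteq> {\<one>}" using F(2) by auto
    then show False using simple_not_triv by auto
  qed
  then have "f i ` kernel K G F = {\<one>}"
    using dich[OF fh[OF i(1)] F.normal_kernel f(2)[OF i(1)]] by auto
  then have "kernel K G F \<subseteq> N i" by (auto simp: N_def kernel_def)
  with le i(1) show ?thesis unfolding N_def by blast
qed

text \<open>An abstract homomorphism into a wreath product: \<open>\<sigma> q i\<close> is the label
  picked up when \<open>q\<close> moves \<open>i\<close> to \<open>\<pi> q i\<close>, and
  \<open>lab_mult\<close> is the cocycle rule, by which labels of loops at \<open>i0\<close>
  multiply homomorphically. \<open>faithful\<close> embeds the kernel of \<open>\<phi>\<close> into
  a power of \<open>S\<close>, and \<open>lab_surj\<close> makes the label at \<open>i0\<close> an
  epimorphism on the stabiliser.\<close>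

locale labelled_extension = Q: group Q + S: simple_group S + phi: group_hom Q G \<phi>
  for Q (structure) and S (structure) and G (structure) and \<phi> +
  fixes \<pi> :: "'a \<Rightarrow> 'i \<Rightarrow> 'i" and \<sigma> :: "'a \<Rightarrow> 'i \<Rightarrow> 'c" and I :: "'i set" and i0 :: 'i
  assumes fin: "finite (carrier Q)" "finite I" and base: "i0 \<in> I"
    and noncomm: "\<exists>a\<in>carrier S. \<exists>b\<in>carrier S. a \<otimes>\<^bsub>S\<^esub> b \<noteq> b \<otimes>\<^bsub>S\<^esub> a"
    and act_closed: "\<lbrakk>q \<in> carrier Q; i \<in> I\<rbrakk> \<Longrightarrow> \<pi> q i \<in> I"
    and act_mult: "\<lbrakk>q \<in> carrier Q; r \<in> carrier Q; i \<in> I\<rbrakk> \<Longrightarrow> \<pi> (q \<otimes>\<^bsub>Q\<^esub> r) i = \<pi> q (\<pi> r i)"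
    and act_ker: "\<lbrakk>q \<in> carrier Q; \<phi> q = \<one>\<^bsub>G\<^esub>; i \<in> I\<rbrakk> \<Longrightarrow> \<pi> q i = i"
    and transitive: "i \<in> I \<Longrightarrow> \<exists>q\<in>carrier Q. \<pi> q i0 = i"
    and lab_closed: "\<lbrakk>q \<in> carrier Q; i \<in> I\<rbrakk> \<Longrightarrow> \<sigma> q i \<in> carrier S"
    and lab_mult: "\<lbrakk>q \<in> carrier Q; r \<in> carrier Q; i \<in> I\<rbrakk>
      \<Longrightarrow> \<sigma> (q \<otimes>\<^bsub>Q\<^esub> r) i = \<sigma> q (\<pi> r i) \<otimes>\<^bsub>S\<^esub> \<sigma> r i"
    and faithful: "\<lbrakk>q \<in> carrier Q; \<phi> q = \<one>\<^bsub>G\<^esub>; \<And>i. i \<in> I \<Longrightarrow> \<sigma> q i = \<one>\<^bsub>S\<^esub>\<rbrakk> \<Longrightarrow> q = \<one>\<^bsub>Q\<^esub>"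
    and lab_surj: "s \<in> carrier S \<Longrightarrow> \<exists>q\<in>carrier Q. \<pi> q i0 = i0 \<and> \<sigma> q i0 = s"
begin

definition K where "K = kernel Q G \<phi>"

definition stab where "stab = {q \<in> carrier Q. \<pi> q i0 = i0}"

lemma K_iff: "k \<in> K \<longleftrightarrow> k \<in> carrier Q \<and> \<phi> k = \<one>\<^bsub>G\<^esub>"
  by (auto simp: K_def kernel_def)

lemma K_normal: "K \<lhd> Q"
  unfolding K_def by (rule phi.normal_kernel)

lemma act_one: "i \<in> I \<Longrightarrow> \<pi> \<one>\<^bsub>Q\<^esub> i = i"
  by (rule act_ker) auto

lemma act_inv: "\<lbrakk>q \<in> carrier Q; i \<in> I\<rbrakk> \<Longrightarrow> \<pi> (inv\<^bsub>Q\<^esub> q) (\<pi> q i) = i"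
  using act_mult[of "inv\<^bsub>Q\<^esub> q" q i] act_one by simp

lemma act_inj: "q \<in> carrier Q \<Longrightarrow> inj_on (\<pi> q) I"
  by (metis act_inv inj_onI)

lemma act_surj: "q \<in> carrier Q \<Longrightarrow> \<pi> q ` I = I"
  by (rule endo_inj_surj) (use fin act_closed act_inj in auto)

lemma lab_one: "i \<in> I \<Longrightarrow> \<sigma> \<one>\<^bsub>Q\<^esub> i = \<one>\<^bsub>S\<^esub>"
  using lab_mult[of "\<one>\<^bsub>Q\<^esub>" "\<one>\<^bsub>Q\<^esub>" i] act_one[of i] lab_closed[of "\<one>\<^bsub>Q\<^esub>" i]
  by (simp add: S.l_cancel_one)

lemma conj_in_K: "\<lbrakk>q \<in> carrier Q; k \<in> K\<rbrakk> \<Longrightarrow> q \<otimes>\<^bsub>Q\<^esub> k \<otimes>\<^bsub>Q\<^esub> inv\<^bsub>Q\<^esub> q \<in> K"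
  using normal.inv_op_closed2[OF K_normal] .

text \<open>Conjugation by \<open>q\<close> carries coordinate \<open>i\<close> of an element of
  \<open>K\<close> to coordinate \<open>\<pi> q i\<close>, up to an inner automorphism of
  \<open>S\<close>. Hence \<open>Q\<close> permutes the coordinate kernels as it permutes
  \<open>I\<close>.\<close>

lemma lab_conj:
  assumes "q \<in> carrier Q" "k \<in> K" "i \<in> I"
  shows "\<sigma> (q \<otimes>\<^bsub>Q\<^esub> k \<otimes>\<^bsub>Q\<^esub> inv\<^bsub>Q\<^esub> q) (\<pi> q i) = \<sigma> q i \<otimes>\<^bsub>S\<^esub> \<sigma> k i \<otimes>\<^bsub>S\<^esub> inv\<^bsub>S\<^esub> (\<sigma> q i)"
proof -
  have k: "k \<in> carrier Q" "\<pi> k i = i" using assms act_ker by (auto simp: K_iff)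
  have "\<sigma> (inv\<^bsub>Q\<^esub> q) (\<pi> q i) \<otimes>\<^bsub>S\<^esub> \<sigma> q i = \<one>\<^bsub>S\<^esub>"
    using lab_mult[of "inv\<^bsub>Q\<^esub> q" q i] lab_one assms by simp
  then have "inv\<^bsub>S\<^esub> (\<sigma> q i) = \<sigma> (inv\<^bsub>Q\<^esub> q) (\<pi> q i)"
    using assms by (intro S.inv_equality) (auto intro!: lab_closed act_closed)
  then show ?thesis
    using assms k by (simp add: lab_mult act_mult act_inv act_closed)
qed

lemma lab_conj_trivial:
  assumes "q \<in> carrier Q" "k \<in> K" "i \<in> I"
  shows "\<sigma> (q \<otimes>\<^bsub>Q\<^esub> k \<otimes>\<^bsub>Q\<^esub> inv\<^bsub>Q\<^esub> q) (\<pi> q i) = \<one>\<^bsub>S\<^esub> \<longleftrightarrow> \<sigma> k i = \<one>\<^bsub>S\<^esub>"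
proof -
  have c: "\<sigma> q i \<in> carrier S" "\<sigma> k i \<in> carrier S"
    using assms by (auto simp: K_iff intro: lab_closed)
  then show ?thesis using lab_conj[OF assms] S.conj_eq_one_iff by simp
qed

lemma lab_hom_K: "i \<in> I \<Longrightarrow> (\<lambda>k. \<sigma> k i) \<in> hom (Q\<lparr>carrier := K\<rparr>) S"
  by (rule homI) (auto simp: K_iff lab_closed lab_mult act_ker)

lemma stab_subgroup: "subgroup stab Q"
proof
  show "inv\<^bsub>Q\<^esub> q \<in> stab" if "q \<in> stab" for q
    using that act_inv[of q i0] base by (auto simp: stab_def)
qed (auto simp: stab_def act_mult act_one base)

lemma K_le_stab: "K \<subseteq> stab"
  using act_ker base by (auto simp: K_iff stab_def)

lemma lab_hom_stab: "(\<lambda>q. \<sigma> q i0) \<in> hom (Q\<lparr>carrier := stab\<rparr>) S"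
  by (rule homI) (auto simp: stab_def lab_closed lab_mult base)

lemma lab_stab_image: "(\<lambda>q. \<sigma> q i0) ` stab = carrier S"
  using lab_surj lab_closed base by (auto simp: stab_def image_iff)

lemma normal_K_in:
  assumes "subgroup P Q" "K \<subseteq> P"
  shows "K \<lhd> Q\<lparr>carrier := P\<rparr>"
  using Q.normal_restrict_supergroup[OF assms(1) K_normal assms(2)] .

text \<open>\<open>K\<close> is normal in \<open>P\<close> and \<open>F\<close> is onto, so the
  image of \<open>K\<close> is normal in the simple group \<open>S\<close>.\<close>

lemma image_K_dichotomy:
  assumes "subgroup P Q" "K \<subseteq> P" "F \<in> hom (Q\<lparr>carrier := P\<rparr>) S" "F ` P = carrier S"
  shows "F ` K = carrier S \<or> F ` K = {\<one>\<^bsub>S\<^esub>}"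
proof -
  interpret F: group_hom "Q\<lparr>carrier := P\<rparr>" S F
    using assms Q.subgroup_imp_group S.is_group by (intro group_hom.intro group_hom_axioms.intro) auto
  show ?thesis
    using S.no_real_normal_subgroup[OF F.normal_image[OF normal_K_in[OF assms(1,2)]]] assms(4) by auto
qed

end

text \<open>The kernels of the maps \<open>\<lambda>k. \<sigma> k i\<close> on \<open>K\<close> are permuted transitively, so the classes of
  indices with equal kernels all have the same size, which divides \<open>card I\<close>. A single \<open>w\<close> with few
  trivial labels therefore separates all of them.\<close>

locale separated_extension = labelled_extension +
  fixes w
  assumes w: "w \<in> carrier Q" "\<phi> w = \<one>\<^bsub>G\<^esub>"
    and w_trivial: "{i \<in> I. \<sigma> w i = \<one>\<^bsub>S\<^esub>} \<noteq> {}" "{i \<in> I. \<sigma> w i = \<one>\<^bsub>S\<^esub>} \<noteq> I"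
    and w_few: "\<And>d. \<lbrakk>d dvd card I; d \<noteq> 1\<rbrakk> \<Longrightarrow> card {i \<in> I. \<sigma> w i = \<one>\<^bsub>S\<^esub>} < d"
begin

text \<open>A nontrivial label of \<open>w\<close> is conjugated to \<open>i0\<close>. There the
  label is an epimorphism on all of \<open>stab\<close>, so the image of \<open>K\<close> is normal
  in \<open>S\<close> and therefore everything. Conjugation then carries this to any other
  \<open>i\<close>.\<close>

lemma lab_K_image:
  assumes "i \<in> I"
  shows "(\<lambda>k. \<sigma> k i) ` K = carrier S"
proof -
  obtain j where j: "j \<in> I" "\<sigma> w j \<noteq> \<one>\<^bsub>S\<^esub>" using w_trivial by auto
  obtain q where q: "q \<in> carrier Q" "\<pi> q i0 = j" using transitive[OF j(1)] by auto
  have wK: "w \<in> K" using w by (simp add: K_iff)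
  define v where "v = inv\<^bsub>Q\<^esub> q \<otimes>\<^bsub>Q\<^esub> w \<otimes>\<^bsub>Q\<^esub> q"
  have "v \<in> K" using conj_in_K[of "inv\<^bsub>Q\<^esub> q" w] q wK by (simp add: v_def)
  moreover have "\<sigma> v i0 \<noteq> \<one>\<^bsub>S\<^esub>"
    using lab_conj_trivial[of "inv\<^bsub>Q\<^esub> q" w j] q wK j act_inv[of q i0] base by (simp add: v_def)
  ultimately have "(\<lambda>k. \<sigma> k i0) ` K \<noteq> {\<one>\<^bsub>S\<^esub>}" by auto
  then have full: "(\<lambda>k. \<sigma> k i0) ` K = carrier S"
    using image_K_dichotomy[OF stab_subgroup K_le_stab lab_hom_stab lab_stab_image] by auto
  obtain r where r: "r \<in> carrier Q" "\<pi> r i0 = i" using transitive[OF assms] by auto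
  show ?thesis
  proof (intro equalityI subsetI)
    fix s assume s: "s \<in> carrier S"
    have c: "\<sigma> r i0 \<in> carrier S" using r base by (auto intro: lab_closed)
    obtain k where k: "k \<in> K" "\<sigma> k i0 = inv\<^bsub>S\<^esub> (\<sigma> r i0) \<otimes>\<^bsub>S\<^esub> s \<otimes>\<^bsub>S\<^esub> \<sigma> r i0"
      using full s c by (metis (no_types, lifting) S.inv_closed S.m_closed imageE)
    have "\<sigma> (r \<otimes>\<^bsub>Q\<^esub> k \<otimes>\<^bsub>Q\<^esub> inv\<^bsub>Q\<^esub> r) i = s"
      using lab_conj[OF r(1) k(1) base] r(2) k(2) s c
      by (simp add: S.m_assoc S.inv_solve_left) (simp add: S.m_assoc[symmetric])
    then show "s \<in> (\<lambda>k. \<sigma> k i) ` K" using conj_in_K[OF r(1) k(1)] by (metis imageI)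
  qed (use assms in \<open>auto simp: K_iff intro: lab_closed\<close>)
qed

lemma separated:
  assumes "i \<in> I" "j \<in> I" and eq: "\<And>k. k \<in> K \<Longrightarrow> \<sigma> k i = \<one>\<^bsub>S\<^esub> \<longleftrightarrow> \<sigma> k j = \<one>\<^bsub>S\<^esub>"
  shows "i = j"
proof -
  define C where "C i = {j \<in> I. \<forall>k\<in>K. \<sigma> k i = \<one>\<^bsub>S\<^esub> \<longleftrightarrow> \<sigma> k j = \<one>\<^bsub>S\<^esub>}" for i
  have C_act: "\<pi> q ` C i = C (\<pi> q i)" if q: "q \<in> carrier Q" and i: "i \<in> I" for q i
  proof -
    have sub: "\<pi> q ` C i \<subseteq> C (\<pi> q i)" if q: "q \<in> carrier Q" and i: "i \<in> I" for q i
    proof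
      fix j' assume "j' \<in> \<pi> q ` C i"
      then obtain j where j: "j \<in> C i" "j' = \<pi> q j" by auto
      have "\<sigma> k (\<pi> q i) = \<one>\<^bsub>S\<^esub> \<longleftrightarrow> \<sigma> k (\<pi> q j) = \<one>\<^bsub>S\<^esub>" if k: "k \<in> K" for k
      proof -
        let ?k = "inv\<^bsub>Q\<^esub> q \<otimes>\<^bsub>Q\<^esub> k \<otimes>\<^bsub>Q\<^esub> q"
        have k': "?k \<in> K" using conj_in_K[of "inv\<^bsub>Q\<^esub> q" k] q k by simp
        have "q \<otimes>\<^bsub>Q\<^esub> ?k \<otimes>\<^bsub>Q\<^esub> inv\<^bsub>Q\<^esub> q = k"
          using q k by (simp add: K_iff Q.m_assoc) (simp add: Q.m_assoc[symmetric])
        then show ?thesis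
          using lab_conj_trivial[OF q k', of i] lab_conj_trivial[OF q k', of j] i j k'
          by (auto simp: C_def)
      qed
      then show "j' \<in> C (\<pi> q i)" using j q by (auto simp: C_def act_closed)
    qed
    have "C (\<pi> q i) \<subseteq> \<pi> q ` C i"
    proof
      fix j assume j: "j \<in> C (\<pi> q i)"
      have "\<pi> (inv\<^bsub>Q\<^esub> q) j \<in> C i"
        using sub[of "inv\<^bsub>Q\<^esub> q" "\<pi> q i"] j q i act_closed act_inv[OF q i] by auto
      moreover have "\<pi> q (\<pi> (inv\<^bsub>Q\<^esub> q) j) = j"
        using act_inv[of "inv\<^bsub>Q\<^esub> q" j] q j by (simp add: C_def)
      ultimately show "j \<in> \<pi> q ` C i" by force
    qed
    with sub[OF q i] show ?thesis by auto
  qed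
  have C_card: "card (C i) = card (C i0)" if i: "i \<in> I" for i
  proof -
    obtain q where q: "q \<in> carrier Q" "\<pi> q i0 = i" using transitive[OF i] by auto
    have "C i0 \<subseteq> I" by (auto simp: C_def)
    then show ?thesis
      using C_act[OF q(1) base] q(2) card_image[OF inj_on_subset[OF act_inj[OF q(1)]]] by metis
  qed
  have "card (C i0) dvd card (\<Union>(C ` I))"
    by (rule dvd_partition) (use fin C_card in \<open>auto simp: C_def intro: finite_subset\<close>)
  moreover have "\<Union>(C ` I) = I" by (auto simp: C_def)
  ultimately have dvd: "card (C i0) dvd card I" by simp
  \<comment> \<open>The class of a point where \<open>w\<close> has trivial label lies in the
    trivial set of \<open>w\<close>, which is smaller than every divisor of \<open>card I\<close>
    other than 1.\<close>
  obtain z where z: "z \<in> I" "\<sigma> w z = \<one>\<^bsub>S\<^esub>" using w_trivial by auto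
  have "C z \<subseteq> {i \<in> I. \<sigma> w i = \<one>\<^bsub>S\<^esub>}" using w z by (auto simp: C_def K_iff)
  then have "card (C z) \<le> card {i \<in> I. \<sigma> w i = \<one>\<^bsub>S\<^esub>}" using fin by (intro card_mono) auto
  then have "card (C i0) = 1" using w_few[OF dvd] C_card[OF z(1)] by force
  then have "card (C i) = 1" using C_card assms by simp
  moreover have "i \<in> C i" "j \<in> C i" using assms by (auto simp: C_def)
  ultimately show ?thesis by (metis card_1_singletonE singletonD)
qed

text \<open>What separates \<open>P\<close> from \<open>stab\<close> is a fixed point:
  \<open>stab\<close> fixes \<open>i0\<close>, and \<open>moves\<close> denies \<open>P\<close> any.
  The two epimorphisms to pull back along a supposed isomorphism are \<open>\<theta>\<close>, whose
  kernel lies in \<open>K\<close>, and the label at \<open>i0\<close>, which is onto on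
  \<open>K\<close>.\<close>

theorem stabilizer_not_iso:
  assumes P: "subgroup P Q" "K \<subseteq> P" and moves: "\<And>i. i \<in> I \<Longrightarrow> \<exists>q\<in>P. \<pi> q i \<noteq> i"
    and \<theta>: "\<theta> \<in> hom (Q\<lparr>carrier := stab\<rparr>) S" "\<theta> ` stab = carrier S"
    and \<theta>_ker: "\<And>q. \<lbrakk>q \<in> stab; \<theta> q = \<one>\<^bsub>S\<^esub>\<rbrakk> \<Longrightarrow> q \<in> K"
  shows "\<not> Q\<lparr>carrier := P\<rparr> \<cong> Q\<lparr>carrier := stab\<rparr>"
proof
  assume "Q\<lparr>carrier := P\<rparr> \<cong> Q\<lparr>carrier := stab\<rparr>"
  then obtain \<psi> where \<psi>: "\<psi> \<in> hom (Q\<lparr>carrier := P\<rparr>) (Q\<lparr>carrier := stab\<rparr>)" "bij_betw \<psi> P stab"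
    by (auto simp: is_iso_def iso_def)
  have \<psi>_img: "\<psi> ` P = stab" using \<psi>(2) by (simp add: bij_betw_def)
  have surj: "(h \<circ> \<psi>) \<in> hom (Q\<lparr>carrier := P\<rparr>) S" "(h \<circ> \<psi>) ` P = carrier S"
    if "h \<in> hom (Q\<lparr>carrier := stab\<rparr>) S" "h ` stab = carrier S" for h
    using hom_compose[OF \<psi>(1) that(1)] that(2) \<psi>_img by (simp_all only: image_comp[symmetric])
  have "\<exists>F. F \<in> hom (Q\<lparr>carrier := P\<rparr>) S \<and> F ` P = carrier S \<and> F ` K \<noteq> {\<one>\<^bsub>S\<^esub>}"
  proof (rule ccontr)
    assume none: "\<not> ?thesis"
    \<comment> \<open>If both pullbacks were trivial on \<open>K\<close>, then \<open>\<psi>\<close>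
      would map \<open>K\<close> injectively into the elements of \<open>K\<close> with trivial
      label at \<open>i0\<close>, a proper subset of a finite set.\<close>
    have triv: "(\<theta> \<circ> \<psi>) ` K = {\<one>\<^bsub>S\<^esub>}" "((\<lambda>q. \<sigma> q i0) \<circ> \<psi>) ` K = {\<one>\<^bsub>S\<^esub>}"
      using none surj[OF \<theta>] surj[OF lab_hom_stab lab_stab_image] by blast+
    have "\<theta> (\<psi> k) = \<one>\<^bsub>S\<^esub> \<and> \<sigma> (\<psi> k) i0 = \<one>\<^bsub>S\<^esub>" if "k \<in> K" for k
      using imageI[OF that, of "\<theta> \<circ> \<psi>"] imageI[OF that, of "(\<lambda>q. \<sigma> q i0) \<circ> \<psi>"]
      unfolding triv by simp
    moreover have "\<psi> k \<in> stab" if "k \<in> K" for k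
      using that \<psi>_img P(2) by blast
    ultimately have "\<psi> ` K \<subseteq> {k \<in> K. \<sigma> k i0 = \<one>\<^bsub>S\<^esub>}"
      using \<theta>_ker by blast
    moreover have "{k \<in> K. \<sigma> k i0 = \<one>\<^bsub>S\<^esub>} \<subset> K"
    proof -
      obtain s where "s \<in> carrier S" "s \<noteq> \<one>\<^bsub>S\<^esub>" using S.simple_not_triv S.one_closed by blast
      then obtain k where "k \<in> K" "\<sigma> k i0 \<noteq> \<one>\<^bsub>S\<^esub>" using lab_K_image[OF base] by (metis imageE)
      then show ?thesis by blast
    qed
    ultimately have "\<psi> ` K \<subset> K" by auto
    moreover have fK: "finite K" by (rule finite_subset[OF _ fin(1)]) (auto simp: K_iff)
    moreover have "card (\<psi> ` K) = card K"
      by (rule card_image) (use \<psi>(2) P(2) in \<open>auto simp: bij_betw_def intro: inj_on_subset\<close>)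
    ultimately show False by (metis psubset_card_mono less_irrefl)
  qed
  then obtain F where F: "F \<in> hom (Q\<lparr>carrier := P\<rparr>) S" "F ` P = carrier S" "F ` K \<noteq> {\<one>\<^bsub>S\<^esub>}"
    by auto
  have FK: "F ` K = carrier S" using image_K_dichotomy[OF P F(1,2)] F(3) by auto
  interpret F: group_hom "Q\<lparr>carrier := P\<rparr>" S F
    using F P Q.subgroup_imp_group S.is_group by (intro group_hom.intro group_hom_axioms.intro) auto
  obtain a b where ab: "a \<in> carrier S" "b \<in> carrier S" "a \<otimes>\<^bsub>S\<^esub> b \<noteq> b \<otimes>\<^bsub>S\<^esub> a" using noncomm by auto
  have "\<exists>i\<in>I. kernel (Q\<lparr>carrier := K\<rparr>) S (\<lambda>k. \<sigma> k i) = kernel (Q\<lparr>carrier := K\<rparr>) S F"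
  proof (rule S.kernel_of_subdirect_product[OF ab])
    show "group (Q\<lparr>carrier := K\<rparr>)" using K_normal Q.subgroup_imp_group by (simp add: normal_def)
    show "F \<in> hom (Q\<lparr>carrier := K\<rparr>) S"
      using F(1) P(2) by (auto simp: hom_def)
  qed (use fin lab_hom_K lab_K_image FK faithful in \<open>auto simp: K_iff\<close>)
  then obtain i where i: "i \<in> I" and ker: "\<And>k. k \<in> K \<Longrightarrow> \<sigma> k i = \<one>\<^bsub>S\<^esub> \<longleftrightarrow> F k = \<one>\<^bsub>S\<^esub>"
    by (auto simp: kernel_def)
  \<comment> \<open>\<open>F\<close> is defined on all of \<open>P\<close>, so conjugation by
    \<open>q\<close> preserves its kernel on \<open>K\<close>, which is the kernel of coordinate
    \<open>i\<close>. But conjugation also carries that kernel to the one of coordinate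
    \<open>\<pi> q i\<close>, and \<open>separated\<close> identifies the two points.\<close>
  have "\<pi> q i = i" if q: "q \<in> P" for q
  proof -
    have qQ: "q \<in> carrier Q" using q P(1) subgroup.subset by blast
    have conj: "F (q \<otimes>\<^bsub>Q\<^esub> k \<otimes>\<^bsub>Q\<^esub> inv\<^bsub>Q\<^esub> q) = \<one>\<^bsub>S\<^esub> \<longleftrightarrow> F k = \<one>\<^bsub>S\<^esub>" if k: "k \<in> K" for k
    proof -
      have kP: "k \<in> P" "q \<otimes>\<^bsub>Q\<^esub> k \<in> P" "inv\<^bsub>Q\<^esub> q \<in> P"
        using k q P subgroup.m_closed[OF P(1)] subgroup.m_inv_closed[OF P(1)] by auto
      have "F (q \<otimes>\<^bsub>Q\<^esub> k \<otimes>\<^bsub>Q\<^esub> inv\<^bsub>Q\<^esub> q) \<otimes>\<^bsub>S\<^esub> F q = F q \<otimes>\<^bsub>S\<^esub> F k"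
      proof -
        have "q \<otimes>\<^bsub>Q\<^esub> k \<otimes>\<^bsub>Q\<^esub> inv\<^bsub>Q\<^esub> q \<otimes>\<^bsub>Q\<^esub> q = q \<otimes>\<^bsub>Q\<^esub> k"
          using qQ k by (simp add: K_iff Q.m_assoc)
        then show ?thesis
          using F.hom_mult[of "q \<otimes>\<^bsub>Q\<^esub> k \<otimes>\<^bsub>Q\<^esub> inv\<^bsub>Q\<^esub> q" q] F.hom_mult[of q k] kP q
            subgroup.m_closed[OF P(1) kP(2,3)] by simp
      qed
      moreover have "F q \<in> carrier S" "F k \<in> carrier S" "F (q \<otimes>\<^bsub>Q\<^esub> k \<otimes>\<^bsub>Q\<^esub> inv\<^bsub>Q\<^esub> q) \<in> carrier S"
        using F.hom_closed q kP subgroup.m_closed[OF P(1) kP(2,3)] by auto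
      ultimately show ?thesis by (metis S.l_cancel_one S.r_cancel_one)
    qed
    have "\<sigma> k i = \<one>\<^bsub>S\<^esub> \<longleftrightarrow> \<sigma> k (\<pi> q i) = \<one>\<^bsub>S\<^esub>" if k: "k \<in> K" for k
    proof -
      let ?k = "inv\<^bsub>Q\<^esub> q \<otimes>\<^bsub>Q\<^esub> k \<otimes>\<^bsub>Q\<^esub> q"
      have k': "?k \<in> K" using conj_in_K[of "inv\<^bsub>Q\<^esub> q" k] qQ k by simp
      have eq: "q \<otimes>\<^bsub>Q\<^esub> ?k \<otimes>\<^bsub>Q\<^esub> inv\<^bsub>Q\<^esub> q = k"
        using qQ k by (simp add: K_iff Q.m_assoc) (simp add: Q.m_assoc[symmetric])
      show ?thesis
        using lab_conj_trivial[OF qQ k' i] conj[OF k'] ker[OF k] ker[OF k'] unfolding eq by simp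
    qed
    then show ?thesis using separated[OF i act_closed[OF qQ i]] by simp
  qed
  then show False using moves[OF i] by auto
qed

end

section \<open>Wreath products and transport to the natural numbers\<close>

text \<open>The direct product of \<open>G\<close> with the wreath product of \<open>S\<close> by
  the permutations of \<open>I\<close>. Carrying \<open>G\<close> along as a component makes
  \<open>fst\<close> the projection of every subgroup to \<open>G\<close>. The right factor acts
  first, so the left label is read at \<open>p' i\<close>.\<close>

definition wreath :: "('g, 'm) monoid_scheme \<Rightarrow> ('s, 'n) monoid_scheme \<Rightarrow> 'i set \<Rightarrow> ('g \<times> ('i \<Rightarrow> 'i) \<times> ('i \<Rightarrow> 's)) monoid" where
  "wreath G S I = \<lparr> carrier = {(g,p,s). g \<in> carrier G \<and> p permutes I \<and> s \<in> I \<rightarrow>\<^sub>E carrier S},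
     mult = (\<lambda>(g,p,s) (g',p',s'). (g \<otimes>\<^bsub>G\<^esub> g', p \<circ> p', \<lambda>i\<in>I. s (p' i) \<otimes>\<^bsub>S\<^esub> s' i)),
     one = (\<one>\<^bsub>G\<^esub>, id, \<lambda>i\<in>I. \<one>\<^bsub>S\<^esub>) \<rparr>"

lemma wreath_carrier: "(g,p,s) \<in> carrier (wreath G S I) \<longleftrightarrow> g \<in> carrier G \<and> p permutes I \<and> s \<in> I \<rightarrow>\<^sub>E carrier S"
  by (simp add: wreath_def)

lemma wreath_mult: "(g,p,s) \<otimes>\<^bsub>wreath G S I\<^esub> (g',p',s') = (g \<otimes>\<^bsub>G\<^esub> g', p \<circ> p', \<lambda>i\<in>I. s (p' i) \<otimes>\<^bsub>S\<^esub> s' i)"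
  by (simp add: wreath_def)

lemma wreath_one: "\<one>\<^bsub>wreath G S I\<^esub> = (\<one>\<^bsub>G\<^esub>, id, \<lambda>i\<in>I. \<one>\<^bsub>S\<^esub>)"
  by (simp add: wreath_def)

lemma group_wreath:
  assumes "group G" "group S"
  shows "group (wreath G S I)"
proof -
  interpret G: group G by fact
  interpret S: group S by fact
  have mem: "s (p i) \<in> carrier S" if "s \<in> I \<rightarrow>\<^sub>E carrier S" "p permutes I" "i \<in> I" for s p i
    using that by (auto simp: permutes_in_image)
  have mem': "s i \<in> carrier S" if "s \<in> I \<rightarrow>\<^sub>E carrier S" "i \<in> I" for s i
    using that by auto
  show ?thesis
  proof (rule groupI)
    show "\<one>\<^bsub>wreath G S I\<^esub> \<in> carrier (wreath G S I)"
      by (simp add: wreath_one wreath_carrier permutes_id)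
  next
    fix a b assume "a \<in> carrier (wreath G S I)" "b \<in> carrier (wreath G S I)"
    then show "a \<otimes>\<^bsub>wreath G S I\<^esub> b \<in> carrier (wreath G S I)"
    proof -
      obtain g p s g' p' s' where eq: "a = (g,p,s)" "b = (g',p',s')" by (metis prod_cases3)
      have w: "g \<in> carrier G" "g' \<in> carrier G" "p permutes I" "p' permutes I"
        "s \<in> I \<rightarrow>\<^sub>E carrier S" "s' \<in> I \<rightarrow>\<^sub>E carrier S"
        using \<open>a \<in> _\<close> \<open>b \<in> _\<close> by (simp_all add: eq wreath_carrier)
      have "(\<lambda>i\<in>I. s (p' i) \<otimes>\<^bsub>S\<^esub> s' i) \<in> I \<rightarrow>\<^sub>E carrier S"
        using mem[OF w(5,4)] mem'[OF w(6)] by (simp only: restrict_PiE_iff) simp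
      then show ?thesis
        using w permutes_compose[OF w(4,3)] by (simp add: eq wreath_mult wreath_carrier)
    qed
  next
    fix a b c
    assume "a \<in> carrier (wreath G S I)" "b \<in> carrier (wreath G S I)" "c \<in> carrier (wreath G S I)"
    then show "a \<otimes>\<^bsub>wreath G S I\<^esub> b \<otimes>\<^bsub>wreath G S I\<^esub> c = a \<otimes>\<^bsub>wreath G S I\<^esub> (b \<otimes>\<^bsub>wreath G S I\<^esub> c)"
    proof -
      obtain g p s g' p' s' g'' p'' s''
        where eq: "a = (g,p,s)" "b = (g',p',s')" "c = (g'',p'',s'')" by (metis prod_cases3)
      have w: "g \<in> carrier G" "g' \<in> carrier G" "g'' \<in> carrier G" "p' permutes I" "p'' permutes I"
        "s \<in> I \<rightarrow>\<^sub>E carrier S" "s' \<in> I \<rightarrow>\<^sub>E carrier S" "s'' \<in> I \<rightarrow>\<^sub>E carrier S"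
        using \<open>a \<in> _\<close> \<open>b \<in> _\<close> \<open>c \<in> _\<close> by (simp_all add: eq wreath_carrier)
      have "(\<lambda>i\<in>I. (\<lambda>i\<in>I. s (p' i) \<otimes>\<^bsub>S\<^esub> s' i) (p'' i) \<otimes>\<^bsub>S\<^esub> s'' i)
        = (\<lambda>i\<in>I. s ((p' \<circ> p'') i) \<otimes>\<^bsub>S\<^esub> (\<lambda>i\<in>I. s' (p'' i) \<otimes>\<^bsub>S\<^esub> s'' i) i)"
      proof (rule restrict_ext)
        fix i assume i: "i \<in> I"
        then have i': "p'' i \<in> I" "p' (p'' i) \<in> I" using w(4,5) by (simp_all add: permutes_in_image)
        show "(\<lambda>i\<in>I. s (p' i) \<otimes>\<^bsub>S\<^esub> s' i) (p'' i) \<otimes>\<^bsub>S\<^esub> s'' i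
          = s ((p' \<circ> p'') i) \<otimes>\<^bsub>S\<^esub> (\<lambda>i\<in>I. s' (p'' i) \<otimes>\<^bsub>S\<^esub> s'' i) i"
          using i i' mem'[OF w(6) i'(2)] mem'[OF w(7) i'(1)] mem'[OF w(8) i] by (simp add: S.m_assoc)
      qed
      then show ?thesis using w(1-3) by (simp add: eq wreath_mult G.m_assoc comp_assoc)
    qed
  next
    fix a assume "a \<in> carrier (wreath G S I)"
    then show "\<one>\<^bsub>wreath G S I\<^esub> \<otimes>\<^bsub>wreath G S I\<^esub> a = a"
      by (cases a) (auto simp: wreath_carrier wreath_mult wreath_one permutes_in_image fun_eq_iff PiE_iff extensional_def)
  next
    fix a assume a: "a \<in> carrier (wreath G S I)"
    obtain g p s where [simp]: "a = (g,p,s)" by (cases a)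
    have gps: "g \<in> carrier G" "p permutes I" "s \<in> I \<rightarrow>\<^sub>E carrier S" using a by (auto simp: wreath_carrier)
    let ?b = "(inv\<^bsub>G\<^esub> g, inv_into UNIV p, \<lambda>i\<in>I. inv\<^bsub>S\<^esub> (s (inv_into UNIV p i)))"
    have pi: "inv_into UNIV p permutes I" by (rule permutes_inv[OF gps(2)])
    have "(\<lambda>i\<in>I. inv\<^bsub>S\<^esub> (s (inv_into UNIV p i))) \<in> I \<rightarrow>\<^sub>E carrier S"
      using mem[OF gps(3) pi] by (simp only: restrict_PiE_iff) simp
    then have "?b \<in> carrier (wreath G S I)"
      using gps pi by (simp add: wreath_carrier)
    moreover have "?b \<otimes>\<^bsub>wreath G S I\<^esub> a = \<one>\<^bsub>wreath G S I\<^esub>"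
    proof -
      have "(\<lambda>i\<in>I. (\<lambda>i\<in>I. inv\<^bsub>S\<^esub> (s (inv_into UNIV p i))) (p i) \<otimes>\<^bsub>S\<^esub> s i) = (\<lambda>i\<in>I. \<one>\<^bsub>S\<^esub>)"
        using mem'[OF gps(3)]
        by (intro restrict_ext) (simp add: permutes_in_image[OF gps(2)] permutes_inverses[OF gps(2)])
      then show ?thesis using gps by (simp add: wreath_mult wreath_one permutes_inv_o)
    qed
    ultimately show "\<exists>b\<in>carrier (wreath G S I). b \<otimes>\<^bsub>wreath G S I\<^esub> a = \<one>\<^bsub>wreath G S I\<^esub>" by blast
  qed
qed

lemma finite_wreath:
  assumes "finite (carrier G)" "finite (carrier S)" "finite I"
  shows "finite (carrier (wreath G S I))"
proof (rule finite_subset)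
  show "carrier (wreath G S I) \<subseteq> carrier G \<times> {p. p permutes I} \<times> (I \<rightarrow>\<^sub>E carrier S)"
    using wreath_carrier by fast
qed (use assms in \<open>auto intro!: finite_cartesian_product finite_permutations finite_PiE\<close>)

text \<open>The theorem asks for a quotient whose elements are natural numbers; an enumeration of
  the finite carrier transports the multiplication.\<close>

lemma iso_nat_monoid:
  assumes "group Q" "finite (carrier Q)"
  shows "\<exists>(R :: nat monoid) h. group R \<and> h \<in> iso R Q"
proof -
  interpret Q: group Q by fact
  obtain f n where f: "bij_betw f (carrier Q) {i::nat. i < n}"
    using finite_imp_inj_to_nat_seg[OF assms(2)] by (metis bij_betw_def)
  define g where "g = the_inv_into (carrier Q) f"
  have g: "bij_betw g {i. i < n} (carrier Q)" unfolding g_def by (rule bij_betw_the_inv_into[OF f])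
  have gf: "g (f q) = q" if "q \<in> carrier Q" for q
    using f that by (simp add: g_def bij_betw_def the_inv_into_f_f)
  define R where "R = \<lparr> carrier = {i. i < n}, mult = (\<lambda>i j. f (g i \<otimes>\<^bsub>Q\<^esub> g j)), one = f \<one>\<^bsub>Q\<^esub> \<rparr>"
  have fc: "f q < n" if "q \<in> carrier Q" for q using f that by (auto simp: bij_betw_def)
  have gc: "g i \<in> carrier Q" if "i < n" for i using g that by (auto simp: bij_betw_def)
  have fg: "f (g i) = i" if "i < n" for i
    using f that unfolding g_def bij_betw_def by (intro f_the_inv_into_f) auto
  have "group R"
  proof (rule groupI)
    fix i assume i: "i \<in> carrier R"
    then show "\<exists>j\<in>carrier R. j \<otimes>\<^bsub>R\<^esub> i = \<one>\<^bsub>R\<^esub>"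
      by (intro bexI[of _ "f (inv\<^bsub>Q\<^esub> (g i))"]) (simp_all add: R_def gf gc fc)
  qed (auto simp: R_def gf gc fc fg Q.m_assoc)
  moreover have "g \<in> iso R Q"
    using g by (auto simp: iso_def hom_def R_def gc gf)
  ultimately show ?thesis by blast
qed

lemma Gamma_quotient_iso:
  assumes Q: "Gamma_quotient Q" and R: "group R" and h: "h \<in> iso Q R"
  shows "Gamma_quotient R"
proof -
  interpret Q: group Q using Q by (simp add: Gamma_quotient_def)
  interpret R: group R by fact
  interpret h: group_hom Q R h using h by unfold_locales (simp add: iso_def)
  have img: "h ` carrier Q = carrier R" using h by (auto simp: iso_def bij_betw_def)
  obtain x y z where c: "x \<in> carrier Q" "y \<in> carrier Q" "z \<in> carrier Q"
    and r: "x [^]\<^bsub>Q\<^esub> (2::nat) = \<one>\<^bsub>Q\<^esub>" "y [^]\<^bsub>Q\<^esub> (2::nat) = \<one>\<^bsub>Q\<^esub>" "z [^]\<^bsub>Q\<^esub> (3::nat) = \<one>\<^bsub>Q\<^esub>"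
      "(y \<otimes>\<^bsub>Q\<^esub> z) [^]\<^bsub>Q\<^esub> (2::nat) = \<one>\<^bsub>Q\<^esub>" "(z \<otimes>\<^bsub>Q\<^esub> x) [^]\<^bsub>Q\<^esub> (5::nat) = \<one>\<^bsub>Q\<^esub>"
      "(x \<otimes>\<^bsub>Q\<^esub> y) [^]\<^bsub>Q\<^esub> (3::nat) = \<one>\<^bsub>Q\<^esub>" and gen: "generate Q {x,y,z} = carrier Q"
    using Q unfolding Gamma_quotient_def by blast
  have pow: "h u [^]\<^bsub>R\<^esub> n = \<one>\<^bsub>R\<^esub>" if "u \<in> carrier Q" "u [^]\<^bsub>Q\<^esub> n = \<one>\<^bsub>Q\<^esub>" for u and n :: nat
    using h.hom_nat_pow[OF that(1), of n] that(2) by simp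
  have "generate R {h x, h y, h z} = carrier R"
    using h.generate_img[of "{x,y,z}"] c gen img by simp
  moreover have "finite (carrier R)"
    using Q img by (metis Gamma_quotient_def finite_imageI)
  ultimately show ?thesis
    unfolding Gamma_quotient_def
    using R.is_group c pow[OF _ r(1)] pow[OF _ r(2)] pow[OF _ r(3)] pow[OF _ r(4)] pow[OF _ r(5)] pow[OF _ r(6)]
    by (intro conjI bexI[of _ "h x"] bexI[of _ "h y"] bexI[of _ "h z"]) simp_all
qed

lemma iso_restrict_carrier:
  assumes "h \<in> iso R Q" "A \<subseteq> carrier R"
  shows "R\<lparr>carrier := A\<rparr> \<cong> Q\<lparr>carrier := h ` A\<rparr>"
proof -
  have "h \<in> iso (R\<lparr>carrier := A\<rparr>) (Q\<lparr>carrier := h ` A\<rparr>)"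
    using assms by (auto simp: iso_def hom_def bij_betw_def subset_iff intro: inj_on_subset)
  then show ?thesis by (auto simp: is_iso_def)
qed

section \<open>Evaluation over initial segments\<close>

text \<open>Supplements \<open>upt_rec_numeral\<close>, which needs a numeral as lower bound, at the
  lower bounds 0 and \<open>Suc 0\<close>. A \<open>list_all2\<close> statement about a table then
  unrolls into one rewrite rule per entry.\<close>

lemma upt_unroll:
  "[0..<numeral n] = 0 # [Suc 0..<numeral n]"
  "[Suc 0..<numeral n] = (if n = num.One then [] else Suc 0 # [2..<numeral n])"
  by (cases n; simp add: upt_conv_Cons numeral_2_eq_2)+

lemma list_all2_uptI:
  "length xs = n \<Longrightarrow> (\<And>i. i < n \<Longrightarrow> P i (xs ! i)) \<Longrightarrow> list_all2 P [0..<n] xs"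
  by (simp add: list_all2_conv_all_nth)

text \<open>Unlike a bounded quantifier, \<open>all_below\<close> keeps its predicate unapplied, so that the simplifier
  meets only instances at numerals.\<close>

definition all_below :: "(nat \<Rightarrow> bool) \<Rightarrow> nat \<Rightarrow> bool" where "all_below P n \<longleftrightarrow> (\<forall>i<n. P i)"

lemma all_below_simps:
  "all_below P 0" "all_below P (Suc 0) \<longleftrightarrow> P 0"
  "all_below P (numeral k) \<longleftrightarrow> P (pred_numeral k) \<and> all_below P (pred_numeral k)"
  by (auto simp: all_below_def numeral_eq_Suc less_Suc_eq)

section \<open>The alternating group of degree 5\<close>

text \<open>All twenty 3-cycles on the points 1 to 5.\<close>

definition tri_list :: "(nat \<times> nat \<times> nat) list" where
 "tri_list = [
  (1,2,3),(1,2,4),(1,2,5),(1,3,2),(1,3,4),(1,3,5),(1,4,2),(1,4,3),(1,4,5),(1,5,2),(1,5,3),(1,5,4),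
   (2,3,4),(2,3,5),(2,4,3),(2,4,5),(2,5,3),(2,5,4),(3,4,5),(3,5,4)]"

text \<open>The sixty even permutations as products of two 3-cycles, given by positions in
  \<open>tri_list\<close>. In this form both membership in the alternating group and generation by
  3-cycles are immediate.\<close>

definition lab_list :: "(nat \<times> nat) list" where
 "lab_list = [
  (0,3),(4,8),(5,11),(12,18),(0,4),(0,5),(1,7),(1,8),(12,13),(2,10),(2,11),(12,17),(1,15),(0,12),
   (0,13),(1,12),(0,18),(0,19),(0,15),(0,14),(1,19),(0,17),(0,16),(1,16),(0,0),(3,18),(3,19),
   (4,18),(1,3),(2,3),(0,1),(3,15),(1,5),(0,2),(3,17),(2,4),(3,8),(1,1),(6,19),(0,6),(2,6),(4,5),
   (0,8),(0,7),(5,6),(6,16),(2,7),(1,2),(3,11),(2,2),(6,10),(0,9),(1,9),(4,11),(0,11),(0,10),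
   (4,9),(7,9),(1,10),(1,11)]"

text \<open>Row \<open>k\<close> of \<open>comm_list\<close> consists of some \<open>g\<close> and of the 3-cycle that is the commutator of \<open>lab (Suc k)\<close> and \<open>lab g\<close>;
  row \<open>j\<close> of \<open>conj_list\<close> conjugates the 3-cycle \<open>j\<close> to the 3-cycle 0. Hence a nontrivial normal subgroup contains
  all 3-cycles.\<close>

definition comm_list :: "(nat \<times> nat) list" where
 "comm_list = [
  (12,19),(12,18),(12,0),(16,13),(17,12),(16,15),(15,14),(14,1),(17,17),(15,16),(13,2),(1,18),
   (1,18),(1,18),(1,7),(1,7),(1,7),(1,11),(1,11),(1,11),(1,5),(1,5),(1,5),(1,14),(1,14),(1,14),
   (3,0),(5,18),(4,19),(7,15),(4,19),(3,0),(7,15),(5,18),(3,0),(1,17),(1,17),(1,17),(5,10),(3,11),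
   (5,13),(5,2),(3,11),(4,15),(3,11),(4,15),(5,13),(1,13),(1,13),(1,13),(4,7),(3,8),(4,12),(4,1),
   (3,8),(4,3),(3,8),(4,7),(4,12)]"

definition conj_list :: "nat list" where
 "conj_list = [
  0,2,1,3,6,9,4,10,8,5,7,11,48,36,37,50,49,38,45,57]"

definition cyc3 :: "nat \<Rightarrow> nat \<Rightarrow> nat" where
  "cyc3 j = (case tri_list ! j of (a,b,c) \<Rightarrow> cycle_of_list [a,b,c])"

definition lab :: "nat \<Rightarrow> nat \<Rightarrow> nat" where
  "lab k = cyc3 (fst (lab_list ! k)) \<circ> cyc3 (snd (lab_list ! k))"

lemma cyc3_all: "list_all2 (\<lambda>j (a,b,c). \<forall>x\<in>{1,2,3,4,5}.
    cyc3 j x = transpose a b (transpose b c x)) [0..<20] tri_list"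
  by (rule list_all2_uptI) (simp add: tri_list_def, simp add: cyc3_def split: prod.split)

lemmas cyc3_simps = cyc3_all[unfolded tri_list_def, simplified upt_unroll upt_rec_numeral,
  simplified, simplified transpose_def, simplified]

lemma lab_all: "list_all2 (\<lambda>k t. \<forall>a\<in>{1,2,3,4,5}. lab k a = cyc3 (fst t) (cyc3 (snd t) a)) [0..<60] lab_list"
  by (rule list_all2_uptI) (simp add: lab_list_def, simp add: lab_def)

lemmas lab_simps = lab_all[unfolded lab_list_def, simplified upt_unroll upt_rec_numeral,
  simplified, simplified cyc3_simps, simplified]

interpretation A5: group "alt_group 5" by (rule alt_group_is_group)

lemma alt5_comp:
  "f \<in> carrier (alt_group 5) \<Longrightarrow> g \<in> carrier (alt_group 5) \<Longrightarrow> f \<circ> g \<in> carrier (alt_group 5)"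
  using A5.m_closed by (simp only: alt_group_mult)

lemma alt5_eqI:
  assumes "f \<in> carrier (alt_group 5)" "g \<in> carrier (alt_group 5)" "\<forall>a\<in>{1,2,3,4,5}. f a = g a"
  shows "f = g"
proof
  fix a
  show "f a = g a"
  proof (cases "a \<in> {1..5}")
    case True
    then have "a = 1 \<or> a = 2 \<or> a = 3 \<or> a = 4 \<or> a = 5" by auto
    then show ?thesis using assms(3) by blast
  next
    case False
    then show ?thesis
      using assms(1,2) unfolding alt_group_carrier by (metis permutes_not_in)
  qed
qed

lemma cyc3_in_alt5:
  assumes "j < 20"
  shows "cyc3 j \<in> carrier (alt_group 5)"
proof -
  have "list_all (\<lambda>(a,b,c). distinct [a,b,c] \<and> a \<in> {1..5} \<and> b \<in> {1..5} \<and> c \<in> {1..5}) tri_list"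
    by (simp add: tri_list_def)
  moreover have "length tri_list = 20" by (simp add: tri_list_def)
  ultimately have "case tri_list ! j of (a,b,c) \<Rightarrow>
      distinct [a,b,c] \<and> a \<in> {1..5} \<and> b \<in> {1..5} \<and> c \<in> {1..5}"
    using assms by (simp add: list_all_length)
  then obtain a b c where abc: "tri_list ! j = (a,b,c)" "distinct [a,b,c]" "{a,b,c} \<subseteq> {1..5}"
    by (auto split: prod.splits)
  have "cycle_of_list [a,b,c] \<in> three_cycles 5"
    by (rule CollectI, rule exI[of _ "[a,b,c]"]) (use abc(2,3) in simp)
  then show ?thesis using three_cycles_incl[of 5] abc(1) by (auto simp: cyc3_def simp del: cycle_of_list.simps)
qed

lemma lab_list_bound:
  assumes "k < 60"
  shows "fst (lab_list ! k) < 20" "snd (lab_list ! k) < 20"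
proof -
  have "list_all (\<lambda>(s,t). s < 20 \<and> t < 20) lab_list"
    by (simp add: lab_list_def)
  moreover have "length lab_list = 60" by (simp add: lab_list_def)
  ultimately have "(\<lambda>(s,t). s < 20 \<and> t < 20) (lab_list ! k)"
    using assms by (simp add: list_all_length)
  then show "fst (lab_list ! k) < 20" "snd (lab_list ! k) < 20"
    by (auto split: prod.splits)
qed

lemma lab_in_alt5: "k < 60 \<Longrightarrow> lab k \<in> carrier (alt_group 5)"
  using lab_list_bound[of k] cyc3_in_alt5
    A5.m_closed[of "cyc3 (fst (lab_list ! k))" "cyc3 (snd (lab_list ! k))"]
  by (auto simp: lab_def alt_group_mult)

lemma inj_lab: "inj_on lab {..<60}"
proof -
  have "distinct (map (\<lambda>k. (lab k 1, lab k 2, lab k 3, lab k 4, lab k 5)) [0..<60])"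
    by (simp add: upt_unroll upt_rec_numeral lab_simps)
  then have "inj_on (\<lambda>k. (lab k 1, lab k 2, lab k 3, lab k 4, lab k 5)) {..<60}"
    by (simp add: distinct_map atLeast0LessThan)
  then show ?thesis by (auto simp: inj_on_def)
qed

lemma card_alt5: "card (carrier (alt_group 5)) = 60"
  using alt_group_card_carrier[of 5] by (simp add: fact_numeral)

text \<open>Sixty distinct even permutations exhaust a group of order 60.\<close>

lemma alt5_eq_lab: "carrier (alt_group 5) = lab ` {..<60}"
proof (rule card_subset_eq[symmetric])
  show "finite (carrier (alt_group 5))" using card_alt5 card.infinite by fastforce
  show "lab ` {..<60} \<subseteq> carrier (alt_group 5)" using lab_in_alt5 by auto
  show "card (lab ` {..<60}) = card (carrier (alt_group 5))"
    by (simp add: card_image[OF inj_lab] card_alt5)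
qed

lemma lab_0: "lab 0 = id"
proof -
  have "lab 0 \<in> carrier (alt_group 5)" "id \<in> carrier (alt_group 5)"
    using lab_in_alt5[of 0] A5.one_closed by (simp_all add: alt_group_one)
  then show ?thesis by (rule alt5_eqI) (simp add: lab_simps)
qed

text \<open>The shift by \<open>Suc\<close> skips the identity \<open>lab 0\<close>, whose
  commutators are all trivial. The commutator relation is written without inverses so that it can be
  compared at five points.\<close>

lemma comm_list_correct:
  assumes "k < 59"
  shows "\<exists>g<60. \<exists>j<20. lab (Suc k) \<circ> lab g = cyc3 j \<circ> lab g \<circ> lab (Suc k)"
proof -
  have "list_all2 (\<lambda>k (g,j). g < 60 \<and> j < 20 \<and>
      (\<forall>a\<in>{1,2,3,4,5}. lab (Suc k) (lab g a) = cyc3 j (lab g (lab (Suc k) a)))) [0..<59] comm_list"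
    by (simp add: upt_unroll upt_rec_numeral comm_list_def numeral_2_eq_2[symmetric] lab_simps cyc3_simps)
  then have "case comm_list ! k of (g,j) \<Rightarrow> g < 60 \<and> j < 20 \<and>
      (\<forall>a\<in>{1,2,3,4,5}. lab (Suc k) (lab g a) = cyc3 j (lab g (lab (Suc k) a)))"
    using assms by (simp only: list_all2_conv_all_nth) simp
  then obtain g j where gj: "g < 60" "j < 20"
      "\<forall>a\<in>{1,2,3,4,5}. (lab (Suc k) \<circ> lab g) a = (cyc3 j \<circ> lab g \<circ> lab (Suc k)) a"
    by (auto split: prod.splits)
  have "lab (Suc k) \<circ> lab g = cyc3 j \<circ> lab g \<circ> lab (Suc k)"
    by (rule alt5_eqI[OF _ _ gj(3)])
      (intro alt5_comp lab_in_alt5 cyc3_in_alt5; use assms gj in simp)+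
  then show ?thesis using gj by blast
qed

lemma conj_list_correct:
  assumes "j < 20"
  shows "\<exists>h<60. lab h \<circ> cyc3 j = cyc3 0 \<circ> lab h"
proof -
  have "list_all2 (\<lambda>j h. h < 60 \<and> (\<forall>a\<in>{1,2,3,4,5}. lab h (cyc3 j a) = cyc3 0 (lab h a))) [0..<20] conj_list"
    by (simp add: upt_unroll upt_rec_numeral conj_list_def numeral_2_eq_2[symmetric] lab_simps cyc3_simps)
  then have h: "conj_list ! j < 60"
      "\<forall>a\<in>{1,2,3,4,5}. (lab (conj_list ! j) \<circ> cyc3 j) a = (cyc3 0 \<circ> lab (conj_list ! j)) a"
    using assms by (simp_all only: list_all2_conv_all_nth) simp_all
  have "lab (conj_list ! j) \<circ> cyc3 j = cyc3 0 \<circ> lab (conj_list ! j)"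
    by (rule alt5_eqI[OF _ _ h(2)])
      (intro alt5_comp lab_in_alt5 cyc3_in_alt5; use assms h in simp)+
  then show ?thesis using h by blast
qed

lemma simple_alt5: "simple_group (alt_group 5)"
proof
  show "1 < order (alt_group 5)" by (simp add: order_def card_alt5)
next
  fix M assume M: "M \<lhd> alt_group 5"
  interpret M: normal M "alt_group 5" by fact
  show "M = carrier (alt_group 5) \<or> M = {\<one>\<^bsub>alt_group 5\<^esub>}"
  proof (cases "M = {\<one>\<^bsub>alt_group 5\<^esub>}")
    case False
    then obtain p where p: "p \<in> M" "p \<noteq> id"
      using M.one_closed by (auto simp: alt_group_one)
    then obtain k where k: "p = lab k" "k < 60" using M.subset alt5_eq_lab by auto
    with p lab_0 obtain k' where k': "k = Suc k'" "k' < 59" by (cases k) auto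
    obtain g j where gj: "g < 60" "j < 20" and eq: "p \<circ> lab g = cyc3 j \<circ> lab g \<circ> p"
      using comm_list_correct[OF k'(2)] k k' by auto
    have conj: "(t \<in> M) = (s \<in> M)"
      if "h \<in> carrier (alt_group 5)" "t \<in> carrier (alt_group 5)" "s \<in> carrier (alt_group 5)" "h \<circ> t = s \<circ> h" for h t s
    proof -
      have e: "h \<otimes>\<^bsub>alt_group 5\<^esub> t = s \<otimes>\<^bsub>alt_group 5\<^esub> h" using that(4) by (simp add: alt_group_mult)
      have "s = h \<otimes>\<^bsub>alt_group 5\<^esub> t \<otimes>\<^bsub>alt_group 5\<^esub> inv\<^bsub>alt_group 5\<^esub> h"
        unfolding e using that(1-3) by (simp add: A5.m_assoc)
      moreover have "t = inv\<^bsub>alt_group 5\<^esub> h \<otimes>\<^bsub>alt_group 5\<^esub> s \<otimes>\<^bsub>alt_group 5\<^esub> h"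
        using that(1-3) e[symmetric] by (simp add: A5.m_assoc) (simp flip: A5.m_assoc)
      ultimately show ?thesis using M.inv_op_closed1[OF that(1)] M.inv_op_closed2[OF that(1)] by metis
    qed
    have pc: "p \<in> carrier (alt_group 5)" using p M.subset by auto
    let ?g = "lab g"
    have gc: "?g \<in> carrier (alt_group 5)" "cyc3 j \<in> carrier (alt_group 5)"
      using gj lab_in_alt5 cyc3_in_alt5 by auto
    \<comment> \<open>The commutator of \<open>p\<close> and \<open>?g\<close> is \<open>p\<close>
      times the inverse of the conjugate \<open>?q\<close>, so it lies in \<open>M\<close>.\<close>
    let ?q = "?g \<otimes>\<^bsub>alt_group 5\<^esub> p \<otimes>\<^bsub>alt_group 5\<^esub> inv\<^bsub>alt_group 5\<^esub> ?g"
    have q: "?q \<in> M" using M.inv_op_closed2[OF gc(1) p(1)] .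
    have "p \<otimes>\<^bsub>alt_group 5\<^esub> ?g = cyc3 j \<otimes>\<^bsub>alt_group 5\<^esub> (?g \<otimes>\<^bsub>alt_group 5\<^esub> p)"
      using eq by (simp add: alt_group_mult comp_assoc)
    then have "p = cyc3 j \<otimes>\<^bsub>alt_group 5\<^esub> (?g \<otimes>\<^bsub>alt_group 5\<^esub> p) \<otimes>\<^bsub>alt_group 5\<^esub> inv\<^bsub>alt_group 5\<^esub> ?g"
      using A5.inv_solve_right[of p _ ?g] pc gc by simp
    then have "p = cyc3 j \<otimes>\<^bsub>alt_group 5\<^esub> ?q" using pc gc by (simp add: A5.m_assoc)
    then have "cyc3 j = p \<otimes>\<^bsub>alt_group 5\<^esub> inv\<^bsub>alt_group 5\<^esub> ?q"
      using A5.inv_solve_right[of "cyc3 j" p ?q] pc gc by simp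
    then have "cyc3 j \<in> M" using M.m_closed[OF p(1) M.m_inv_closed[OF q]] by simp
    moreover have all: "(cyc3 i \<in> M) = (cyc3 0 \<in> M)" if i: "i < 20" for i
    proof -
      obtain h where "h < 60" "lab h \<circ> cyc3 i = cyc3 0 \<circ> lab h" using conj_list_correct[OF i] by blast
      then show ?thesis using conj[OF lab_in_alt5 cyc3_in_alt5[OF i] cyc3_in_alt5[of 0]] by simp
    qed
    ultimately have "cyc3 i \<in> M" if "i < 20" for i using gj that by blast
    then have "lab k \<in> M" if "k < 60" for k
      using M.m_closed lab_list_bound[OF that] by (simp add: lab_def alt_group_mult)
    then show ?thesis using alt5_eq_lab M.subset by auto
  qed simp
qed

lemma noncomm_alt5: "\<exists>a\<in>carrier (alt_group 5). \<exists>b\<in>carrier (alt_group 5).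
    a \<otimes>\<^bsub>alt_group 5\<^esub> b \<noteq> b \<otimes>\<^bsub>alt_group 5\<^esub> a"
proof (intro bexI)
  have "(cyc3 0 \<circ> cyc3 1) 1 \<noteq> (cyc3 1 \<circ> cyc3 0) 1" by (simp add: cyc3_simps)
  then show "cyc3 0 \<otimes>\<^bsub>alt_group 5\<^esub> cyc3 1 \<noteq> cyc3 1 \<otimes>\<^bsub>alt_group 5\<^esub> cyc3 0"
    unfolding alt_group_mult by metis
qed (simp_all add: cyc3_in_alt5)

section \<open>PSL(2,29)\<close>

type_synonym mat = "int \<times> int \<times> int \<times> int"

text \<open>Integer operations are kept apart from reduction: associativity and multiplicativity of
  determinants are polynomial identities over the integers, and they pass to residues because
  reducing a factor does not change the reduced product.\<close>

definition mmul_int :: "mat \<Rightarrow> mat \<Rightarrow> mat" where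
  "mmul_int = (\<lambda>(a,b,c,d) (e,f,g,h). (a*e + b*g, a*f + b*h, c*e + d*g, c*f + d*h))"

definition reduce29 :: "mat \<Rightarrow> mat" where "reduce29 = (\<lambda>(a,b,c,d). (a mod 29, b mod 29, c mod 29, d mod 29))"

definition mmul :: "mat \<Rightarrow> mat \<Rightarrow> mat" where "mmul A B = reduce29 (mmul_int A B)"

definition mdet_int :: "mat \<Rightarrow> int" where "mdet_int = (\<lambda>(a,b,c,d). a*d - b*c)"

definition mdet :: "mat \<Rightarrow> int" where "mdet A = mdet_int A mod 29"

definition mats :: "mat set" where
  "mats = {0..<29} \<times> {0..<29} \<times> {0..<29} \<times> {0..<29}"

definition madj_int :: "mat \<Rightarrow> mat" where "madj_int = (\<lambda>(a,b,c,d). (d, -b, -c, a))"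

definition madj :: "mat \<Rightarrow> mat" where "madj A = reduce29 (madj_int A)"

definition mneg_int :: "mat \<Rightarrow> mat" where "mneg_int = (\<lambda>(a,b,c,d). (-a, -b, -c, -d))"

definition mneg :: "mat \<Rightarrow> mat" where "mneg A = reduce29 (mneg_int A)"

declare split_paired_Ex [simp del] split_paired_All [simp del]

abbreviation E :: mat where "E \<equiv> (1,0,0,1)"

lemma mod_bilinear:
  fixes a b e g m :: int
  shows "((a mod m) * e + (b mod m) * g) mod m = (a * e + b * g) mod m"
    and "(a * (e mod m) + b * (g mod m)) mod m = (a * e + b * g) mod m"
  by (metis mod_add_eq mod_mult_left_eq, metis mod_add_eq mod_mult_right_eq)

lemma reduce29_mmul_int_reduce29: "reduce29 (mmul_int (reduce29 A) B) = reduce29 (mmul_int A B)" "reduce29 (mmul_int A (reduce29 B)) = reduce29 (mmul_int A B)"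
  by (cases A; cases B; simp add: mmul_int_def reduce29_def mod_bilinear)+

lemma mmul_reduce29 [simp]: "mmul (reduce29 A) B = mmul A B" "mmul A (reduce29 B) = mmul A B"
  by (simp_all add: mmul_def reduce29_mmul_int_reduce29)

lemma mmul_int_assoc: "mmul_int (mmul_int A B) C = mmul_int A (mmul_int B C)"
  by (cases A; cases B; cases C; simp add: mmul_int_def algebra_simps)

lemma mmul_assoc: "mmul (mmul A B) C = mmul A (mmul B C)"
  by (simp add: mmul_def reduce29_mmul_int_reduce29 mmul_int_assoc)

lemma reduce29_mats [simp]: "reduce29 A \<in> mats"
  by (cases A) (simp add: reduce29_def mats_def)

lemma mmul_mats [simp]: "mmul A B \<in> mats"
  by (simp add: mmul_def)

lemma reduce29_id: "A \<in> mats \<Longrightarrow> reduce29 A = A"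
  by (cases A) (simp add: reduce29_def mats_def)

lemma mdet_reduce29 [simp]: "mdet (reduce29 A) = mdet A"
proof -
  have "(a mod m * (d mod m) - b mod m * (c mod m)) mod m = (a * d - b * c) mod m" for a b c d m :: int
    by (metis mod_diff_eq mod_mult_eq)
  then show ?thesis by (cases A) (simp add: mdet_def mdet_int_def reduce29_def)
qed

lemma mmul_E: "mmul E A = reduce29 A" "mmul A E = reduce29 A"
  by (cases A; simp add: mmul_def mmul_int_def)+

lemma mdet_mmul: "mdet (mmul A B) = mdet A * mdet B mod 29"
proof -
  have "mdet_int (mmul_int A B) = mdet_int A * mdet_int B"
    by (cases A; cases B; simp add: mmul_int_def mdet_int_def algebra_simps)
  then show ?thesis by (simp add: mmul_def) (simp add: mdet_def mod_mult_eq)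
qed

lemma reduce29_mneg_int_reduce29: "reduce29 (mneg_int (reduce29 A)) = reduce29 (mneg_int A)"
  by (cases A) (simp add: reduce29_def mneg_int_def mod_minus_eq)

lemma mneg_mmul: "mmul (mneg A) B = mneg (mmul A B)" "mmul A (mneg B) = mneg (mmul A B)"
proof -
  have "mmul_int (mneg_int A) B = mneg_int (mmul_int A B)" "mmul_int A (mneg_int B) = mneg_int (mmul_int A B)"
    by (cases A; cases B; simp add: mmul_int_def mneg_int_def)+
  then show "mmul (mneg A) B = mneg (mmul A B)" "mmul A (mneg B) = mneg (mmul A B)"
    by (simp_all add: mneg_def mmul_def reduce29_mmul_int_reduce29 reduce29_mneg_int_reduce29)
qed

lemma mneg_mneg: "mneg (mneg A) = reduce29 A"
  by (cases A) (simp add: mneg_def reduce29_mneg_int_reduce29, simp add: mneg_int_def)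

lemma mneg_mats [simp]: "mneg A \<in> mats"
  by (simp add: mneg_def)

lemma mdet_mneg [simp]: "mdet (mneg A) = mdet A"
  by (cases A) (simp add: mneg_def, simp add: mneg_int_def mdet_def mdet_int_def)

lemma SL2_carrier: "carrier (SL2 29) = {A \<in> mats. mdet A = 1}"
  by (auto simp: SL2_def mats_def mdet_def mdet_int_def)

lemma SL2_mult: "mult (SL2 29) = mmul"
  by (simp add: SL2_def fun_eq_iff split_paired_All mmul_def mmul_int_def reduce29_def)

lemma SL2_one: "one (SL2 29) = E"
  by (simp add: SL2_def)

lemma madj_mmul:
  assumes "mdet A = 1"
  shows "mmul (madj A) A = E" "mmul A (madj A) = E"
  using assms
  by (cases A; simp add: madj_def; simp add: mmul_def mmul_int_def madj_int_def reduce29_def mdet_def mdet_int_def algebra_simps)+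

lemma madj_SL2: "A \<in> carrier (SL2 29) \<Longrightarrow> madj A \<in> carrier (SL2 29)"
  by (cases A) (simp add: SL2_carrier madj_def, simp add: madj_int_def mdet_def mdet_int_def algebra_simps)

lemma group_SL2: "group (SL2 29)"
proof (rule groupI)
  show "\<one>\<^bsub>SL2 29\<^esub> \<in> carrier (SL2 29)"
    by (simp add: SL2_carrier SL2_one mats_def mdet_def mdet_int_def)
  show "\<exists>B\<in>carrier (SL2 29). B \<otimes>\<^bsub>SL2 29\<^esub> A = \<one>\<^bsub>SL2 29\<^esub>" if "A \<in> carrier (SL2 29)" for A
    using that madj_SL2[OF that] madj_mmul(1)[of A] by (auto simp: SL2_carrier SL2_one SL2_mult)
qed (auto simp: SL2_carrier SL2_mult SL2_one mmul_assoc mdet_mmul mmul_E reduce29_id)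

interpretation SL: group "SL2 29" by (rule group_SL2)

section \<open>The quotient by the centre and its automorphisms\<close>

definition N :: "mat set" where "N = {E, (28,0,0,28)}"

lemma mneg_E: "mneg E = (28,0,0,28)" by (simp add: mneg_def mneg_int_def reduce29_def)

lemma mneg_eq: "mneg A = mmul (28,0,0,28) A" "mneg A = mmul A (28,0,0,28)"
  by (metis mmul_E(1) mneg_E mneg_mmul(1) mneg_mneg reduce29_mats reduce29_id mneg_mats, metis mmul_E(2) mneg_E mneg_mmul(2) mneg_mneg reduce29_mats reduce29_id mneg_mats)

lemma inv_SL2: "A \<in> carrier (SL2 29) \<Longrightarrow> inv\<^bsub>SL2 29\<^esub> A = madj A"
  using madj_mmul(1) madj_SL2 by (intro SL.inv_equality) (auto simp: SL2_carrier SL2_one SL2_mult)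

lemma normal_N: "N \<lhd> SL2 29"
proof (rule SL.normal_invI)
  have "madj E = E" "madj (28,0,0,28) = (28,0,0,28)" by (simp_all add: madj_def madj_int_def reduce29_def)
  then show "subgroup N (SL2 29)"
    by (intro SL.subgroupI) (auto simp: N_def SL2_mult inv_SL2 SL2_carrier mats_def mdet_def mdet_int_def mmul_def mmul_int_def reduce29_def)
  fix A n assume A: "A \<in> carrier (SL2 29)" and "n \<in> N"
  then have "mmul (mmul A n) (madj A) = n"
    using madj_mmul(2)[of A] by (auto simp: N_def SL2_carrier mmul_E reduce29_id mneg_mmul mneg_E[symmetric])
  then show "A \<otimes>\<^bsub>SL2 29\<^esub> n \<otimes>\<^bsub>SL2 29\<^esub> inv\<^bsub>SL2 29\<^esub> A \<in> N"
    using A \<open>n \<in> N\<close> by (simp add: SL2_mult inv_SL2)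
qed

abbreviation G :: "mat set monoid" where "G \<equiv> PSL2 29"

lemma PSL2_eq: "G = SL2 29 Mod N"
  by (simp add: PSL2_def N_def)

interpretation P: group G
  unfolding PSL2_eq by (rule normal.factorgroup_is_group[OF normal_N])

text \<open>A coset of the centre is a pair of opposite matrices, so working in \<open>G\<close>
  amounts to working with matrices up to sign.\<close>

definition cl :: "mat \<Rightarrow> mat set" where "cl A = {A, mneg A}"

lemma cl_coset: "A \<in> mats \<Longrightarrow> cl A = N #>\<^bsub>SL2 29\<^esub> A"
  by (auto simp: cl_def r_coset_def N_def SL2_mult mneg_eq(1) mmul_E reduce29_id)

lemma cl_carrier [simp]: "A \<in> carrier (SL2 29) \<Longrightarrow> cl A \<in> carrier G"
  by (auto simp: PSL2_eq FactGroup_def RCOSETS_def cl_coset SL2_carrier)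

lemma G_cases:
  assumes "S \<in> carrier G"
  obtains A where "A \<in> carrier (SL2 29)" "S = cl A"
  using assms by (auto simp: PSL2_eq FactGroup_def RCOSETS_def cl_coset SL2_carrier)

lemma cl_mult: "A \<in> carrier (SL2 29) \<Longrightarrow> B \<in> carrier (SL2 29) \<Longrightarrow> cl A \<otimes>\<^bsub>G\<^esub> cl B = cl (mmul A B)"
  using normal.rcos_sum[OF normal_N, of A B]
  by (simp add: PSL2_eq cl_coset FactGroup_def SL2_carrier SL2_mult)

lemma cl_one: "\<one>\<^bsub>G\<^esub> = cl E"
  by (auto simp: PSL2_eq FactGroup_def cl_def mneg_E N_def)

lemma cl_eq_iff: "A \<in> mats \<Longrightarrow> B \<in> mats \<Longrightarrow> cl A = cl B \<longleftrightarrow> A = B \<or> A = mneg B"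
  by (auto simp: cl_def doubleton_eq_iff mneg_mneg reduce29_id)

lemma cl_mneg: "A \<in> mats \<Longrightarrow> cl (mneg A) = cl A"
  by (auto simp: cl_def mneg_mneg reduce29_id)

lemma mmul_SL2 [simp]: "A \<in> carrier (SL2 29) \<Longrightarrow> B \<in> carrier (SL2 29) \<Longrightarrow> mmul A B \<in> carrier (SL2 29)"
  using SL.m_closed by (simp add: SL2_mult)

lemma mneg_SL2 [simp]: "A \<in> carrier (SL2 29) \<Longrightarrow> mneg A \<in> carrier (SL2 29)"
  by (simp add: SL2_carrier)

lemma E_SL2 [simp]: "E \<in> carrier (SL2 29)"
  using SL.one_closed by (simp add: SL2_one)

lemma finite_G: "finite (carrier G)"
proof -
  have "finite (carrier (SL2 29))"
    by (rule finite_subset[of _ mats]) (auto simp: SL2_carrier mats_def)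
  moreover have "carrier G \<subseteq> cl ` carrier (SL2 29)" by (auto elim: G_cases)
  ultimately show ?thesis by (meson finite_imageI finite_subset)
qed

definition conjm :: "mat \<Rightarrow> mat \<Rightarrow> mat \<Rightarrow> mat" where "conjm M M' X = mmul (mmul M X) M'"

text \<open>\<open>M\<close> need not have determinant 1. The determinants of \<open>M\<close> and
  \<open>M'\<close> are inverse to each other, so conjugation still preserves SL(2,29); this covers
  the outer automorphisms induced by GL(2,29), which are needed because \<open>G1\<close> may lie in
  either class of A5.\<close>

lemma conjm_iso:
  assumes "mmul M M' = E" "mmul M' M = E"
  shows "(\<lambda>S. conjm M M' ` S) \<in> iso G G"
    and "\<And>X. X \<in> mats \<Longrightarrow> conjm M M' ` cl X = cl (conjm M M' X)"
proof -
  have cl: "conjm M M' ` cl X = cl (conjm M M' X)" for M M' X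
    by (auto simp: cl_def conjm_def mneg_mmul)
  then show "\<And>X. X \<in> mats \<Longrightarrow> conjm M M' ` cl X = cl (conjm M M' X)" by simp
  have dd: "mdet M * mdet M' mod 29 = 1"
    using mdet_mmul[of M M'] assms(1) by (simp add: mdet_def mdet_int_def)
  have closed: "conjm M M' X \<in> carrier (SL2 29)" if "X \<in> carrier (SL2 29)" "mdet M * mdet M' mod 29 = 1" for M M' X
    using that by (simp add: SL2_carrier conjm_def mdet_mmul mod_simps)
  have inv: "conjm M' M (conjm M M' X) = X" if "X \<in> carrier (SL2 29)" "mmul M' M = E" for M M' X
  proof -
    have "conjm M' M (conjm M M' X) = mmul (mmul (mmul M' M) X) (mmul M' M)"
      by (simp add: conjm_def mmul_assoc)
    then show ?thesis using that by (simp add: SL2_carrier mmul_E reduce29_id)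
  qed
  have hom: "conjm M M' (mmul X Y) = mmul (conjm M M' X) (conjm M M' Y)" if "mmul M' M = E" for X Y
  proof -
    have "mmul (conjm M M' X) (conjm M M' Y) = mmul (mmul (mmul M X) (mmul M' M)) (mmul Y M')"
      by (simp add: conjm_def mmul_assoc)
    then show ?thesis using that by (simp add: conjm_def mmul_assoc mmul_E)
  qed
  have fin: "conjm M' M ` conjm M M' ` S = S" if "S \<in> carrier G" "mmul M' M = E" for S M M'
  proof -
    from that(1) obtain A where A: "A \<in> carrier (SL2 29)" "S = cl A" by (rule G_cases)
    then show ?thesis using inv[OF A(1) that(2)] by (simp add: cl)
  qed
  have img: "conjm M M' ` S \<in> carrier G" if "S \<in> carrier G" "mdet M * mdet M' mod 29 = 1" for S M M'
  proof -
    from that(1) obtain A where A: "A \<in> carrier (SL2 29)" "S = cl A" by (rule G_cases)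
    then show ?thesis using closed[OF A(1) that(2)] by (simp add: cl)
  qed
  show "(\<lambda>S. conjm M M' ` S) \<in> iso G G"
  proof (rule isoI)
    show "(\<lambda>S. conjm M M' ` S) \<in> hom G G"
    proof (rule homI)
      show "conjm M M' ` S \<in> carrier G" if "S \<in> carrier G" for S using img[OF that dd] .
      fix S T assume "S \<in> carrier G" "T \<in> carrier G"
      then obtain A B where "A \<in> carrier (SL2 29)" "S = cl A" "B \<in> carrier (SL2 29)" "T = cl B"
        by (auto elim!: G_cases)
      then show "conjm M M' ` (S \<otimes>\<^bsub>G\<^esub> T) = conjm M M' ` S \<otimes>\<^bsub>G\<^esub> conjm M M' ` T"
        using closed[OF _ dd] hom[OF assms(2)] by (simp add: cl_mult cl)
    qed
    show "bij_betw (\<lambda>S. conjm M M' ` S) (carrier G) (carrier G)"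
    proof (rule bij_betw_byWitness[where f' = "\<lambda>S. conjm M' M ` S"])
      show "(\<lambda>S. conjm M M' ` S) ` carrier G \<subseteq> carrier G" using img[OF _ dd] by blast
      show "(\<lambda>S. conjm M' M ` S) ` carrier G \<subseteq> carrier G"
        using img[of _ M' M] dd by (auto simp only: mult.commute)
    qed (use fin assms in blast)+
  qed
qed

section \<open>Generation by transvections\<close>

lemma prime29: "prime (29::int)"
  by simp

lemma mod29_eq_1_iff: "x mod 29 = 1 \<longleftrightarrow> (29::int) dvd x - 1"
  using mod_eq_dvd_iff[of x 29 1] by simp

lemma mod29I: "(29::int) dvd e - z \<Longrightarrow> 0 \<le> z \<Longrightarrow> z < 29 \<Longrightarrow> e mod 29 = z"
  by (metis mod_eq_dvd_iff mod_pos_pos_trivial)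

lemma inverse29:
  assumes "\<not> (29::int) dvd x"
  shows "\<exists>y. 29 dvd x * y - 1"
proof -
  have "gcd x 29 = 1"
    using assms prime29 by (metis coprime_commute coprime_imp_gcd_eq_1 prime_imp_coprime)
  then obtain y v where "y * x + v * 29 = 1" using bezout_int[of x 29] by auto
  then have "x * y - 1 = 29 * (- v)" by (simp add: algebra_simps)
  then show ?thesis by (metis dvd_triv_left)
qed

lemma reduce29_eq_iff:
  "reduce29 (a,b,c,d) = reduce29 (e,f,g,h) \<longleftrightarrow> 29 dvd a - e \<and> 29 dvd b - f \<and> 29 dvd c - g \<and> 29 dvd d - h"
  by (simp add: reduce29_def mod_eq_dvd_iff)

text \<open>Since 29 is prime, the powers of one nontrivial transvection give all transvections of
  its shape. A matrix with nonzero lower left entry is an upper, a lower and an upper transvection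
  multiplied; any other matrix gets such an entry from a lower transvection.\<close>

lemma transvections_generate:
  assumes J: "subgroup J G" and u: "cl (1,u,0,1) \<in> J" "\<not> 29 dvd u" "u \<in> {0..<29}"
    and v: "cl (1,0,v,1) \<in> J" "\<not> 29 dvd v" "v \<in> {0..<29}"
  shows "J = carrier G"
proof -
  have SLt: "(1,b,0,1) \<in> carrier (SL2 29)" "(1,0,b,1) \<in> carrier (SL2 29)" if "b \<in> {0..<29}" for b
    using that by (auto simp: SL2_carrier mats_def mdet_def mdet_int_def)
  have Jc: "S \<in> carrier G" if "S \<in> J" for S using that subgroup.subset[OF J] by auto
  have pow_up: "cl (1, int k * u mod 29, 0, 1) \<in> J" for k
  proof (induction k)
    case 0 then show ?case using subgroup.one_closed[OF J] by (simp add: cl_one)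
  next
    case (Suc k)
    have "mmul (1,u,0,1) (1, int k * u mod 29, 0, 1) = (1, int (Suc k) * u mod 29, 0, 1)"
      by (simp add: mmul_def mmul_int_def reduce29_def mod_simps algebra_simps)
    then show ?case
      using subgroup.m_closed[OF J u(1) Suc] cl_mult[OF SLt(1)[OF u(3)] SLt(1)[of "int k * u mod 29"]] by simp
  qed
  have pow_lo: "cl (1, 0, int k * v mod 29, 1) \<in> J" for k
  proof (induction k)
    case 0 then show ?case using subgroup.one_closed[OF J] by (simp add: cl_one)
  next
    case (Suc k)
    have "mmul (1,0,v,1) (1, 0, int k * v mod 29, 1) = (1, 0, int (Suc k) * v mod 29, 1)"
      by (simp add: mmul_def mmul_int_def reduce29_def mod_simps algebra_simps)
    then show ?case
      using subgroup.m_closed[OF J v(1) Suc] cl_mult[OF SLt(2)[OF v(3)] SLt(2)[of "int k * v mod 29"]] by simp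
  qed
  have mult: "\<exists>k. int k * w mod 29 = b" if w: "\<not> 29 dvd w" and b: "b \<in> {0..<29}" for w b
  proof -
    obtain y where y: "29 dvd w * y - 1" using inverse29[OF w] by auto
    have "int (nat (b * y mod 29)) * w mod 29 = b * (w * y) mod 29"
      by (simp add: mod_simps algebra_simps)
    also have "\<dots> = b * 1 mod 29"
      using y by (metis mod_eq_dvd_iff mod_mult_right_eq)
    finally show ?thesis using b by (intro exI[of _ "nat (b * y mod 29)"]) auto
  qed
  have up: "cl (1,b,0,1) \<in> J" and lo: "cl (1,0,b,1) \<in> J" if "b \<in> {0..<29}" for b
    using mult[OF u(2) that] mult[OF v(2) that] pow_up pow_lo by metis+
  have nz: "cl (a,b,c,d) \<in> J" if A: "(a,b,c,d) \<in> carrier (SL2 29)" and c: "c \<noteq> 0" for a b c d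
  proof -
    have r: "a \<in> {0..<29}" "b \<in> {0..<29}" "c \<in> {0..<29}" "d \<in> {0..<29}" "(a*d - b*c) mod 29 = 1 mod 29"
      using A by (auto simp: SL2_carrier mats_def mdet_def mdet_int_def)
    have "\<not> 29 dvd c" using r(3) c by (auto dest: zdvd_imp_le)
    then obtain c' where c': "29 dvd c * c' - 1" using inverse29 by auto
    have det: "29 dvd a*d - b*c - 1" using r(5) by (simp add: mod29_eq_1_iff)
    \<comment> \<open>The diagonal entries of the triple product are \<open>1 + i * c\<close> and
      \<open>1 + c * k\<close>; solving for \<open>a\<close> and \<open>d\<close> gives these
      values, and the determinant then forces the entry \<open>b\<close>.\<close>
    define i k where "i = (a-1)*c' mod 29" and "k = (d-1)*c' mod 29"
    have eq: "mmul (mmul (1,i,0,1) (1,0,c,1)) (1,k,0,1) = (a,b,c,d)"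
    proof -
      have "m dvd 1 + (a-1)*c'*c - a" "m dvd (1 + (a-1)*c'*c)*((d-1)*c') + (a-1)*c' - b"
        "m dvd c*((d-1)*c') + 1 - d"
        if "m dvd a*d - b*c - 1" "m dvd c * c' - 1" for m :: int
        using that by algebra+
      note d = this[OF det c']
      have "(1,i,0,1) = reduce29 (1, (a-1)*c', 0, 1)" "(1,k,0,1) = reduce29 (1, (d-1)*c', 0, 1)"
        by (simp_all add: reduce29_def i_def k_def)
      then have "mmul (mmul (1,i,0,1) (1,0,c,1)) (1,k,0,1) = reduce29 (a,b,c,d)"
        using d by (simp add: mmul_def reduce29_mmul_int_reduce29) (simp add: mmul_int_def reduce29_eq_iff algebra_simps)
      then show ?thesis using r(1-4) by (simp add: reduce29_def)
    qed
    have ik: "i \<in> {0..<29}" "k \<in> {0..<29}" by (auto simp: i_def k_def)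
    have "cl (mmul (mmul (1,i,0,1) (1,0,c,1)) (1,k,0,1)) \<in> J"
      using subgroup.m_closed[OF J subgroup.m_closed[OF J up[OF ik(1)] lo[OF r(3)]] up[OF ik(2)]]
      using SLt(1)[OF ik(1)] SLt(2)[OF r(3)] SLt(1)[OF ik(2)] by (simp add: cl_mult)
    then show ?thesis unfolding eq .
  qed
  have all: "cl A \<in> J" if A: "A \<in> carrier (SL2 29)" for A
  proof -
    obtain a b c d where abcd: "A = (a,b,c,d)" by (cases A)
    show ?thesis
    proof (cases "c = 0")
      case False then show ?thesis using nz A abcd by simp
    next
      case True
      \<comment> \<open>Left multiplication by this matrix adds the first row to the second, so the
        lower left entry becomes \<open>a\<close>, which is nonzero because \<open>a * d\<close> is
        1 modulo 29.\<close>
      have L: "(1,0,1,1) \<in> carrier (SL2 29)" using SLt(2)[of 1] by simp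
      have "a \<in> {0..<29}" "b \<in> {0..<29}" "d \<in> {0..<29}" "a * d mod 29 = 1"
        using A abcd True by (auto simp: SL2_carrier mats_def mdet_def mdet_int_def)
      then have a: "a \<noteq> 0" and e: "mmul (1,0,1,1) A = (a, b, a, (b + d) mod 29)"
        by (auto simp: abcd True mmul_def mmul_int_def reduce29_def)
      have "mmul (1,0,1,1) A \<in> carrier (SL2 29)" using L A by simp
      then have "cl (mmul (1,0,1,1) A) \<in> J" using nz[of a b a] a unfolding e by simp
      then have "cl (1,0,1,1) \<otimes>\<^bsub>G\<^esub> cl A \<in> J" using L A by (simp add: cl_mult)
      moreover have "cl (1,0,1,1) \<in> J" using lo[of 1] by simp
      ultimately have "inv\<^bsub>G\<^esub> (cl (1,0,1,1)) \<otimes>\<^bsub>G\<^esub> (cl (1,0,1,1) \<otimes>\<^bsub>G\<^esub> cl A) \<in> J"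
        using subgroup.m_closed[OF J subgroup.m_inv_closed[OF J]] by simp
      then show ?thesis using L A by (simp flip: P.m_assoc)
    qed
  qed
  show ?thesis
  proof
    show "carrier G \<subseteq> J" using all by (auto elim!: G_cases)
  qed (use Jc in auto)
qed

text \<open>By Cayley-Hamilton every power of \<open>A\<close> has the form \<open>lin A \<alpha> \<beta>\<close>.\<close>

definition lin :: "mat \<Rightarrow> int \<Rightarrow> int \<Rightarrow> mat" where
  "lin = (\<lambda>(a,b,c,d) \<alpha> \<beta>. reduce29 (\<alpha> * a + \<beta>, \<alpha> * b, \<alpha> * c, \<alpha> * d + \<beta>))"

text \<open>The trace stays an unreduced integer; statements about traces are divisibilities by
  29.\<close>

definition mtrace :: "mat \<Rightarrow> int" where "mtrace = (\<lambda>(a,b,c,d). a + d)"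

text \<open>The coefficients of A^n = \<alpha> A + \<beta> for trace \<open>t\<close> and
  determinant 1, from A^2 = t A - 1. The first one runs through 0, 1, t, t^2 - 1, ..., the Chebyshev
  polynomials of the second kind in t / 2.\<close>

fun power_coeffs :: "int \<Rightarrow> nat \<Rightarrow> int \<times> int" where
  "power_coeffs t 0 = (0, 1)"
| "power_coeffs t (Suc n) = (case power_coeffs t n of (\<alpha>, \<beta>) \<Rightarrow> (\<alpha> * t + \<beta>, - \<alpha>))"

lemma lin_mats [simp]: "lin A \<alpha> \<beta> \<in> mats"
  by (cases A) (simp add: lin_def)

lemma mdet_eq_1_iff: "mdet (a,b,c,d) = 1 \<longleftrightarrow> 29 dvd a*d - b*c - 1"
  by (simp add: mdet_def mdet_int_def mod29_eq_1_iff)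

lemma mmul_lin:
  assumes "mdet A = 1"
  shows "mmul A (lin A \<alpha> \<beta>) = lin A (\<alpha> * mtrace A + \<beta>) (- \<alpha>)"
proof -
  obtain a b c d where A: "A = (a,b,c,d)" by (cases A)
  have "m dvd (a*(\<alpha>*a+\<beta>) + b*(\<alpha>*c)) - ((\<alpha>*(a+d)+\<beta>)*a + - \<alpha>)"
    "m dvd (c*(\<alpha>*b) + d*(\<alpha>*d+\<beta>)) - ((\<alpha>*(a+d)+\<beta>)*d + - \<alpha>)"
    if "m dvd a*d - b*c - 1" for m
    using that by algebra+
  note diag = this[OF assms[unfolded A mdet_eq_1_iff]]
  have "(a*(\<alpha>*b) + b*(\<alpha>*d+\<beta>)) - (\<alpha>*(a+d)+\<beta>)*b = 0"
    "(c*(\<alpha>*a+\<beta>) + d*(\<alpha>*c)) - (\<alpha>*(a+d)+\<beta>)*c = 0"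
    by (simp_all add: algebra_simps)
  with diag show ?thesis
    unfolding A lin_def mtrace_def prod.case by (simp add: mmul_def reduce29_mmul_int_reduce29) (simp add: mmul_int_def reduce29_eq_iff)
qed

lemma lin_SL2: "A \<in> carrier (SL2 29) \<Longrightarrow>
    lin A (fst (power_coeffs (mtrace A) n)) (snd (power_coeffs (mtrace A) n)) \<in> carrier (SL2 29)"
proof (induction n)
  case 0
  have "lin A 0 1 = E" by (cases A) (simp add: lin_def reduce29_def)
  then show ?case by simp
next
  case (Suc n)
  then have "mmul A (lin A (fst (power_coeffs (mtrace A) n)) (snd (power_coeffs (mtrace A) n))) \<in> carrier (SL2 29)"
    by simp
  then show ?case using Suc.prems by (simp add: mmul_lin SL2_carrier case_prod_beta)
qed

lemma cl_pow:
  assumes "A \<in> carrier (SL2 29)"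
  shows "cl A [^]\<^bsub>G\<^esub> n = cl (lin A (fst (power_coeffs (mtrace A) n)) (snd (power_coeffs (mtrace A) n)))"
proof (induction n)
  case 0
  have "lin A 0 1 = E" by (cases A) (simp add: lin_def reduce29_def)
  then show ?case by (simp add: cl_one)
next
  case (Suc n)
  have "cl A [^]\<^bsub>G\<^esub> Suc n = cl A \<otimes>\<^bsub>G\<^esub> cl A [^]\<^bsub>G\<^esub> n"
    by (rule P.nat_pow_Suc2) (use assms in simp)
  then show ?case
    using Suc assms lin_SL2[OF assms, of n] mmul_lin[of A]
    by (simp add: cl_mult SL2_carrier case_prod_beta)
qed

section \<open>Traces of elements of order 2, 3 and 5\<close>

lemma dvd_prime_mult: "(29::int) dvd x * y \<longleftrightarrow> 29 dvd x \<or> 29 dvd y"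
  using prime_dvd_mult_iff[OF prime29] .

text \<open>If \<alpha> were invertible, \<alpha> A + \<beta> = E or -E would make A scalar;
  determinant 1 leaves only E and -E, which are trivial in \<open>G\<close>.\<close>

lemma torsion_trace:
  assumes A: "A \<in> carrier (SL2 29)" "cl A \<noteq> \<one>\<^bsub>G\<^esub>" and pow: "cl A [^]\<^bsub>G\<^esub> n = \<one>\<^bsub>G\<^esub>"
  shows "29 dvd fst (power_coeffs (mtrace A) n)"
proof (rule ccontr)
  obtain \<alpha> \<beta> where ab: "power_coeffs (mtrace A) n = (\<alpha>, \<beta>)" by (cases "power_coeffs (mtrace A) n")
  obtain a b c d where abcd: "A = (a,b,c,d)" by (cases A)
  assume "\<not> ?thesis"
  then have \<alpha>: "\<not> 29 dvd \<alpha>" by (simp add: ab)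
  have "lin A \<alpha> \<beta> = E \<or> lin A \<alpha> \<beta> = mneg E"
    using pow cl_pow[OF A(1), of n] lin_SL2[OF A(1), of n] by (simp add: ab cl_one cl_eq_iff SL2_carrier mats_def)
  then have "29 dvd \<alpha> * b \<and> 29 dvd \<alpha> * c \<and> (\<alpha> * a + \<beta>) mod 29 = (\<alpha> * d + \<beta>) mod 29"
    by (auto simp: abcd lin_def reduce29_def mneg_E)
  then have "29 dvd \<alpha> * b" "29 dvd \<alpha> * c" "29 dvd \<alpha> * (a - d)"
    by (auto simp: mod_eq_dvd_iff algebra_simps)
  then have dv: "29 dvd b" "29 dvd c" "29 dvd a - d" using \<alpha> by (auto simp: dvd_prime_mult)
  have r: "a \<in> {0..<29}" "b \<in> {0..<29}" "c \<in> {0..<29}" "d \<in> {0..<29}" and det: "29 dvd a*d - b*c - 1"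
    using A(1) by (auto simp: abcd SL2_carrier mats_def mdet_eq_1_iff)
  have bc: "b = 0" "c = 0" using dv r by (auto dest: zdvd_imp_le)
  have ad: "a = d" using dv(3) r by (metis atLeastLessThan_iff mod_eq_dvd_iff mod_pos_pos_trivial)
  have "29 dvd (a - 1) * (a + 1)" using det by (simp add: bc ad algebra_simps)
  then have "29 dvd a - 1 \<or> 29 dvd a + 1" by (simp add: dvd_prime_mult)
  then have "a = 1 \<or> a = 28"
  proof
    assume "29 dvd a - 1" then show ?thesis using r mod29I[of a 1] by auto
  next
    assume "29 dvd a + 1"
    then have "29 dvd (a + 1) - 29" by (rule dvd_diff) simp
    then show ?thesis using r mod29I[of a 28] by auto
  qed
  then have "A = E \<or> A = mneg E" using ad by (auto simp: abcd bc mneg_E)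
  then have "cl A = cl E" using cl_mneg[of E] by (auto simp: mats_def)
  with A(2) show False by (simp add: cl_one)
qed

lemma mtrace_reduce29: "29 dvd mtrace (reduce29 A) - mtrace A"
proof -
  have "29 dvd (a mod 29 + d mod 29) - (a + d)" for a d :: int
    by (metis mod_add_eq mod_eq_dvd_iff)
  then show ?thesis by (cases A) (simp add: mtrace_def reduce29_def)
qed

lemma mtrace_mneg: "29 dvd mtrace (mneg A) + mtrace A"
  using mtrace_reduce29[of "mneg_int A"] by (cases A) (simp add: mneg_def mtrace_def mneg_int_def algebra_simps)

text \<open>Take traces in A^2 = t A - 1.\<close>

lemma mtrace_square: 
  assumes "A \<in> carrier (SL2 29)"
  shows "29 dvd mtrace (mmul A A) - (mtrace A * mtrace A - 2)"
proof -
  have "lin A 1 0 = A" using assms by (cases A) (simp add: lin_def reduce29_id SL2_carrier)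
  then have "mmul A A = lin A (mtrace A) (-1)" using mmul_lin[of A 1 0] assms by (simp add: SL2_carrier)
  then show ?thesis
    using mtrace_reduce29[of "(mtrace A * fst A + -1, mtrace A * fst (snd A), mtrace A * fst (snd (snd A)), mtrace A * snd (snd (snd A)) + -1)"]
    by (cases A) (simp add: lin_def mtrace_def algebra_simps)
qed

text \<open>Orders 2, 3 and 5 force traces t with t = 0, t^2 = 1 and t^4 - 3 t^2 + 1 = 0. The free
  sign of the lift \<open>B\<close> makes its trace 1.\<close>

lemma triangle_lift:
  assumes "S \<in> carrier G" "T \<in> carrier G" "S \<noteq> \<one>\<^bsub>G\<^esub>" "T \<noteq> \<one>\<^bsub>G\<^esub>" "S \<otimes>\<^bsub>G\<^esub> T \<noteq> \<one>\<^bsub>G\<^esub>"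
    and "S [^]\<^bsub>G\<^esub> (2::nat) = \<one>\<^bsub>G\<^esub>" "T [^]\<^bsub>G\<^esub> (3::nat) = \<one>\<^bsub>G\<^esub>" "(S \<otimes>\<^bsub>G\<^esub> T) [^]\<^bsub>G\<^esub> (5::nat) = \<one>\<^bsub>G\<^esub>"
  shows "\<exists>A B. A \<in> carrier (SL2 29) \<and> B \<in> carrier (SL2 29) \<and> S = cl A \<and> T = cl B \<and>
     29 dvd mtrace A \<and> 29 dvd mtrace B - 1 \<and>
     (29 dvd mtrace (mmul A B) * mtrace (mmul A B) - 25 \<or> 29 dvd mtrace (mmul A B) * mtrace (mmul A B) - 7)"
proof -
  obtain A where A: "A \<in> carrier (SL2 29)" "S = cl A" using assms(1) by (rule G_cases)
  obtain B' where B': "B' \<in> carrier (SL2 29)" "T = cl B'" using assms(2) by (rule G_cases)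
  have trA: "29 dvd mtrace A"
    using torsion_trace[of A 2] assms A by (simp add: numeral_2_eq_2)
  have "29 dvd mtrace B' * mtrace B' - 1"
    using torsion_trace[of B' 3] assms B' by (simp add: numeral_3_eq_3)
  then have "29 dvd (mtrace B' - 1) * (mtrace B' + 1)" by (simp add: algebra_simps)
  then have tB: "29 dvd mtrace B' - 1 \<or> 29 dvd mtrace B' + 1" by (simp only: dvd_prime_mult)
  have "\<exists>B. B \<in> carrier (SL2 29) \<and> T = cl B \<and> 29 dvd mtrace B - 1"
    using tB
  proof
    assume "29 dvd mtrace B' + 1"
    then have "29 dvd (mtrace (mneg B') + mtrace B') - (mtrace B' + 1)" using mtrace_mneg dvd_diff by blast
    then show ?thesis using B' by (intro exI[of _ "mneg B'"]) (simp add: cl_mneg SL2_carrier)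
  qed (use B' in auto)
  then obtain B where B: "B \<in> carrier (SL2 29)" "T = cl B" "29 dvd mtrace B - 1" by auto
  define t where "t = mtrace (mmul A B)"
  have "29 dvd ((t*t+-1)*t+-t)*t+-(t*t+-1)"
    using torsion_trace[of "mmul A B" 5] assms A B
    by (simp add: cl_mult t_def eval_nat_numeral algebra_simps)
  \<comment> \<open>Modulo 29 the quartic splits in t^2, since 25 + 7 = 3 + 29 and 25 * 7 = 1 + 6 *
    29.\<close>
  have "29 dvd (t*t - 25) * (t*t - 7)"
  proof -
    have "(t*t - 25) * (t*t - 7) = (((t*t+-1)*t+-t)*t+-(t*t+-1)) + 29 * (6 - t*t)"
      by (simp add: algebra_simps)
    then show ?thesis using \<open>29 dvd ((t*t+-1)*t+-t)*t+-(t*t+-1)\<close>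
      by (metis dvd_add dvd_triv_left)
  qed
  then show ?thesis using A B trA by (auto simp: t_def dvd_prime_mult)
qed

text \<open>The sign of \<open>A\<close> is still free because its trace is 0; it decides between
  the traces 5 and -5 of the product.\<close>

lemma triangle_normalize:
  assumes A: "A \<in> carrier (SL2 29)" and B: "B \<in> carrier (SL2 29)"
    and mtrace: "29 dvd mtrace A" "29 dvd mtrace (mmul A B) * mtrace (mmul A B) - 25"
  shows "\<exists>A'. A' \<in> carrier (SL2 29) \<and> cl A' = cl A \<and> 29 dvd mtrace A' \<and> 29 dvd mtrace (mmul A' B) - 5"
proof -
  have "29 dvd (mtrace (mmul A B) - 5) * (mtrace (mmul A B) + 5)" using mtrace(2) by (simp add: algebra_simps)
  then have "29 dvd mtrace (mmul A B) - 5 \<or> 29 dvd mtrace (mmul A B) + 5" by (simp only: dvd_prime_mult)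
  then show ?thesis
  proof
    assume 5: "29 dvd mtrace (mmul A B) + 5"
    have "29 dvd (mtrace (mneg (mmul A B)) + mtrace (mmul A B)) - (mtrace (mmul A B) + 5)"
      using mtrace_mneg 5 dvd_diff by blast
    moreover have "29 dvd (mtrace (mneg A) + mtrace A) - mtrace A" using mtrace_mneg mtrace(1) dvd_diff by blast
    ultimately show ?thesis
      using A by (intro exI[of _ "mneg A"]) (simp add: mneg_mmul cl_mneg SL2_carrier)
  qed (use A mtrace in auto)
qed

text \<open>\<open>A0\<close> is the diagonal matrix with entries \<open>-12\<close> and \<open>12\<close>, where \<open>12\<^sup>2 = -1\<close>; \<open>B0\<close> has trace 1, and \<open>A0 B0\<close> has trace 5.\<close>

definition A0 :: mat where "A0 = (17,0,0,12)"
definition B0 :: mat where "B0 = (16,27,19,14)"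

text \<open>In an eigenbasis of \<open>A\<close> for -12 and 12, the traces of \<open>B\<close> and
  \<open>A B\<close> determine the diagonal of \<open>B\<close>, and the determinant gives the
  product of its other two entries; rescaling one basis vector then makes them equal to those of
  \<open>B0\<close>. The second column of \<open>B0\<close> requires B v = 27 x + 14 v, so x = 14 (B
  - 14) v, because 14 is the inverse of 27 modulo 29.\<close>

lemma intertwiner:
  assumes A: "A \<in> carrier (SL2 29)" "29 dvd mtrace A" and B: "B \<in> carrier (SL2 29)" "29 dvd mtrace B - 1"
    and AB: "29 dvd mtrace (mmul A B) - 5"
  shows "\<exists>M M'. mmul M M' = E \<and> mmul M' M = E \<and> conjm M M' A0 = A \<and> conjm M M' B0 = B"
proof -
  obtain a b c d where Aeq: "A = (a,b,c,d)" by (cases A)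
  obtain e f g h where Beq: "B = (e,f,g,h)" by (cases B)
  have hyp: "29 dvd a + d" "29 dvd a*d - b*c - 1" "29 dvd e + h - 1" "29 dvd e*h - f*g - 1"
    using A B by (auto simp: Aeq Beq mtrace_def SL2_carrier mdet_eq_1_iff)
  have "29 dvd (mtrace (mmul A B) - 5) - (mtrace (mmul A B) - mtrace (mmul_int A B))"
    using AB mtrace_reduce29[of "mmul_int A B"] unfolding mmul_def by (rule dvd_diff)
  then have trAB: "29 dvd a*e + b*g + c*f + d*h - 5"
    by (simp add: Aeq Beq mtrace_def mmul_int_def algebra_simps)
  \<comment> \<open>The vector (b, 12 - a) is in the kernel of A - 12. Should it vanish, (12 - d, c)
    serves instead: 12 - a and 12 - d cannot both vanish, as their sum is 24 when the trace is
    0.\<close>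
  have "\<exists>p q. (\<not> 29 dvd p \<or> \<not> 29 dvd q) \<and> 29 dvd a*p+b*q-12*p \<and> 29 dvd c*p+d*q-12*q"
  proof (cases "29 dvd b \<and> 29 dvd 12 - a")
    case False
    have "m dvd c*b+d*(s-a)-s*(s-a)"
      if "m dvd a+d" "m dvd a*d-b*c-1" "m dvd s*s+1" for m s :: int using that by algebra
    from this[OF hyp(1,2), of 12] False show ?thesis
      by (intro exI[of _ b] exI[of _ "12-a"]) (auto simp: algebra_simps)
  next
    case True
    have "\<not> 29 dvd 12 - d"
    proof
      assume "29 dvd 12 - d"
      then have "29 dvd (a + d) + (12 - a) + (12 - d)"
        using True hyp(1) by (blast intro: dvd_add[OF dvd_add])
      then show False by simp
    qed
    moreover have "m dvd a*(s-d)+b*c-s*(s-d)"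
      if "m dvd a+d" "m dvd a*d-b*c-1" "m dvd s*s+1" for m s :: int using that by algebra
    from this[OF hyp(1,2), of 12]
    have "29 dvd a*(12-d)+b*c-12*(12-d)" "29 dvd c*(12-d)+d*c-12*c" by (auto simp: algebra_simps)
    ultimately show ?thesis by (intro exI[of _ "12-d"] exI[of _ c]) auto
  qed
  then obtain p q where pq: "\<not> 29 dvd p \<or> \<not> 29 dvd q" and
    ev2: "29 dvd a*p+b*q-12*p" "29 dvd c*p+d*q-12*q" by auto
  txt \<open>The intertwiner has the columns \<open>14 (B - 14) v\<close> and \<open>v\<close>, where \<open>v = (p, q)\<close> is an eigenvector of \<open>A\<close> for 12.\<close>
  define x1 x2 where "x1 = 14*((e-14)*p+f*q)" and "x2 = 14*(g*p+(h-14)*q)"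
  \<comment> \<open>Polarising Cayley-Hamilton with the traces 0, 1 and 5 gives A B + B A = A + 5.
    Applied to \<open>v\<close> it turns (B - 14) v into an eigenvector for -12; the defect is 319 =
    11 * 29.\<close>
  have ev1: "29 dvd a*x1+b*x2+12*x1" "29 dvd c*x1+d*x2+12*x2"
  proof -
    let ?u = "a*p+b*q-12*p" and ?v = "c*p+d*q-12*q" and ?t = "a*e+b*g+c*f+d*h-5"
    have "a*x1+b*x2+12*x1 = 14 * ((a+d)*(e*p+f*q-(e+h)*p) + (e+h-1)*(12*p+?u) - 13*?u - ?u*e - ?v*f + ?t*p + 29*(-11*p))"
      "c*x1+d*x2+12*x2 = 14 * ((a+d)*(g*p+h*q-(e+h)*q) + (e+h-1)*(12*q+?v) - 13*?v - ?u*g - ?v*h + ?t*q + 29*(-11*q))"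
      by (simp_all add: x1_def x2_def algebra_simps)
    then show "29 dvd a*x1+b*x2+12*x1" "29 dvd c*x1+d*x2+12*x2"
      using hyp(1,3) trAB ev2 by (simp_all only: dvd_add dvd_diff dvd_mult dvd_mult2 dvd_triv_left)
  qed
  have Bv2: "29 dvd e*p+f*q-(27*x1+14*p)" "29 dvd g*p+h*q-(27*x2+14*q)"
  proof -
    have "e*p+f*q-(27*x1+14*p) = 29 * (- 13 * ((e-14)*p+f*q))"
      "g*p+h*q-(27*x2+14*q) = 29 * (- 13 * (g*p+(h-14)*q))"
      by (simp_all add: x1_def x2_def algebra_simps)
    then show "29 dvd e*p+f*q-(27*x1+14*p)" "29 dvd g*p+h*q-(27*x2+14*q)" by (metis dvd_triv_left)+
  qed
  \<comment> \<open>For x = \<beta> (B - \<beta>) v, the relation B^2 = B - 1 yields B x = (1 -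
    \<beta>) x + \<beta> (\<beta> (1 - \<beta>) - 1) v. At \<beta> = 14 the coefficients are 16 and
    19, the first column of \<open>B0\<close>.\<close>
  have gen2: "m dvd e*(\<beta>*((e-\<beta>)*p+f*q)) + f*(\<beta>*(g*p+(h-\<beta>)*q)) - ((1-\<beta>)*(\<beta>*((e-\<beta>)*p+f*q)) + \<beta>*(\<beta>*(1-\<beta>)-1)*p)"
    "m dvd g*(\<beta>*((e-\<beta>)*p+f*q)) + h*(\<beta>*(g*p+(h-\<beta>)*q)) - ((1-\<beta>)*(\<beta>*(g*p+(h-\<beta>)*q)) + \<beta>*(\<beta>*(1-\<beta>)-1)*q)"
    if "m dvd e+h-1" "m dvd e*h-f*g-1" for m \<beta> :: int
    using that by algebra+
  have Bv1: "29 dvd e*x1+f*x2-(16*x1+19*p)" "29 dvd g*x1+h*x2-(16*x2+19*q)"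
  proof -
    have "u - (16*v+19*w) = (u - ((1-14)*v + 14*(14*(1-14)-1)*w)) - 29 * (v + 89 * w)" for u v w :: int
      by simp
    then have "29 dvd u - (16*v+19*w)" if "29 dvd u - ((1-14)*v + 14*(14*(1-14)-1)*w)" for u v w :: int
      using that by (metis dvd_diff dvd_triv_left)
    then show "29 dvd e*x1+f*x2-(16*x1+19*p)" "29 dvd g*x1+h*x2-(16*x2+19*q)"
      using gen2[OF hyp(3,4), of 14] unfolding x1_def x2_def by blast+
  qed
  \<comment> \<open>Dependent eigenvectors for 12 and -12 force x = 0, as \<open>v\<close> is
    nonzero; then B x = 16 x + 19 v gives v = 0.\<close>
  have det: "\<not> 29 dvd x1*q - p*x2"
  proof
    assume D: "29 dvd x1*q - p*x2"
    have "m dvd 2*s*(q*x2)" "m dvd 2*s*(p*x2)" "m dvd 2*s*(p*x1)" "m dvd 2*s*(q*x1)"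
      if "m dvd a*p+b*q-s*p" "m dvd c*p+d*q-s*q" "m dvd a*x1+b*x2+s*x1" "m dvd c*x1+d*x2+s*x2"
        "m dvd x1*q-p*x2" for m s :: int
      using that by algebra+
    from this[OF ev2 ev1 D] have z: "29 dvd 24*(q*x2)" "29 dvd 24*(p*x2)" "29 dvd 24*(p*x1)" "29 dvd 24*(q*x1)"
      by simp_all
    have x: "29 dvd x1" "29 dvd x2" using z pq by (auto simp: dvd_prime_mult)
    have "29 dvd x1 * (e-16) + x2 * f - (e*x1+f*x2-(16*x1+19*p))"
      "29 dvd x1 * g + x2 * (h-16) - (g*x1+h*x2-(16*x2+19*q))"
      using x Bv1 by (simp_all only: dvd_add dvd_diff dvd_mult2)
    then have "29 dvd 19*p" "29 dvd 19*q" by (simp_all add: algebra_simps)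
    then show False using pq by (auto simp: dvd_prime_mult)
  qed
  obtain y where y: "29 dvd (x1*q - p*x2) * y - 1" using inverse29[OF det] by auto
  define M where "M = (x1,p,x2,q)"
  define M' where "M' = (y*q, -(y*p), -(y*x2), y*x1)"
  have rdE: "E = reduce29 E" by (simp add: reduce29_def)
  have inv: "mmul M M' = E" "mmul M' M = E"
    unfolding mmul_def M_def M'_def by (subst rdE, use y in \<open>simp add: mmul_int_def reduce29_eq_iff algebra_simps\<close>)+
  have "mmul M A0 = mmul A M"
  proof -
    have "29 dvd 17*x - y" if "29 dvd y + 12*x" for x y :: int
    proof -
      have "17*x - y = 29*x - (y + 12*x)" by simp
      then show ?thesis using that by (metis dvd_diff dvd_triv_left)
    qed
    then show ?thesis
      using ev1 ev2 by (auto simp: mmul_def M_def A0_def Aeq mmul_int_def reduce29_eq_iff dvd_diff_commute mult.commute)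
  qed
  moreover have "mmul M B0 = mmul B M"
    using Bv1 Bv2 by (auto simp: mmul_def M_def B0_def Beq mmul_int_def reduce29_eq_iff dvd_diff_commute mult.commute)
  ultimately have "conjm M M' A0 = A" "conjm M M' B0 = B"
    using inv A(1) B(1) by (simp_all add: conjm_def mmul_assoc mmul_E reduce29_id SL2_carrier)
  then show ?thesis using inv by blast
qed

section \<open>Subgroups of PSL(2,29) isomorphic to the alternating group\<close>

text \<open>Two pairs of elements of orders 2 and 3, where the second product is the square of the
  first, of order 5. If the trace of the first product has square 7, its square has trace 7 - 2 = 5,
  so one of the two pairs always realises trace 5 up to sign.\<close>

lemma alt5_pairs:
  "\<exists>p q p' q'. {p,q,p',q'} \<subseteq> carrier (alt_group 5) \<and> id \<notin> {p,q,p',q',p \<circ> q,p' \<circ> q'}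
     \<and> p \<circ> p = id \<and> q \<circ> (q \<circ> q) = id \<and> p' \<circ> p' = id \<and> q' \<circ> (q' \<circ> q') = id
     \<and> (p \<circ> q) \<circ> ((p \<circ> q) \<circ> ((p \<circ> q) \<circ> ((p \<circ> q) \<circ> (p \<circ> q)))) = id
     \<and> p' \<circ> q' = (p \<circ> q) \<circ> (p \<circ> q)"
proof -
  define p q p' q' where "p = lab 3" and "q = lab 19" and "p' = lab 8" and "q' = lab 40"
  have c: "p \<in> carrier (alt_group 5)" "q \<in> carrier (alt_group 5)"
    "p' \<in> carrier (alt_group 5)" "q' \<in> carrier (alt_group 5)" "id \<in> carrier (alt_group 5)"
    using lab_in_alt5 A5.one_closed by (auto simp: p_def q_def p'_def q'_def alt_group_one)
  note cc = alt5_comp[OF c(1) c(2)] alt5_comp[OF c(3) c(4)]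
  note d = p_def q_def p'_def q'_def lab_simps
  have "p \<circ> p = id" "q \<circ> (q \<circ> q) = id" "p' \<circ> p' = id" "q' \<circ> (q' \<circ> q') = id"
    "(p \<circ> q) \<circ> ((p \<circ> q) \<circ> ((p \<circ> q) \<circ> ((p \<circ> q) \<circ> (p \<circ> q)))) = id"
    "p' \<circ> q' = (p \<circ> q) \<circ> (p \<circ> q)"
    by ((rule alt5_eqI; (intro alt5_comp c)?); simp add: d)+
  moreover have "id \<notin> {p,q,p',q',p \<circ> q,p' \<circ> q'}"
  proof -
    have "p 1 \<noteq> 1 \<or> p 2 \<noteq> 2" "q 1 \<noteq> 1 \<or> q 2 \<noteq> 2 \<or> q 3 \<noteq> 3" "p' 1 \<noteq> 1 \<or> p' 2 \<noteq> 2"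
      "q' 1 \<noteq> 1 \<or> q' 2 \<noteq> 2 \<or> q' 3 \<noteq> 3" "(p \<circ> q) 1 \<noteq> 1" "(p' \<circ> q') 1 \<noteq> 1"
      by (simp_all add: d)
    then show ?thesis by (metis (no_types, lifting) empty_iff id_apply insertE)
  qed
  ultimately show ?thesis using c by blast
qed

text \<open>Only membership of the two conjugated matrices is claimed; that they pin down the
  subgroup is a count in \<open>H_unique\<close>.\<close>

lemma alt5_subgroup_generators:
  assumes G1: "subgroup G1 G" and iso: "G\<lparr>carrier := G1\<rparr> \<cong> alt_group 5"
  shows "\<exists>M M'. mmul M M' = E \<and> mmul M' M = E \<and> cl (conjm M M' A0) \<in> G1 \<and> cl (conjm M M' B0) \<in> G1"
proof -
  interpret G1: group "G\<lparr>carrier := G1\<rparr>" using P.subgroup_imp_group[OF G1] .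
  obtain h where h: "h \<in> hom (alt_group 5) (G\<lparr>carrier := G1\<rparr>)" "bij_betw h (carrier (alt_group 5)) G1"
    using G1.iso_sym[OF iso] by (auto simp: is_iso_def iso_def)
  have sub: "G1 \<subseteq> carrier G" using subgroup.subset[OF G1] .
  have hc: "h u \<in> carrier G" "h u \<in> G1" if "u \<in> carrier (alt_group 5)" for u
    using h(2) that sub by (auto simp: bij_betw_def)
  have hm: "h (u \<circ> v) = h u \<otimes>\<^bsub>G\<^esub> h v" if "u \<in> carrier (alt_group 5)" "v \<in> carrier (alt_group 5)" for u v
    using h(1) that by (auto simp: hom_def alt_group_mult)
  have idc: "id \<in> carrier (alt_group 5)" using A5.one_closed by (simp add: alt_group_one)
  have h1: "h id = \<one>\<^bsub>G\<^esub>"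
    using hm[OF idc idc] hc(1)[OF idc] by (simp add: P.l_cancel_one')
  have hn: "h u \<noteq> \<one>\<^bsub>G\<^esub>" if "u \<in> carrier (alt_group 5)" "u \<noteq> id" for u
    using h(2) that idc h1 by (metis bij_betw_def inj_onD)
  have pow: "x [^]\<^bsub>G\<^esub> (2::nat) = x \<otimes>\<^bsub>G\<^esub> x" "x [^]\<^bsub>G\<^esub> (3::nat) = x \<otimes>\<^bsub>G\<^esub> (x \<otimes>\<^bsub>G\<^esub> x)"
    "x [^]\<^bsub>G\<^esub> (5::nat) = x \<otimes>\<^bsub>G\<^esub> (x \<otimes>\<^bsub>G\<^esub> (x \<otimes>\<^bsub>G\<^esub> (x \<otimes>\<^bsub>G\<^esub> x)))" if "x \<in> carrier G" for x
    using that by (simp_all add: eval_nat_numeral P.m_assoc)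
  obtain p q p' q' where c: "p \<in> carrier (alt_group 5)" "q \<in> carrier (alt_group 5)"
      "p' \<in> carrier (alt_group 5)" "q' \<in> carrier (alt_group 5)"
    and n: "p \<noteq> id" "q \<noteq> id" "p' \<noteq> id" "q' \<noteq> id" "p \<circ> q \<noteq> id" "p' \<circ> q' \<noteq> id"
    and r: "p \<circ> p = id" "q \<circ> (q \<circ> q) = id" "p' \<circ> p' = id" "q' \<circ> (q' \<circ> q') = id"
      "(p \<circ> q) \<circ> ((p \<circ> q) \<circ> ((p \<circ> q) \<circ> ((p \<circ> q) \<circ> (p \<circ> q)))) = id" "p' \<circ> q' = (p \<circ> q) \<circ> (p \<circ> q)"
    using alt5_pairs by (metis insert_subset insertCI)
  have r': "(p' \<circ> q') \<circ> ((p' \<circ> q') \<circ> ((p' \<circ> q') \<circ> ((p' \<circ> q') \<circ> (p' \<circ> q')))) = id"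
  proof -
    have "(p' \<circ> q') \<circ> ((p' \<circ> q') \<circ> ((p' \<circ> q') \<circ> ((p' \<circ> q') \<circ> (p' \<circ> q'))))
      = ((p \<circ> q) \<circ> ((p \<circ> q) \<circ> ((p \<circ> q) \<circ> ((p \<circ> q) \<circ> (p \<circ> q))))) \<circ>
        ((p \<circ> q) \<circ> ((p \<circ> q) \<circ> ((p \<circ> q) \<circ> ((p \<circ> q) \<circ> (p \<circ> q)))))"
      by (simp only: r(6) comp_assoc)
    then show ?thesis by (simp add: r(5))
  qed
  have lift: "\<exists>A B. A \<in> carrier (SL2 29) \<and> B \<in> carrier (SL2 29) \<and> h u = cl A \<and> h v = cl B \<and>
     29 dvd mtrace A \<and> 29 dvd mtrace B - 1 \<and>
     (29 dvd mtrace (mmul A B) * mtrace (mmul A B) - 25 \<or> 29 dvd mtrace (mmul A B) * mtrace (mmul A B) - 7)"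
    if c: "u \<in> carrier (alt_group 5)" "v \<in> carrier (alt_group 5)"
      and n: "u \<noteq> id" "v \<noteq> id" "u \<circ> v \<noteq> id" and r: "u \<circ> u = id" "v \<circ> (v \<circ> v) = id"
        "(u \<circ> v) \<circ> ((u \<circ> v) \<circ> ((u \<circ> v) \<circ> ((u \<circ> v) \<circ> (u \<circ> v)))) = id" for u v
  proof (rule triangle_lift)
    note uv = alt5_comp[OF c]
    show "h u \<otimes>\<^bsub>G\<^esub> h v \<noteq> \<one>\<^bsub>G\<^esub>" using hn[OF uv n(3)] hm[OF c] by simp
    show "h u [^]\<^bsub>G\<^esub> (2::nat) = \<one>\<^bsub>G\<^esub>" using hm[OF c(1) c(1)] r(1) h1 hc c by (simp add: pow)
    show "h v [^]\<^bsub>G\<^esub> (3::nat) = \<one>\<^bsub>G\<^esub>"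
      using hm[OF c(2) alt5_comp[OF c(2) c(2)]] hm[OF c(2) c(2)] r(2) h1 hc c by (simp add: pow)
    have "h (u \<circ> v) [^]\<^bsub>G\<^esub> (5::nat) = h ((u \<circ> v) \<circ> ((u \<circ> v) \<circ> ((u \<circ> v) \<circ> ((u \<circ> v) \<circ> (u \<circ> v)))))"
      using uv hc(1)[OF uv] by (simp only: pow hm alt5_comp)
    then show "(h u \<otimes>\<^bsub>G\<^esub> h v) [^]\<^bsub>G\<^esub> (5::nat) = \<one>\<^bsub>G\<^esub>" using r(3) h1 hm[OF c] by simp
  qed (use hc hn c n in auto)
  have "\<exists>A B. A \<in> carrier (SL2 29) \<and> B \<in> carrier (SL2 29) \<and> cl A \<in> G1 \<and> cl B \<in> G1 \<and>
     29 dvd mtrace A \<and> 29 dvd mtrace B - 1 \<and> 29 dvd mtrace (mmul A B) * mtrace (mmul A B) - 25"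
  proof -
    obtain A B where AB: "A \<in> carrier (SL2 29)" "B \<in> carrier (SL2 29)" "h p = cl A" "h q = cl B"
      "29 dvd mtrace A" "29 dvd mtrace B - 1"
      "29 dvd mtrace (mmul A B) * mtrace (mmul A B) - 25 \<or> 29 dvd mtrace (mmul A B) * mtrace (mmul A B) - 7"
      using lift[OF c(1,2) n(1,2,5) r(1,2,5)] by blast
    obtain A' B' where AB': "A' \<in> carrier (SL2 29)" "B' \<in> carrier (SL2 29)" "h p' = cl A'" "h q' = cl B'"
      "29 dvd mtrace A'" "29 dvd mtrace B' - 1"
      using lift[OF c(3,4) n(3,4,6) r(3,4) r'] by blast
    show ?thesis
      using AB(7)
    proof
      assume "29 dvd mtrace (mmul A B) * mtrace (mmul A B) - 25"
      then show ?thesis using AB hc(2)[OF c(1)] hc(2)[OF c(2)] by metis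
    next
      assume 7: "29 dvd mtrace (mmul A B) * mtrace (mmul A B) - 7"
      \<comment> \<open>With squared trace 7, the other pair has the product \<open>mmul C C\<close>
        up to sign, whose trace is 5 or -5.\<close>
      define C where "C = mmul A B"
      have C: "C \<in> carrier (SL2 29)" using AB by (simp add: C_def)
      have "cl (mmul A' B') = cl (mmul C C)"
        using hm[OF c(3,4)] hm[OF alt5_comp[OF c(1,2)] alt5_comp[OF c(1,2)]] hm[OF c(1,2)] AB AB' C
        by (simp add: r(6) cl_mult C_def)
      then have "mmul A' B' = mmul C C \<or> mmul A' B' = mneg (mmul C C)" by (simp add: cl_eq_iff)
      moreover have t: "29 dvd mtrace (mmul C C) - 5"
      proof -
        have "29 dvd (mtrace (mmul C C) - (mtrace C * mtrace C - 2)) + (mtrace C * mtrace C - 7)"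
          using mtrace_square[OF C] 7 unfolding C_def by (rule dvd_add)
        then show ?thesis by simp
      qed
      moreover have "29 dvd mtrace (mneg (mmul C C)) + 5"
      proof -
        have "29 dvd (mtrace (mneg (mmul C C)) + mtrace (mmul C C)) - (mtrace (mmul C C) - 5)"
          using mtrace_mneg t by (rule dvd_diff)
        then show ?thesis by simp
      qed
      ultimately have "29 dvd (mtrace (mmul A' B') - 5) * (mtrace (mmul A' B') + 5)" by auto
      then have "29 dvd mtrace (mmul A' B') * mtrace (mmul A' B') - 25" by (simp add: algebra_simps)
      then show ?thesis using AB' hc(2)[OF c(3)] hc(2)[OF c(4)] by metis
    qed
  qed
  then obtain A B where AB: "A \<in> carrier (SL2 29)" "B \<in> carrier (SL2 29)" "cl A \<in> G1" "cl B \<in> G1"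
     "29 dvd mtrace A" "29 dvd mtrace B - 1" "29 dvd mtrace (mmul A B) * mtrace (mmul A B) - 25" by blast
  obtain A' where A': "A' \<in> carrier (SL2 29)" "cl A' = cl A" "29 dvd mtrace A'" "29 dvd mtrace (mmul A' B) - 5"
    using triangle_normalize[OF AB(1,2,5,7)] by blast
  show ?thesis using intertwiner[OF A'(1,3) AB(2,6) A'(4)] A'(2) AB(3,4) by metis
qed

section \<open>The action on 203 cosets and its labels\<close>

datatype gen = GX | GY | GZ

text \<open>The tables were found by a computer search. Row \<open>i\<close> of \<open>x_list\<close>, \<open>y_list\<close>, \<open>z_list\<close> consists of the coset to
  which the generator moves coset \<open>i\<close>, the index of the label in \<open>lab_list\<close>, and the index in \<open>sub_list\<close> of the
  element of \<open>H\<close> that corrects the product of the generator and the representative of coset \<open>i\<close> (up to sign).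
  The labels are trivial along a breadth-first spanning tree, so that every entry is the label of a loop at coset 0.\<close>

definition x_list :: "(nat \<times> nat \<times> nat) list" where
 "x_list = [
  (0,30,1),(3,0,0),(5,0,0),(1,0,0),(9,0,0),(2,0,0),(12,0,0),(13,0,0),(14,0,0),(4,0,0),(18,0,0),
   (20,0,0),(6,0,0),(7,0,0),(8,0,0),(27,0,0),(24,0,0),(29,0,0),(10,0,0),(33,0,0),(11,0,0),
   (36,0,0),(37,0,0),(23,47,13),(16,0,0),(41,0,0),(43,0,0),(15,0,0),(47,0,0),(17,0,0),(50,0,0),
   (51,0,0),(52,0,0),(19,0,0),(55,0,0),(35,8,44),(21,0,0),(22,0,0),(58,0,0),(59,0,0),(60,0,0),
   (25,0,0),(62,0,0),(26,0,0),(64,0,0),(65,0,0),(66,0,0),(28,0,0),(71,0,0),(68,30,1),(30,0,0),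
   (31,0,0),(32,0,0),(57,0,0),(80,0,0),(34,0,0),(83,0,0),(53,0,0),(38,0,0),(39,0,0),(40,0,0),
   (86,0,0),(42,0,0),(89,0,0),(44,0,0),(45,0,0),(46,0,0),(94,0,0),(49,30,1),(76,0,0),(96,0,0),
   (48,0,0),(99,0,0),(78,29,17),(92,47,13),(100,0,0),(69,0,0),(85,0,0),(73,51,20),(103,0,0),
   (54,0,0),(81,14,48),(105,0,0),(56,0,0),(108,0,0),(77,0,0),(61,0,0),(91,0,0),(111,0,0),(63,0,0),
   (113,0,0),(87,0,0),(74,47,13),(115,7,50),(67,0,0),(117,0,0),(70,0,0),(119,0,0),(120,0,0),
   (72,0,0),(75,0,0),(125,0,0),(126,0,0),(79,0,0),(109,47,13),(82,0,0),(123,51,20),(132,0,0),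
   (84,0,0),(104,47,13),(137,0,0),(88,0,0),(138,0,0),(90,0,0),(121,47,13),(93,10,40),(116,12,57),
   (95,0,0),(143,0,0),(97,0,0),(98,0,0),(114,47,13),(147,0,0),(106,29,17),(150,0,0),(101,0,0),
   (102,0,0),(129,0,0),(135,47,13),(127,0,0),(141,4,55),(155,0,0),(107,0,0),(144,50,37),(156,0,0),
   (128,47,13),(158,0,0),(110,0,0),(112,0,0),(139,59,14),(165,0,0),(130,6,53),(167,12,18),
   (118,0,0),(133,20,45),(172,0,0),(175,0,0),(122,0,0),(177,0,0),(178,0,0),(124,0,0),(153,0,0),
   (174,47,13),(151,0,0),(181,0,0),(131,0,0),(134,0,0),(187,0,0),(136,0,0),(168,20,34),(188,0,0),
   (163,0,0),(190,0,0),(161,0,0),(193,0,0),(140,0,0),(166,11,49),(142,12,15),(159,50,26),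
   (194,0,0),(180,50,26),(173,26,7),(145,0,0),(171,18,4),(152,47,13),(146,0,0),(195,0,0),
   (148,0,0),(149,0,0),(197,46,18),(170,20,34),(154,0,0),(191,0,40),(185,0,0),(198,0,0),(183,0,0),
   (199,0,0),(157,0,0),(160,0,0),(192,2,2),(162,0,0),(182,0,50),(189,1,5),(164,0,0),(169,0,0),
   (176,0,0),(201,23,21),(179,56,15),(184,0,0),(186,0,0),(202,0,0),(196,38,8),(200,0,0)]"

definition y_list :: "(nat \<times> nat \<times> nat) list" where
 "y_list = [
  (1,0,0),(0,0,0),(6,0,0),(3,30,1),(7,0,0),(10,0,0),(2,0,0),(4,0,0),(15,0,0),(16,0,0),(5,0,0),
   (21,0,0),(18,0,0),(24,0,0),(25,0,0),(8,0,0),(9,0,0),(30,0,0),(12,0,0),(22,0,0),(34,0,0),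
   (11,0,0),(19,0,0),(38,0,0),(13,0,0),(14,0,0),(44,0,0),(41,0,0),(31,0,0),(48,0,0),(17,0,0),
   (28,0,0),(39,0,0),(53,0,0),(20,0,0),(40,29,51),(55,0,0),(57,0,0),(23,0,0),(32,0,0),(35,51,41),
   (27,0,0),(45,0,0),(63,0,0),(26,0,0),(42,0,0),(67,0,0),(69,0,0),(29,0,0),(73,0,0),(71,0,0),
   (76,0,0),(77,0,0),(33,0,0),(81,0,0),(36,0,0),(75,51,20),(37,0,0),(58,47,13),(85,0,0),
   (60,59,47),(68,0,0),(87,0,0),(43,0,0),(89,0,0),(91,0,0),(93,0,0),(46,0,0),(61,0,0),(47,0,0),
   (97,0,0),(50,0,0),(74,0,0),(49,0,0),(72,0,0),(56,29,17),(51,0,0),(52,0,0),(86,59,14),(82,0,0),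
   (80,14,48),(54,0,0),(79,0,0),(106,0,0),(109,0,0),(59,0,0),(78,59,14),(62,0,0),(111,10,40),
   (64,0,0),(90,59,14),(65,0,0),(114,0,0),(66,0,0),(115,7,50),(98,0,0),(118,0,0),(70,0,0),
   (95,0,0),(121,0,0),(123,0,0),(102,0,0),(101,0,0),(127,0,0),(128,0,0),(129,0,0),(83,0,0),
   (133,0,0),(135,0,0),(84,0,0),(112,0,0),(88,7,50),(110,0,0),(139,0,0),(92,0,0),(94,10,40),
   (116,27,43),(141,0,0),(96,0,0),(143,0,0),(130,6,53),(99,0,0),(148,0,0),(100,0,0),(144,51,29),
   (151,0,0),(153,0,0),(103,0,0),(104,0,0),(105,0,0),(120,4,55),(134,0,0),(150,4,55),(107,0,0),
   (131,0,0),(108,0,0),(159,0,0),(161,0,0),(163,0,0),(113,0,0),(166,0,0),(117,0,0),(169,0,0),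
   (119,0,0),(124,29,28),(173,0,0),(149,0,0),(176,0,0),(122,0,0),(146,0,0),(132,6,53),(125,0,0),
   (172,20,34),(126,0,0),(182,0,0),(183,0,0),(185,0,0),(160,0,0),(180,0,0),(136,0,0),(157,0,0),
   (137,0,0),(191,0,0),(138,0,0),(167,0,0),(165,11,49),(140,0,0),(164,0,0),(170,0,0),(142,0,0),
   (168,0,0),(174,0,0),(152,50,26),(145,0,0),(171,0,0),(179,40,9),(147,0,0),(195,0,0),(197,34,19),
   (175,52,3),(158,0,0),(190,0,40),(154,0,0),(155,0,0),(188,23,7),(156,0,0),(196,51,20),
   (198,38,4),(184,38,4),(192,0,0),(181,0,50),(162,0,0),(189,0,0),(194,12,15),(193,12,18),
   (177,0,0),(186,29,17),(178,42,16),(187,23,7),(200,17,34),(199,36,26),(202,9,19),(201,5,16)]"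

definition z_list :: "(nat \<times> nat \<times> nat) list" where
 "z_list = [
  (2,0,0),(4,0,0),(7,0,0),(8,0,0),(6,0,0),(11,0,0),(1,0,0),(0,0,0),(15,30,1),(17,0,0),(19,0,0),
   (22,0,0),(23,0,0),(20,51,41),(26,0,0),(3,30,1),(28,0,0),(31,0,0),(32,0,0),(21,0,0),(35,0,0),
   (10,0,0),(5,0,0),(39,0,0),(40,0,0),(42,0,0),(45,0,0),(46,0,0),(30,0,0),(49,0,0),(16,0,0),
   (9,0,0),(38,0,0),(54,0,0),(24,29,51),(13,29,51),(56,0,0),(37,29,51),(18,0,0),(12,0,0),
   (34,51,41),(61,0,0),(44,0,0),(59,0,0),(25,0,0),(14,0,0),(68,0,0),(70,0,0),(72,0,0),(74,0,0),
   (75,0,0),(43,47,13),(78,0,0),(79,0,0),(82,0,0),(50,51,20),(71,51,20),(57,51,41),(84,0,0),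
   (51,47,13),(60,51,29),(67,0,0),(88,0,0),(76,47,13),(90,0,0),(92,0,0),(93,27,43),(41,0,0),
   (27,0,0),(95,0,0),(98,0,0),(36,29,17),(73,0,0),(48,0,0),(29,0,0),(55,29,17),(85,47,13),
   (101,0,0),(102,0,0),(81,0,0),(104,0,0),(53,0,0),(33,0,0),(107,0,0),(109,47,13),(63,0,0),
   (77,59,14),(110,0,0),(112,0,0),(64,59,14),(89,59,14),(94,10,40),(115,0,0),(116,0,0),(114,7,50),
   (97,0,0),(100,29,28),(69,0,0),(47,0,0),(122,0,0),(124,0,0),(86,59,14),(52,0,0),(103,49,2),
   (128,14,48),(130,0,0),(131,0,0),(134,0,0),(136,0,0),(58,47,13),(111,10,40),(87,7,50),(62,0,0),
   (140,0,0),(91,0,0),(65,0,0),(66,27,43),(142,0,0),(144,0,0),(145,0,0),(129,6,53),(146,0,0),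
   (149,0,0),(118,51,29),(96,51,29),(152,0,0),(154,0,0),(127,22,5),(80,14,48),(150,4,55),
   (132,0,0),(133,0,0),(105,0,0),(106,0,0),(83,0,0),(157,0,0),(160,0,0),(162,0,0),(163,11,49),
   (164,0,0),(167,0,0),(168,0,0),(170,0,0),(171,0,0),(123,29,28),(174,0,0),(148,0,0),(156,29,17),
   (121,0,0),(99,0,0),(120,0,0),(179,0,0),(175,52,3),(180,0,0),(158,0,0),(184,0,0),(186,0,0),
   (159,0,0),(126,0,0),(135,0,0),(108,0,0),(189,0,0),(192,0,0),(165,11,49),(166,0,0),(138,0,0),
   (139,0,0),(113,0,0),(169,0,0),(141,0,0),(117,0,0),(173,0,0),(151,50,26),(143,0,0),(119,0,0),
   (125,40,9),(196,0,0),(197,0,0),(195,34,19),(172,20,34),(182,0,0),(178,51,20),(153,0,0),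
   (187,42,9),(198,35,20),(176,51,20),(147,51,20),(188,44,16),(183,38,4),(191,0,0),(177,47,13),
   (161,0,0),(137,0,0),(200,0,0),(201,0,0),(181,47,39),(185,29,17),(190,47,13),(155,57,17),
   (194,4,55),(202,48,20),(199,6,53),(193,16,17)]"

text \<open>One matrix for each left coset of \<open>H\<close>, with \<open>E\<close> for
  \<open>H\<close> itself; signs are chosen so that every entry is
  \<open>normalised\<close>.\<close>

definition rep_list :: "(int \<times> int \<times> int \<times> int) list" where
 "rep_list = [
  (1,0,0,1),(6,1,21,23),(13,1,20,15),(14,12,9,14),(12,7,0,17),(11,12,21,23),(11,21,8,18),
   (14,1,20,16),(12,4,20,14),(1,3,0,1),(0,8,18,27),(10,24,16,24),(13,9,9,13),(6,17,8,18),
   (1,10,8,23),(5,9,16,0),(6,19,21,28),(13,11,20,17),(0,9,16,24),(11,14,20,15),(4,27,11,2),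
   (11,6,2,17),(1,17,5,28),(4,14,18,27),(14,25,9,12),(14,25,2,14),(8,21,5,6),(2,21,11,0),
   (12,14,0,17),(11,16,21,28),(11,25,8,13),(14,14,20,18),(13,4,21,11),(13,6,8,6),(6,19,18,4),
   (5,5,13,19),(13,15,24,1),(12,1,27,12),(13,24,5,16),(12,6,2,18),(12,11,20,16),(6,19,24,23),
   (10,20,20,14),(9,20,27,15),(5,13,7,1),(7,11,26,12),(8,12,2,14),(1,6,0,1),(0,8,18,23),
   (10,25,16,14),(13,19,9,11),(6,6,8,13),(11,19,9,13),(1,16,7,26),(3,26,3,7),(14,25,16,10),
   (10,7,18,4),(12,18,3,7),(11,27,27,11),(1,15,24,13),(1,13,8,18),(14,20,13,0),(4,8,21,6),
   (6,10,2,18),(2,11,3,17),(3,13,22,28),(9,28,5,6),(8,1,18,6),(10,4,13,14),(6,8,21,4),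
   (13,21,20,19),(0,9,16,14),(11,18,20,17),(11,10,2,23),(1,20,5,14),(4,26,18,23),(14,9,9,10),
   (12,18,26,27),(7,28,7,24),(9,27,20,15),(7,22,22,3),(8,11,13,18),(13,26,18,16),(4,26,16,10),
   (4,15,13,20),(1,16,22,5),(6,21,11,0),(13,4,13,13),(14,6,11,11),(14,4,5,16),(0,14,2,18),
   (11,19,18,18),(3,23,13,13),(1,0,14,1),(9,12,16,15),(12,21,0,17),(11,20,21,4),(11,0,8,8),
   (14,27,20,20),(13,16,8,1),(10,7,13,15),(8,0,21,11),(11,11,13,21),(8,24,8,6),(3,1,23,8),
   (11,22,16,11),(11,21,17,22),(10,0,1,3),(10,23,11,8),(8,23,6,21),(8,7,20,14),(6,15,16,16),
   (10,27,19,5),(0,6,24,13),(2,6,14,28),(6,7,6,12),(2,28,2,14),(1,9,0,1),(0,8,18,19),(13,0,9,9),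
   (6,24,8,8),(1,19,7,18),(3,6,3,16),(14,1,13,1),(2,10,11,12),(9,0,9,13),(13,13,11,20),
   (2,24,25,25),(12,14,12,2),(5,2,10,10),(14,7,25,25),(14,24,18,4),(4,0,17,22),(3,3,1,11),
   (14,26,17,13),(13,1,28,0),(4,12,12,0),(9,26,21,6),(4,5,4,27),(5,9,28,10),(5,25,17,4),
   (6,26,21,9),(13,2,20,21),(0,9,16,4),(11,22,20,19),(4,9,18,19),(9,25,20,17),(7,14,22,11),
   (8,6,13,28),(13,7,18,12),(5,25,16,28),(5,13,19,9),(10,13,25,21),(2,11,4,8),(6,15,19,9),
   (6,2,13,19),(6,7,1,11),(6,16,16,9),(10,1,28,0),(7,14,12,20),(6,11,28,8),(12,12,24,12),
   (7,4,27,28),(1,1,27,28),(6,11,27,11),(2,10,28,10),(11,20,26,21),(5,19,22,20),(12,28,0,17),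
   (11,4,8,3),(14,11,20,22),(13,24,21,21),(10,8,13,25),(13,15,5,17),(12,20,2,1),(8,19,8,1),
   (6,8,15,25),(9,14,18,12),(11,26,16,1),(3,25,21,11),(1,6,13,21),(14,6,4,8),(3,17,17,0),
   (9,27,10,14),(4,16,25,6),(8,24,4,23),(8,14,10,14),(14,18,11,8),(14,16,12,20),(6,23,20,14),
   (3,10,5,17),(11,23,14,3),(2,22,23,7),(14,16,24,13),(13,10,9,7),(14,9,23,19),(6,13,26,13),
   (10,9,14,4),(10,11,10,14),(9,23,25,6),(3,18,2,22),(4,21,18,15),(7,13,5,26)]"

text \<open>One matrix of each sign pair in \<open>H\<close>; entries 1 and 2 are the negatives of
  \<open>A0\<close> and \<open>B0\<close>.\<close>

definition sub_list :: "(int \<times> int \<times> int \<times> int) list" where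
 "sub_list = [
  (1,0,0,1),(12,0,0,17),(13,2,10,15),(11,5,4,23),(11,24,25,23),(14,2,10,16),(13,27,19,15),
   (6,24,25,18),(10,19,8,24),(6,5,4,18),(4,4,9,2),(14,27,19,16),(4,25,20,2),(1,5,17,28),
   (1,15,25,28),(10,10,21,24),(12,27,1,12),(12,23,10,12),(5,10,21,19),(12,2,28,12),(12,6,19,12),
   (5,19,8,19),(2,25,20,4),(1,24,12,28),(1,14,4,28),(2,4,9,4),(9,6,12,21),(9,21,18,26),
   (9,14,1,21),(8,14,1,20),(8,20,16,22),(8,23,17,20),(8,15,28,20),(8,9,13,22),(8,6,12,20),
   (3,21,18,20),(9,23,17,21),(9,8,11,26),(9,15,28,21),(7,9,13,21),(14,26,22,14),(14,16,14,14),
   (7,20,16,21),(6,22,26,23),(6,18,6,23),(3,8,11,20),(6,7,3,23),(6,11,23,23),(7,4,2,22),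
   (7,12,20,22),(14,3,7,14),(14,13,15,14),(3,19,5,3),(3,28,21,3),(3,10,24,3),(3,1,8,3),
   (7,25,27,22),(7,17,9,22),(0,9,16,0),(0,8,18,0)]"
text \<open>Positions of 31 different labels. A subgroup of a group of order 60 with more than 30
  elements is the whole group.\<close>

definition label_witnesses :: "(gen \<times> nat) list" where
 "label_witnesses = [
  (GX,0),(GY,0),(GZ,13),(GX,23),(GZ,34),(GX,35),(GY,60),(GZ,66),(GY,80),(GY,88),(GX,93),(GZ,103),
   (GX,116),(GY,120),(GZ,127),(GZ,129),(GX,133),(GZ,138),(GX,144),(GZ,152),(GX,171),(GX,173),
   (GY,175),(GY,178),(GX,179),(GZ,183),(GY,184),(GZ,184),(GY,187),(GZ,187),(GX,189)]"

fun table :: "gen \<Rightarrow> (nat \<times> nat \<times> nat) list" where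
  "table GX = x_list" | "table GY = y_list" | "table GZ = z_list"

text \<open>The identity beyond the table, as \<open>permutes\<close> demands.\<close>

definition perm :: "gen \<Rightarrow> nat \<Rightarrow> nat" where
  "perm s i = (if i < 203 then fst (table s ! i) else i)"
definition label :: "gen \<Rightarrow> nat \<Rightarrow> nat" where "label s i = fst (snd (table s ! i))"
definition coset_part :: "gen \<Rightarrow> nat \<Rightarrow> nat" where "coset_part s i = snd (snd (table s ! i))"
definition rep :: "nat \<Rightarrow> mat" where "rep i = rep_list ! i"
definition sub :: "nat \<Rightarrow> mat" where "sub k = sub_list ! k"

text \<open>The image of x is the negative of \<open>A0\<close>, so x fixes coset 0; those of y and
  z represent the cosets 1 and 2. The relators hold for these matrices up to sign.\<close>

fun gmat :: "gen \<Rightarrow> mat" where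
  "gmat GX = (12,0,0,17)" | "gmat GY = (6,1,21,23)" | "gmat GZ = (13,1,20,15)"

lemma table_all:
  "list_all2 (\<lambda>i t. perm s i = fst t \<and> label s i = fst (snd t) \<and> coset_part s i = snd (snd t)) [0..<203] (table s)"
proof (rule list_all2_uptI)
  show "length (table s) = 203" by (cases s) (simp_all add: x_list_def y_list_def z_list_def)
qed (simp add: perm_def label_def coset_part_def)

lemmas x_simps = table_all[of GX, unfolded table.simps x_list_def,
  simplified upt_unroll upt_rec_numeral, simplified]

lemmas y_simps = table_all[of GY, unfolded table.simps y_list_def,
  simplified upt_unroll upt_rec_numeral, simplified]

lemmas z_simps = table_all[of GZ, unfolded table.simps z_list_def,
  simplified upt_unroll upt_rec_numeral, simplified]

lemma rep_all: "list_all2 (\<lambda>i t. rep i = t) [0..<203] rep_list"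
  by (rule list_all2_uptI) (simp add: rep_list_def, simp add: rep_def)
lemmas rep_simps = rep_all[unfolded rep_list_def, simplified upt_unroll upt_rec_numeral, simplified]

lemma sub_all: "list_all2 (\<lambda>i t. sub i = t) [0..<60] sub_list"
  by (rule list_all2_uptI) (simp add: sub_list_def, simp add: sub_def)
lemmas sub_simps = sub_all[unfolded sub_list_def, simplified upt_unroll upt_rec_numeral, simplified]

text \<open>The imprimitive action of the wreath product on the 203 * 5 pairs of a coset and a
  point, where relations can be checked on numerals.\<close>

definition gact :: "gen \<Rightarrow> nat \<times> nat \<Rightarrow> nat \<times> nat" where
  "gact s = (\<lambda>(i,a). (perm s i, lab (label s i) a))"

definition wact :: "gen list \<Rightarrow> nat \<times> nat \<Rightarrow> nat \<times> nat" where "wact ws = foldr gact ws"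

definition wmat :: "gen list \<Rightarrow> mat" where "wmat ws = foldr (\<lambda>s. mmul (gmat s)) ws E"

definition fixes_block :: "gen list \<Rightarrow> nat \<Rightarrow> bool" where
  "fixes_block ws i \<longleftrightarrow> (\<forall>a\<in>{1,2,3,4,5}. wact ws (i,a) = (i,a))"

lemmas eval_simps = all_below_simps numeral_2_eq_2[symmetric] x_simps y_simps z_simps lab_simps

section \<open>Verification of the tables\<close>

lemma relator_xx: "all_below (fixes_block [GX,GX]) 203"
  by (simp add: eval_simps fixes_block_def wact_def gact_def)
lemma relator_yy: "all_below (fixes_block [GY,GY]) 203"
  by (simp add: eval_simps fixes_block_def wact_def gact_def)
lemma relator_zzz: "all_below (fixes_block [GZ,GZ,GZ]) 203"
  by (simp add: eval_simps fixes_block_def wact_def gact_def)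
lemma relator_yz: "all_below (fixes_block [GY,GZ,GY,GZ]) 203"
  by (simp add: eval_simps fixes_block_def wact_def gact_def)
lemma relator_xy: "all_below (fixes_block [GX,GY,GX,GY,GX,GY]) 203"
  by (simp add: eval_simps fixes_block_def wact_def gact_def)
lemma relator_zx: "all_below (fixes_block [GZ,GX,GZ,GX,GZ,GX,GZ,GX,GZ,GX]) 203"
  by (simp add: eval_simps fixes_block_def wact_def gact_def)

lemma relator_mats:
  "wmat [GX,GX] \<in> {E, (28,0,0,28)}" "wmat [GY,GY] \<in> {E, (28,0,0,28)}" "wmat [GZ,GZ,GZ] \<in> {E, (28,0,0,28)}"
  "wmat [GY,GZ,GY,GZ] \<in> {E, (28,0,0,28)}" "wmat [GX,GY,GX,GY,GX,GY] \<in> {E, (28,0,0,28)}"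
  "wmat [GZ,GX,GZ,GX,GZ,GX,GZ,GX,GZ,GX] \<in> {E, (28,0,0,28)}"
  by (simp_all add: wmat_def mmul_def mmul_int_def reduce29_def)

text \<open>Entry \<open>k\<close> tells how \<open>sub k\<close> arises, up to sign, from an
  earlier \<open>sub j\<close> by left multiplication with \<open>A0\<close> (\<open>True\<close>)
  or \<open>B0\<close> (\<open>False\<close>). The check runs over \<open>Suc k\<close>, as the
  identity has no predecessor.\<close>

definition sub_parents :: "(bool \<times> nat) list" where
 "sub_parents = [
  (True,0),(True,0),(False,0),(False,1),(True,2),(False,2),(True,3),(False,3),(False,4),(True,5),
   (False,6),(True,7),(True,8),(False,8),(False,9),(True,10),(False,10),(False,11),(False,12),
   (True,13),(True,14),(False,14),(False,15),(True,16),(True,17),(False,17),(False,18),(False,19),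
   (False,20),(False,22),(False,23),(False,24),(True,26),(True,27),(False,27),(False,28),
   (True,29),(True,30),(False,30),(False,31),(False,32),(False,33),(True,35),(False,36),
   (False,37),(True,39),(True,40),(False,40),(False,41),(False,42),(True,43),(False,43),
   (False,44),(False,45),(True,48),(True,49),(True,52),(True,53),(False,54),(False,56)]"

definition sub_parent_ok :: "nat \<Rightarrow> bool" where
  "sub_parent_ok k \<longleftrightarrow> (case sub_parents ! Suc k of (b,j) \<Rightarrow> j < Suc k \<and>
     (let P = mmul (if b then A0 else B0) (sub j) in sub (Suc k) = P \<or> sub (Suc k) = mneg P))"

lemma sub_parents: "all_below sub_parent_ok 59"
  by (simp add: all_below_simps sub_parent_ok_def sub_parents_def numeral_2_eq_2[symmetric] sub_simps
    A0_def B0_def mmul_def mmul_int_def reduce29_def mneg_def mneg_int_def)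

text \<open>Exactly one of \<open>A\<close> and \<open>mneg A\<close> is normalised, so that comparing cosets amounts to comparing matrices.\<close>

definition normalised :: "mat \<Rightarrow> bool" where
  "normalised = (\<lambda>(a,b,c,d). if a = 0 then 0 < b \<and> b \<le> 14 else 0 < a \<and> a \<le> 14)"

lemma distinct_sub_list: "distinct sub_list"
  by (simp add: sub_list_def)

lemma normalised_sub_list: "list_all (\<lambda>A. normalised A \<and> A \<in> mats \<and> mdet A = 1) sub_list"
  by (simp add: sub_list_def normalised_def mats_def mdet_def mdet_int_def)

text \<open>The last conjunct keeps the other representatives outside \<open>H\<close>; this makes
  \<open>H\<close> the full stabiliser of coset 0.\<close>

definition rep_ok :: "nat \<Rightarrow> bool" where
  "rep_ok i \<longleftrightarrow> normalised (rep i) \<and> rep i \<in> mats \<and> mdet (rep i) = 1 \<and> (rep i \<in> set sub_list \<longrightarrow> i = 0)"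

lemma rep_ok: "all_below rep_ok 203"
  by (simp add: all_below_simps rep_ok_def numeral_2_eq_2[symmetric] rep_simps normalised_def mats_def
    mdet_def mdet_int_def sub_list_def)

definition coset_ok :: "gen \<Rightarrow> nat \<Rightarrow> bool" where
  "coset_ok s i \<longleftrightarrow> perm s i < 203 \<and> label s i < 60 \<and> coset_part s i < 60 \<and>
     (let P = mmul (rep (perm s i)) (sub (coset_part s i)); R = mmul (gmat s) (rep i) in R = P \<or> R = mneg P)"

lemma coset_ok_x: "all_below (coset_ok GX) 203"
  by (simp add: all_below_simps coset_ok_def x_simps rep_simps sub_simps
    numeral_2_eq_2[symmetric] mmul_def mmul_int_def reduce29_def mneg_def mneg_int_def)
lemma coset_ok_y: "all_below (coset_ok GY) 203"
  by (simp add: all_below_simps coset_ok_def y_simps rep_simps sub_simps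
    numeral_2_eq_2[symmetric] mmul_def mmul_int_def reduce29_def mneg_def mneg_int_def)
lemma coset_ok_z: "all_below (coset_ok GZ) 203"
  by (simp add: all_below_simps coset_ok_def z_simps rep_simps sub_simps
    numeral_2_eq_2[symmetric] mmul_def mmul_int_def reduce29_def mneg_def mneg_int_def)

definition tree_edge :: "gen \<Rightarrow> nat \<Rightarrow> nat \<Rightarrow> bool" where
  "tree_edge s j i \<longleftrightarrow> j < i \<and> perm s j = i \<and> label s j = 0"

text \<open>The predecessor of \<open>i\<close> in the spanning tree is found by inverting a
  generator: x and y are involutions, and the inverse of z is its square. Predecessors have smaller
  numbers, which permits induction.\<close>

definition tree_ok :: "nat \<Rightarrow> bool" where
  "tree_ok i \<longleftrightarrow> i = 0 \<or> tree_edge GX (perm GX i) i \<or> tree_edge GY (perm GY i) i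
     \<or> tree_edge GZ (perm GZ (perm GZ i)) i"

lemma tree_ok: "all_below tree_ok 203"
  by (simp add: all_below_simps tree_ok_def tree_edge_def x_simps y_simps z_simps numeral_2_eq_2[symmetric])

lemma label_witnesses:
  "distinct (map (\<lambda>(s,i). label s i) label_witnesses)" "list_all (\<lambda>(s,i). i < 203) label_witnesses"
  "length label_witnesses = 31"
  by (simp_all add: label_witnesses_def x_simps y_simps z_simps)

text \<open>The two words have the same image in \<open>PSL(2,29)\<close>, but their labels agree at five cosets only, and 5 is less than
  every nontrivial divisor of 203.\<close>

definition word_u :: "gen list" where
  "word_u = [GX,GY,GX,GZ,GX,GY,GZ,GX,GZ,GY,GX,GZ,GY,GX,GZ,GX]"
definition word_v :: "gen list" where
  "word_v = [GZ,GX,GZ,GY,GX,GZ,GY,GX,GZ,GX,GY,GZ,GX,GY,GZ]"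

definition agree :: "nat \<Rightarrow> bool" where
  "agree i \<longleftrightarrow> (\<forall>a\<in>{1,2,3,4,5}. wact word_u (i,a) = wact word_v (i,a))"

definition agree_ok :: "nat \<Rightarrow> bool" where
  "agree_ok i \<longleftrightarrow> agree i = (i \<in> {141,147,154,167,198})
     \<and> fst (wact word_u (i,1)) = fst (wact word_v (i,1))"

lemma agree_ok: "all_below agree_ok 203"
  by (simp add: eval_simps agree_ok_def agree_def word_u_def word_v_def wact_def gact_def)

text \<open>The first fact puts the quotient of the two words into the kernel over \<open>G\<close>.
  The other two exhibit an upper and a lower transvection, so the image is all of
  \<open>G\<close>.\<close>

lemma word_mats:
  "wmat word_u = wmat word_v \<or> wmat word_u = mneg (wmat word_v)"
  "\<exists>u. wmat [GZ,GY,GX] \<in> {(1,u,0,1), mneg (1,u,0,1)} \<and> \<not> 29 dvd u \<and> u \<in> {0..<29}"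
  "\<exists>u. wmat [GY,GX,GZ,GX,GY,GZ,GX,GY] \<in> {(1,0,u,1), mneg (1,0,u,1)} \<and> \<not> 29 dvd u \<and> u \<in> {0..<29}"
  apply (simp add: word_u_def word_v_def wmat_def mmul_def mmul_int_def reduce29_def mneg_def mneg_int_def)
  apply (rule exI[of _ 26], simp add: wmat_def mmul_def mmul_int_def reduce29_def mneg_def mneg_int_def)
  apply (rule exI[of _ 14], simp add: wmat_def mmul_def mmul_int_def reduce29_def mneg_def mneg_int_def)
  done

section \<open>The finite quotient\<close>

abbreviation "A5 \<equiv> alt_group 5"
abbreviation "Idx \<equiv> {..<203::nat}"
abbreviation "W \<equiv> wreath G A5 Idx"

type_synonym welt = "mat set \<times> (nat \<Rightarrow> nat) \<times> (nat \<Rightarrow> nat \<Rightarrow> nat)"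

interpretation W: group W
  by (rule group_wreath[OF P.is_group alt_group_is_group])

text \<open>So far a mere set of sixty elements; that it is a subgroup will follow from the
  hypothesis on \<open>G1\<close>.\<close>

definition H :: "mat set set" where "H = cl ` set sub_list"

definition lift :: "gen \<Rightarrow> welt" where
  "lift s = (cl (gmat s), perm s, \<lambda>i\<in>Idx. lab (label s i))"

lemma coset_ok: "i < 203 \<Longrightarrow> coset_ok s i"
  using coset_ok_x coset_ok_y coset_ok_z by (cases s) (auto simp: all_below_def)

lemma perm_lt: "i < 203 \<Longrightarrow> perm s i < 203"
  and label_lt: "i < 203 \<Longrightarrow> label s i < 60"
  using coset_ok[of i s] by (auto simp: coset_ok_def)

lemma gmat_SL2: "gmat s \<in> carrier (SL2 29)"
  by (cases s) (simp_all add: SL2_carrier mats_def mdet_def mdet_int_def)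

lemma perm_outside: "\<not> i < 203 \<Longrightarrow> perm s i = i"
  by (simp add: perm_def)

lemma fst_wact: "fst (wact ws (i,a)) = foldr perm ws i"
  by (induction ws arbitrary: i a) (auto simp: wact_def gact_def case_prod_beta)

lemma perm_perm: 
  "perm GX (perm GX i) = i" "perm GY (perm GY i) = i" "perm GZ (perm GZ (perm GZ i)) = i"
proof -
  have "foldr perm ws i = i" if "all_below (fixes_block ws) 203" "i < 203" for ws i
    using that fst_wact[of ws i 1] by (simp add: all_below_def fixes_block_def)
  from this[OF relator_xx] this[OF relator_yy] this[OF relator_zzz]
  show "perm GX (perm GX i) = i" "perm GY (perm GY i) = i" "perm GZ (perm GZ (perm GZ i)) = i"
    by (cases "i < 203"; simp add: perm_outside)+
qed

lemma perm_permutes: "perm s permutes Idx"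
proof (rule bij_imp_permutes)
  have "inj (perm s)"
    by (cases s; rule injI) (metis perm_perm)+
  then show "bij_betw (perm s) Idx Idx"
    by (intro bij_betw_imageI endo_inj_surj) (auto intro: inj_on_subset perm_lt)
qed (simp add: perm_outside)

lemma lift_carrier: "lift s \<in> carrier W"
  using gmat_SL2 perm_permutes lab_in_alt5 label_lt
  by (auto simp: lift_def wreath_carrier restrict_PiE_iff simp del: PiE_iff)

definition word :: "gen list \<Rightarrow> welt" where "word ws = foldr (\<lambda>s. mult W (lift s)) ws \<one>\<^bsub>W\<^esub>"

lemma word_Cons: "word (s # ws) = lift s \<otimes>\<^bsub>W\<^esub> word ws" and word_Nil: "word [] = \<one>\<^bsub>W\<^esub>"
  by (simp_all add: word_def)

lemma word_carrier: "word ws \<in> carrier W"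
  by (induction ws) (auto simp: word_Cons word_Nil lift_carrier)

lemma wmat_SL2: "wmat ws \<in> carrier (SL2 29)"
  by (induction ws) (auto simp: wmat_def gmat_SL2)

lemma fst_word: "fst (word ws) = cl (wmat ws)"
proof (induction ws)
  case Nil then show ?case by (simp add: word_Nil wreath_one wmat_def cl_one)
next
  case (Cons s ws)
  have "fst (word (s # ws)) = cl (gmat s) \<otimes>\<^bsub>G\<^esub> fst (word ws)"
    by (cases "word ws") (simp add: word_Cons lift_def wreath_mult)
  then show ?case using Cons cl_mult[OF gmat_SL2 wmat_SL2] by (simp add: wmat_def)
qed

lemma word_act: "i < 203 \<Longrightarrow> wact ws (i,a) = (fst (snd (word ws)) i, snd (snd (word ws)) i a) \<and> fst (snd (word ws)) i < 203"
proof (induction ws)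
  case Nil then show ?case by (simp add: word_Nil wact_def wreath_one alt_group_one)
next
  case (Cons s ws)
  obtain g p t where w: "word ws = (g,p,t)" by (cases "word ws")
  have "wact (s # ws) (i,a) = gact s (p i, t i a)" "p i < 203"
    using Cons w by (simp_all add: wact_def)
  then show ?case
    using Cons.prems by (simp add: word_Cons w lift_def wreath_mult gact_def alt_group_mult perm_lt)
qed

lemma W_eqI:
  assumes "u \<in> carrier W" "v \<in> carrier W" "fst u = fst v"
    and "\<And>i. i < 203 \<Longrightarrow> fst (snd u) i = fst (snd v) i"
    and "\<And>i. i < 203 \<Longrightarrow> snd (snd u) i = snd (snd v) i"
  shows "u = v"
proof -
  obtain g p s g' p' s' where eq: "u = (g,p,s)" "v = (g',p',s')" by (metis prod_cases3)
  have c: "p permutes Idx" "p' permutes Idx" "s \<in> Idx \<rightarrow>\<^sub>E carrier A5" "s' \<in> Idx \<rightarrow>\<^sub>E carrier A5"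
    using assms(1,2) by (simp_all add: eq wreath_carrier)
  have "p i = p' i" for i
    using assms(4)[of i] c(1,2) permutes_not_in[of p Idx i] permutes_not_in[of p' Idx i]
    by (cases "i < 203") (simp_all add: eq)
  moreover have "s = s'"
    by (rule PiE_ext[OF c(3,4)]) (use assms(5) in \<open>simp add: eq\<close>)
  ultimately show ?thesis using assms(3) by (auto simp: eq)
qed

lemma lab_part: "q \<in> carrier W \<Longrightarrow> i < 203 \<Longrightarrow> snd (snd q) i \<in> carrier A5"
  by (cases q) (auto simp: wreath_carrier)

lemma perm_part: "q \<in> carrier W \<Longrightarrow> i < 203 \<Longrightarrow> fst (snd q) i < 203"
  using permutes_in_image[of "fst (snd q)" Idx i] by (cases q) (auto simp: wreath_carrier)

text \<open>An even permutation of five points is determined by its values there, so fixing every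
  pair makes the permutation and all labels trivial; the sign of the matrix disappears in
  \<open>G\<close>.\<close>

lemma word_relator:
  assumes "all_below (fixes_block ws) 203" "wmat ws \<in> {E, (28,0,0,28)}"
  shows "word ws = \<one>\<^bsub>W\<^esub>"
proof (rule W_eqI[OF word_carrier W.one_closed])
  show "fst (word ws) = fst \<one>\<^bsub>W\<^esub>"
  proof -
    have "cl (28,0,0,28) = cl E" using cl_mneg[of E] by (simp add: mneg_E mats_def)
    then have "cl (wmat ws) = cl E" using assms(2) by (elim insertE) simp_all
    then show ?thesis by (simp only: fst_word wreath_one cl_one fst_conv)
  qed
  fix i :: nat assume i: "i < 203"
  have fb: "wact ws (i,a) = (i,a)" if "a \<in> {1,2,3,4,5}" for a
    using assms(1) i that by (auto simp: all_below_def fixes_block_def)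
  show "fst (snd (word ws)) i = fst (snd \<one>\<^bsub>W\<^esub>) i"
    using word_act[OF i, of ws 1] fb[of 1] by (simp add: wreath_one)
  have "snd (snd (word ws)) i = id"
  proof (rule alt5_eqI)
    show "snd (snd (word ws)) i \<in> carrier A5" by (rule lab_part[OF word_carrier i])
    show "id \<in> carrier A5" using A5.one_closed by (simp add: alt_group_one)
    show "\<forall>a\<in>{1,2,3,4,5}. snd (snd (word ws)) i a = id a"
      using word_act[OF i, of ws] fb by auto
  qed
  then show "snd (snd (word ws)) i = snd (snd \<one>\<^bsub>W\<^esub>) i" using i by (simp add: wreath_one alt_group_one)
qed

section \<open>The subgroup generated by the lifts as a finite quotient\<close>

definition Q :: "welt monoid" where "Q = W\<lparr>carrier := generate W (range lift)\<rparr>"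

lemma range_lift: "range lift = {lift GX, lift GY, lift GZ}"
proof -
  have "UNIV = {GX, GY, GZ}" using gen.exhaust by auto
  then show ?thesis by (metis image_insert image_empty)
qed

lemma Q_subgroup: "subgroup (carrier Q) W"
  unfolding Q_def using W.generate_is_subgroup[of "range lift"] lift_carrier by auto

lemma Q_group: "group Q"
  using W.subgroup_imp_group[OF Q_subgroup] by (simp add: Q_def)

interpretation Q: group Q by (rule Q_group)

lemma Q_mult [simp]: "mult Q = mult W" and Q_one [simp]: "one Q = one W"
  by (simp_all add: Q_def)

lemma Q_in_W: "q \<in> carrier Q \<Longrightarrow> q \<in> carrier W"
  using subgroup.subset[OF Q_subgroup] by auto

lemma lift_Q: "lift s \<in> carrier Q"
  by (auto simp: Q_def intro: generate.incl)

lemma word_Q: "word ws \<in> carrier Q"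
  using Q.m_closed[OF lift_Q] Q.one_closed by (induction ws) (auto simp: word_Cons word_Nil)

lemma finite_Q: "finite (carrier Q)"
proof (rule finite_subset)
  show "carrier Q \<subseteq> carrier W" using Q_in_W by auto
  have "finite (carrier A5)" using card_alt5 card.infinite by fastforce
  then show "finite (carrier W)" by (intro finite_wreath finite_G) auto
qed

lemma Gamma_quotient_Q: "Gamma_quotient Q"
proof -
  note Qs = lift_Q[of GX] lift_Q[of GY] lift_Q[of GZ]
  note Ws = lift_carrier[of GX] lift_carrier[of GY] lift_carrier[of GZ]
  have pow: "q [^]\<^bsub>Q\<^esub> (2::nat) = q \<otimes>\<^bsub>Q\<^esub> q"
    "q [^]\<^bsub>Q\<^esub> (3::nat) = q \<otimes>\<^bsub>Q\<^esub> q \<otimes>\<^bsub>Q\<^esub> q"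
    "q [^]\<^bsub>Q\<^esub> (5::nat) = q \<otimes>\<^bsub>Q\<^esub> q \<otimes>\<^bsub>Q\<^esub> q \<otimes>\<^bsub>Q\<^esub> q \<otimes>\<^bsub>Q\<^esub> q"
    if "q \<in> carrier Q" for q
    using that by (simp_all add: eval_nat_numeral del: Q_mult Q_one)
  have "lift GX [^]\<^bsub>Q\<^esub> (2::nat) = word [GX,GX]" "lift GY [^]\<^bsub>Q\<^esub> (2::nat) = word [GY,GY]"
    "lift GZ [^]\<^bsub>Q\<^esub> (3::nat) = word [GZ,GZ,GZ]"
    "(lift GY \<otimes>\<^bsub>Q\<^esub> lift GZ) [^]\<^bsub>Q\<^esub> (2::nat) = word [GY,GZ,GY,GZ]"
    "(lift GZ \<otimes>\<^bsub>Q\<^esub> lift GX) [^]\<^bsub>Q\<^esub> (5::nat) = word [GZ,GX,GZ,GX,GZ,GX,GZ,GX,GZ,GX]"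
    "(lift GX \<otimes>\<^bsub>Q\<^esub> lift GY) [^]\<^bsub>Q\<^esub> (3::nat) = word [GX,GY,GX,GY,GX,GY]"
    using Ws Qs Q.m_closed[OF Qs(2,3)] Q.m_closed[OF Qs(3,1)] Q.m_closed[OF Qs(1,2)]
    by (simp_all add: pow word_Cons word_Nil W.m_assoc)
  then have "lift GX [^]\<^bsub>Q\<^esub> (2::nat) = \<one>\<^bsub>Q\<^esub>" "lift GY [^]\<^bsub>Q\<^esub> (2::nat) = \<one>\<^bsub>Q\<^esub>"
    "lift GZ [^]\<^bsub>Q\<^esub> (3::nat) = \<one>\<^bsub>Q\<^esub>" "(lift GY \<otimes>\<^bsub>Q\<^esub> lift GZ) [^]\<^bsub>Q\<^esub> (2::nat) = \<one>\<^bsub>Q\<^esub>"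
    "(lift GZ \<otimes>\<^bsub>Q\<^esub> lift GX) [^]\<^bsub>Q\<^esub> (5::nat) = \<one>\<^bsub>Q\<^esub>" "(lift GX \<otimes>\<^bsub>Q\<^esub> lift GY) [^]\<^bsub>Q\<^esub> (3::nat) = \<one>\<^bsub>Q\<^esub>"
    using word_relator[OF relator_xx relator_mats(1)] word_relator[OF relator_yy relator_mats(2)]
      word_relator[OF relator_zzz relator_mats(3)] word_relator[OF relator_yz relator_mats(4)]
      word_relator[OF relator_xy relator_mats(5)] word_relator[OF relator_zx relator_mats(6)] by simp_all
  moreover have "generate Q {lift GX, lift GY, lift GZ} = carrier Q"
  proof -
    have "generate (W\<lparr>carrier := generate W (range lift)\<rparr>) (range lift) = generate W (range lift)"
      using W.generate_consistent[OF _ W.generate_is_subgroup[of "range lift"], of "range lift"] lift_carrier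
      by (metis generate.incl image_subsetI subsetI)
    then show ?thesis by (simp add: Q_def range_lift)
  qed
  ultimately show ?thesis
    unfolding Gamma_quotient_def using Q_group finite_Q Qs by blast
qed

lemma fst_hom: "fst \<in> hom Q G"
proof (rule homI)
  show "fst q \<in> carrier G" if "q \<in> carrier Q" for q
    using Q_in_W[OF that] by (cases q) (simp add: wreath_carrier)
  show "fst (q \<otimes>\<^bsub>Q\<^esub> r) = fst q \<otimes>\<^bsub>G\<^esub> fst r" for q r
    by (cases q; cases r) (simp add: wreath_mult)
qed

interpretation fst: group_hom Q G fst
  by unfold_locales (rule fst_hom)

lemma fst_surj: "fst ` carrier Q = carrier G"
proof -
  have J: "subgroup (fst ` carrier Q) G" by (rule fst.subgroup_img_is_subgroup[OF Q.subgroup_self])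
  obtain u where u: "wmat [GZ,GY,GX] \<in> {(1,u,0,1), mneg (1,u,0,1)}" "\<not> 29 dvd u" "u \<in> {0..<29}"
    using word_mats(2) by auto
  obtain v where v: "wmat [GY,GX,GZ,GX,GY,GZ,GX,GY] \<in> {(1,0,v,1), mneg (1,0,v,1)}" "\<not> 29 dvd v" "v \<in> {0..<29}"
    using word_mats(3) by auto
  have "cl (wmat ws) \<in> fst ` carrier Q" for ws using word_Q[of ws] fst_word[of ws] by (metis imageI)
  then have "cl (1,u,0,1) \<in> fst ` carrier Q" "cl (1,0,v,1) \<in> fst ` carrier Q"
    using u v cl_mneg[of "(1,u,0,1)"] cl_mneg[of "(1,0,v,1)"] by (auto simp: mats_def) metis+
  then show ?thesis using transvections_generate[OF J] u v by blast
qed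

section \<open>Loops at the base coset and their labels\<close>

lemma act_mult: "fst (snd (q \<otimes>\<^bsub>W\<^esub> r)) i = fst (snd q) (fst (snd r) i)"
  by (cases q; cases r) (simp add: wreath_mult)

lemma lab_mult: "i < 203 \<Longrightarrow> snd (snd (q \<otimes>\<^bsub>W\<^esub> r)) i = snd (snd q) (fst (snd r) i) \<circ> snd (snd r) i"
  by (cases q; cases r) (simp add: wreath_mult alt_group_mult)

text \<open>The product of the lifts along a tree path collects only trivial labels.\<close>

lemma tree_element:
  "i < 203 \<Longrightarrow> \<exists>q\<in>carrier Q. fst (snd q) 0 = i \<and> snd (snd q) 0 = id"
proof (induction i rule: less_induct)
  case (less i)
  show ?case
  proof (cases "i = 0")
    case True
    then show ?thesis
      using Q.one_closed by (intro bexI[of _ "\<one>\<^bsub>W\<^esub>"]) (auto simp: wreath_one alt_group_one)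
  next
    case False
    then obtain s j where "tree_edge s j i"
      using tree_ok less.prems by (auto simp: all_below_def tree_ok_def)
    then have j: "j < i" "perm s j = i" "label s j = 0" by (auto simp: tree_edge_def)
    have "j < 203" using j less.prems by simp
    then obtain q where q: "q \<in> carrier Q" "fst (snd q) 0 = j" "snd (snd q) 0 = id"
      using less.IH[OF j(1)] by blast
    from \<open>j < 203\<close> have "fst (snd (lift s \<otimes>\<^bsub>W\<^esub> q)) 0 = i" "snd (snd (lift s \<otimes>\<^bsub>W\<^esub> q)) 0 = id"
      using q j by (simp_all add: act_mult lab_mult lift_def lab_0)
    then show ?thesis using Q.m_closed[OF lift_Q q(1), of s] by auto
  qed
qed

lemma lab_inverse:
  assumes q: "q \<in> carrier Q" "fst (snd q) 0 = i" "snd (snd q) 0 = id"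
  shows "fst (snd (inv\<^bsub>Q\<^esub> q)) i = 0" "snd (snd (inv\<^bsub>Q\<^esub> q)) i = id"
proof -
  have "inv\<^bsub>Q\<^esub> q \<otimes>\<^bsub>W\<^esub> q = \<one>\<^bsub>W\<^esub>" using Q.l_inv[OF q(1)] by simp
  then show "fst (snd (inv\<^bsub>Q\<^esub> q)) i = 0" "snd (snd (inv\<^bsub>Q\<^esub> q)) i = id"
    using act_mult[of "inv\<^bsub>Q\<^esub> q" q 0] lab_mult[of 0 "inv\<^bsub>Q\<^esub> q" q] q
    by (simp_all add: wreath_one alt_group_one)
qed

text \<open>Go along the tree to \<open>i\<close>, apply the generator, and return along the tree:
  only the middle edge contributes a label.\<close>

lemma label_loop:
  assumes i: "i < 203"
  shows "\<exists>q\<in>carrier Q. fst (snd q) 0 = 0 \<and> snd (snd q) 0 = lab (label s i)"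
proof -
  obtain q where q: "q \<in> carrier Q" "fst (snd q) 0 = i" "snd (snd q) 0 = id"
    using tree_element[OF i] by auto
  obtain r where r: "r \<in> carrier Q" "fst (snd r) 0 = perm s i" "snd (snd r) 0 = id"
    using tree_element[OF perm_lt[OF i]] by blast
  let ?t = "inv\<^bsub>Q\<^esub> r \<otimes>\<^bsub>W\<^esub> (lift s \<otimes>\<^bsub>W\<^esub> q)"
  have "fst (snd ?t) 0 = 0" "snd (snd ?t) 0 = lab (label s i)"
    using q r i lab_inverse[OF r] by (simp_all add: act_mult lab_mult lift_def)
  moreover have "?t \<in> carrier Q" using Q.m_closed[OF Q.inv_closed[OF r(1)] Q.m_closed[OF lift_Q q(1)]] by simp
  ultimately show ?thesis by blast
qed

text \<open>The loop labels form a subgroup containing 31 distinct elements; by Lagrange it has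
  order 60.\<close>

lemma loop_labels: "{snd (snd q) 0 | q. q \<in> carrier Q \<and> fst (snd q) 0 = 0} = carrier A5" (is "?D = _")
proof -
  have finA: "finite (carrier A5)" using card_alt5 card.infinite by fastforce
  have sub: "?D \<subseteq> carrier A5"
  proof (rule subsetI, elim CollectE exE conjE)
    fix a q assume "a = snd (snd q) 0" "q \<in> carrier Q"
    then show "a \<in> carrier A5" using lab_part[OF Q_in_W, of q 0] by simp
  qed
  have "subgroup ?D A5"
  proof (rule A5.subgroupI[OF sub])
    show "?D \<noteq> {}" using tree_element[of 0] by force
  next
    fix a assume "a \<in> ?D"
    then obtain q where q: "q \<in> carrier Q" "fst (snd q) 0 = 0" "a = snd (snd q) 0" by blast
    have e: "inv\<^bsub>Q\<^esub> q \<otimes>\<^bsub>W\<^esub> q = \<one>\<^bsub>W\<^esub>" using Q.l_inv[OF q(1)] by simp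
    have "fst (snd (inv\<^bsub>Q\<^esub> q)) 0 = 0" "snd (snd (inv\<^bsub>Q\<^esub> q)) 0 \<circ> a = id"
      using e act_mult[of "inv\<^bsub>Q\<^esub> q" q 0] lab_mult[of 0 "inv\<^bsub>Q\<^esub> q" q] q
      by (simp_all add: wreath_one alt_group_one)
    moreover have "a \<in> carrier A5" "snd (snd (inv\<^bsub>Q\<^esub> q)) 0 \<in> carrier A5"
      using lab_part[OF Q_in_W[OF q(1)], of 0] lab_part[OF Q_in_W[OF Q.inv_closed[OF q(1)]], of 0] q(3)
      by simp_all
    ultimately have "inv\<^bsub>A5\<^esub> a = snd (snd (inv\<^bsub>Q\<^esub> q)) 0"
      by (intro A5.inv_equality) (simp_all add: alt_group_mult alt_group_one)
    then show "inv\<^bsub>A5\<^esub> a \<in> ?D"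
      using Q.inv_closed[OF q(1)] \<open>fst (snd (inv\<^bsub>Q\<^esub> q)) 0 = 0\<close> by blast
  next
    fix a b assume "a \<in> ?D" "b \<in> ?D"
    then obtain q r where q: "q \<in> carrier Q" "fst (snd q) 0 = 0" "a = snd (snd q) 0"
      and r: "r \<in> carrier Q" "fst (snd r) 0 = 0" "b = snd (snd r) 0" by blast
    have "q \<otimes>\<^bsub>W\<^esub> r \<in> carrier Q" using Q.m_closed[OF q(1) r(1)] by simp
    then show "a \<otimes>\<^bsub>A5\<^esub> b \<in> ?D"
      using q r act_mult[of q r 0] lab_mult[of 0 q r]
      by (intro CollectI exI[of _ "q \<otimes>\<^bsub>W\<^esub> r"]) (simp add: alt_group_mult)
  qed
  then have "card (rcosets\<^bsub>A5\<^esub> ?D) * card ?D = 60"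
    using A5.lagrange by (simp add: order_def card_alt5)
  moreover have "31 \<le> card ?D"
  proof -
    let ?L = "map (\<lambda>(s,i). label s i) label_witnesses"
    have lt: "set ?L \<subseteq> {..<60}" using label_witnesses(2) label_lt by (auto simp: list_all_iff)
    have "card (lab ` set ?L) = card (set ?L)"
      by (rule card_image) (rule inj_on_subset[OF inj_lab lt])
    also have "\<dots> = 31" using label_witnesses(1,3) by (metis distinct_card length_map)
    finally have c31: "card (lab ` set ?L) = 31" .
    have "lab ` set ?L \<subseteq> ?D"
    proof
      fix a assume "a \<in> lab ` set ?L"
      then obtain s i where "(s,i) \<in> set label_witnesses" "a = lab (label s i)" by auto
      then have "i < 203" using label_witnesses(2) by (auto simp: list_all_iff)
      from label_loop[OF this, of s] obtain q where "q \<in> carrier Q" "fst (snd q) 0 = 0" "snd (snd q) 0 = a"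
        unfolding \<open>a = _\<close> by blast
      then show "a \<in> ?D" by blast
    qed
    from card_mono[OF finite_subset[OF sub finA] this] show ?thesis unfolding c31 .
  qed
  moreover have "d = 60" if "r * d = 60" "31 \<le> d" for r d :: nat
  proof -
    have "r < 2"
    proof (rule ccontr)
      assume "\<not> r < 2"
      then have "2 * 31 \<le> r * d" using that(2) by (intro mult_le_mono) auto
      then show False using that(1) by simp
    qed
    then have "r = 0 \<or> r = 1" by linarith
    then show ?thesis using that(1) by (elim disjE) simp_all
  qed
  ultimately have "card ?D = 60" by blast
  then show ?thesis by (intro card_subset_eq[OF finA sub]) (simp add: card_alt5)
qed

section \<open>Identification of the base stabiliser with H\<close>

lemma normalised_unique:
  assumes "normalised A" "normalised B" "A \<in> mats" "B \<in> mats" "cl A = cl B"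
  shows "A = B"
proof (rule ccontr)
  assume "A \<noteq> B"
  then have "A = mneg B" using assms by (simp add: cl_eq_iff)
  moreover have "- a mod 29 = 29 - a" if "0 < a" "a \<le> 14" for a :: int
    using that by (intro mod29I) auto
  ultimately show False
    using assms(1-4)
    by (cases A; cases B) (auto simp: normalised_def mneg_def mneg_int_def reduce29_def mats_def split: if_splits)
qed

lemma rep_facts: "i < 203 \<Longrightarrow> rep i \<in> carrier (SL2 29) \<and> normalised (rep i)"
  using rep_ok by (auto simp: all_below_def rep_ok_def SL2_carrier)

lemma sub_list_facts: "A \<in> set sub_list \<Longrightarrow> A \<in> carrier (SL2 29) \<and> normalised A"
  using normalised_sub_list by (auto simp: list_all_iff SL2_carrier)

lemma length_sub_list: "length sub_list = 60" by (simp add: sub_list_def)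

lemma sub_in: "k < 60 \<Longrightarrow> sub k \<in> set sub_list"
  by (simp add: sub_def length_sub_list)

lemma card_H: "card H = 60" and finite_H: "finite H"
proof -
  have "inj_on cl (set sub_list)"
    using sub_list_facts normalised_unique by (intro inj_onI) (blast intro: SL2_carrier[THEN equalityD1, THEN subsetD, THEN CollectD, THEN conjunct1])
  then show "card H = 60"
    using distinct_card[OF distinct_sub_list] by (simp add: H_def card_image length_sub_list)
  show "finite H" by (simp add: H_def)
qed

lemma H_carrier: "H \<subseteq> carrier G"
  using sub_list_facts by (auto simp: H_def)

lemma rep_H: "i < 203 \<Longrightarrow> cl (rep i) \<in> H \<Longrightarrow> i = 0"
proof -
  assume i: "i < 203" and "cl (rep i) \<in> H"
  then obtain A where A: "A \<in> set sub_list" "cl (rep i) = cl A" by (auto simp: H_def)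
  then have "rep i = A"
    using rep_facts[OF i] sub_list_facts[OF A(1)] normalised_unique[of "rep i" A] by (simp add: SL2_carrier)
  then show "i = 0" using rep_ok i A by (simp add: all_below_def rep_ok_def)
qed

text \<open>Induction along \<open>sub_parents\<close> puts every element of \<open>H\<close> into
  \<open>K0\<close>, and equal cardinality does the rest. Only \<open>K0\<close> is known to be a
  subgroup.\<close>

lemma H_unique:
  assumes K0: "subgroup K0 G" "card K0 = 60" and gens: "cl A0 \<in> K0" "cl B0 \<in> K0"
  shows "K0 = H"
proof -
  have SLs: "A0 \<in> carrier (SL2 29)" "B0 \<in> carrier (SL2 29)"
    by (simp_all add: A0_def B0_def SL2_carrier mats_def mdet_def mdet_int_def)
  have "cl (sub k) \<in> K0" if "k < 60" for k
    using that
  proof (induction k rule: less_induct)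
    case (less k)
    show ?case
    proof (cases k)
      case 0
      then show ?thesis using subgroup.one_closed[OF K0(1)] by (simp add: sub_simps cl_one)
    next
      case (Suc k')
      obtain b j where bj: "sub_parents ! Suc k' = (b,j)" by (cases "sub_parents ! Suc k'")
      define P where "P = mmul (if b then A0 else B0) (sub j)"
      have "sub_parent_ok k'" using sub_parents less.prems Suc by (simp add: all_below_def)
      then have j: "j < k" and P: "sub k = P \<or> sub k = mneg P"
        using bj Suc by (simp_all add: sub_parent_ok_def Let_def P_def)
      have sj: "sub j \<in> carrier (SL2 29)" using sub_list_facts sub_in j less.prems by simp
      have "cl (sub j) \<in> K0" using less.IH[OF j] j less.prems by simp
      then have "cl (if b then A0 else B0) \<otimes>\<^bsub>G\<^esub> cl (sub j) \<in> K0"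
        using gens subgroup.m_closed[OF K0(1)] by simp
      then have "cl P \<in> K0" using SLs sj by (cases b) (simp_all add: P_def cl_mult)
      moreover have "cl (sub k) = cl P" using P cl_mneg[of P] by (metis P_def mmul_mats)
      ultimately show ?thesis by simp
    qed
  qed
  moreover have "set sub_list = sub ` {..<60}"
    unfolding set_conv_nth length_sub_list sub_def[abs_def] by blast
  ultimately have "H \<subseteq> K0" by (auto simp: H_def)
  moreover have "finite K0" using K0(2) card.infinite by fastforce
  ultimately show ?thesis using card_H K0(2) by (metis card_subset_eq)
qed

text \<open>The elements of the wreath product whose permutation agrees with left multiplication on
  the cosets form a subgroup \<open>T\<close>. It contains the three lifts, by the third column of
  the tables.\<close>

lemma coset_relation:
  assumes H: "subgroup H G" and q: "q \<in> carrier Q" and i: "i < 203"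
  shows "\<exists>h\<in>H. fst q \<otimes>\<^bsub>G\<^esub> cl (rep i) = cl (rep (fst (snd q) i)) \<otimes>\<^bsub>G\<^esub> h"
proof -
  define T where "T = {q \<in> carrier W. \<forall>i<203. \<exists>h\<in>H.
    fst q \<otimes>\<^bsub>G\<^esub> cl (rep i) = cl (rep (fst (snd q) i)) \<otimes>\<^bsub>G\<^esub> h}"
  have fc: "fst q \<in> carrier G" if "q \<in> carrier W" for q using that by (cases q) (simp add: wreath_carrier)
  have fm: "fst (q \<otimes>\<^bsub>W\<^esub> r) = fst q \<otimes>\<^bsub>G\<^esub> fst r" for q r by (cases q; cases r) (simp add: wreath_mult)
  have rc: "cl (rep i) \<in> carrier G" if "i < 203" for i using rep_facts[OF that] by simp
  have hc: "h \<in> carrier G" if "h \<in> H" for h using H_carrier that by auto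
  have "subgroup T W"
  proof (rule W.subgroupI)
    show "T \<subseteq> carrier W" by (auto simp: T_def)
    have "\<one>\<^bsub>W\<^esub> \<in> T"
      using rc subgroup.one_closed[OF H] unfolding T_def
      by (intro CollectI conjI W.one_closed allI impI bexI[of _ "\<one>\<^bsub>G\<^esub>"]) (simp_all add: wreath_one)
    then show "T \<noteq> {}" by blast
  next
    fix q assume q: "q \<in> T"
    then have qW: "q \<in> carrier W" by (simp add: T_def)
    let ?v = "inv\<^bsub>W\<^esub> q"
    have vW: "?v \<in> carrier W" using qW by simp
    have "\<exists>h\<in>H. fst ?v \<otimes>\<^bsub>G\<^esub> cl (rep i) = cl (rep (fst (snd ?v) i)) \<otimes>\<^bsub>G\<^esub> h" if i: "i < 203" for i
    proof -
      let ?j = "fst (snd ?v) i"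
      have j: "?j < 203" using perm_part[OF vW i] .
      have "fst (snd (q \<otimes>\<^bsub>W\<^esub> ?v)) i = i" using W.r_inv[OF qW] by (simp add: wreath_one)
      then have qj: "fst (snd q) ?j = i" by (simp add: act_mult)
      obtain h where h: "h \<in> H" "fst q \<otimes>\<^bsub>G\<^esub> cl (rep ?j) = cl (rep i) \<otimes>\<^bsub>G\<^esub> h"
        using q j qj unfolding T_def by fastforce
      have e: "fst ?v \<otimes>\<^bsub>G\<^esub> fst q = \<one>\<^bsub>G\<^esub>"
        using W.l_inv[OF qW] fm[of ?v q] by (simp add: wreath_one)
      have "cl (rep ?j) = fst ?v \<otimes>\<^bsub>G\<^esub> (fst q \<otimes>\<^bsub>G\<^esub> cl (rep ?j))"
        using e fc[OF qW] fc[OF vW] rc[OF j] by (simp flip: P.m_assoc)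
      also have "\<dots> = fst ?v \<otimes>\<^bsub>G\<^esub> cl (rep i) \<otimes>\<^bsub>G\<^esub> h"
        unfolding h(2) using fc[OF vW] rc[OF i] hc[OF h(1)] by (simp add: P.m_assoc)
      finally have "fst ?v \<otimes>\<^bsub>G\<^esub> cl (rep i) = cl (rep ?j) \<otimes>\<^bsub>G\<^esub> inv\<^bsub>G\<^esub> h"
        using fc[OF vW] rc[OF i] rc[OF j] hc[OF h(1)] by (simp add: P.inv_solve_right)
      then show ?thesis using subgroup.m_inv_closed[OF H h(1)] by blast
    qed
    then show "?v \<in> T" using vW by (simp add: T_def)
  next
    fix q r assume q: "q \<in> T" and r: "r \<in> T"
    then have W2: "q \<in> carrier W" "r \<in> carrier W" by (simp_all add: T_def)
    have "\<exists>h\<in>H. fst (q \<otimes>\<^bsub>W\<^esub> r) \<otimes>\<^bsub>G\<^esub> cl (rep i) = cl (rep (fst (snd (q \<otimes>\<^bsub>W\<^esub> r)) i)) \<otimes>\<^bsub>G\<^esub> h"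
      if i: "i < 203" for i
    proof -
      let ?j = "fst (snd r) i"
      have j: "?j < 203" "fst (snd q) ?j < 203" using perm_part W2 i by blast+
      obtain h where h: "h \<in> H" "fst r \<otimes>\<^bsub>G\<^esub> cl (rep i) = cl (rep ?j) \<otimes>\<^bsub>G\<^esub> h"
        using r i unfolding T_def by fast
      obtain h' where h': "h' \<in> H" "fst q \<otimes>\<^bsub>G\<^esub> cl (rep ?j) = cl (rep (fst (snd q) ?j)) \<otimes>\<^bsub>G\<^esub> h'"
        using q j unfolding T_def by blast
      have "fst (q \<otimes>\<^bsub>W\<^esub> r) \<otimes>\<^bsub>G\<^esub> cl (rep i) = fst q \<otimes>\<^bsub>G\<^esub> (fst r \<otimes>\<^bsub>G\<^esub> cl (rep i))"
        using fc W2 rc[OF i] by (simp add: fm P.m_assoc)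
      also have "\<dots> = fst q \<otimes>\<^bsub>G\<^esub> cl (rep ?j) \<otimes>\<^bsub>G\<^esub> h"
        unfolding h(2) using fc W2 rc[OF j(1)] hc[OF h(1)] by (simp add: P.m_assoc)
      also have "\<dots> = cl (rep (fst (snd q) ?j)) \<otimes>\<^bsub>G\<^esub> (h' \<otimes>\<^bsub>G\<^esub> h)"
        unfolding h'(2) using rc[OF j(2)] hc h(1) h'(1) by (simp add: P.m_assoc)
      finally show ?thesis
        using subgroup.m_closed[OF H h'(1) h(1)] unfolding act_mult by blast
    qed
    then show "q \<otimes>\<^bsub>W\<^esub> r \<in> T" using W2 by (simp add: T_def)
  qed
  moreover have "range lift \<subseteq> T"
  proof
    fix x assume "x \<in> range lift"
    then obtain s where x: "x = lift s" by auto
    have "\<exists>h\<in>H. fst (lift s) \<otimes>\<^bsub>G\<^esub> cl (rep i) = cl (rep (fst (snd (lift s)) i)) \<otimes>\<^bsub>G\<^esub> h" if i: "i < 203" for i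
    proof -
      define P where "P = mmul (rep (perm s i)) (sub (coset_part s i))"
      have c: "coset_part s i < 60" "mmul (gmat s) (rep i) = P \<or> mmul (gmat s) (rep i) = mneg P"
        using coset_ok[OF i, of s] by (simp_all add: coset_ok_def Let_def P_def)
      have "cl (mmul (gmat s) (rep i)) = cl P" using c(2) cl_mneg[of P] by (metis P_def mmul_mats)
      then have "cl (gmat s) \<otimes>\<^bsub>G\<^esub> cl (rep i) = cl (rep (perm s i)) \<otimes>\<^bsub>G\<^esub> cl (sub (coset_part s i))"
        using cl_mult[OF gmat_SL2] rep_facts i perm_lt[OF i] sub_list_facts[OF sub_in[OF c(1)]]
        by (simp add: cl_mult P_def)
      moreover have "cl (sub (coset_part s i)) \<in> H" using sub_in[OF c(1)] by (simp add: H_def)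
      ultimately show ?thesis by (auto simp: lift_def)
    qed
    then show "x \<in> T" using lift_carrier x by (simp add: T_def)
  qed
  ultimately have "carrier Q \<subseteq> T"
    unfolding Q_def using W.generate_subgroup_incl by simp
  then show ?thesis using q i unfolding T_def by blast
qed

text \<open>Coset 0 is \<open>H\<close> itself, and the representatives of all other cosets lie
  outside \<open>H\<close>.\<close>

lemma fixes_base_iff:
  assumes H: "subgroup H G" and q: "q \<in> carrier Q"
  shows "fst (snd q) 0 = 0 \<longleftrightarrow> fst q \<in> H"
proof -
  obtain h where h: "h \<in> H" "fst q \<otimes>\<^bsub>G\<^esub> cl (rep 0) = cl (rep (fst (snd q) 0)) \<otimes>\<^bsub>G\<^esub> h"
    using coset_relation[OF H q, of 0] by auto
  have r0: "cl (rep 0) = \<one>\<^bsub>G\<^esub>" by (simp add: rep_simps cl_one)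
  have c: "fst q \<in> carrier G" "h \<in> carrier G" "cl (rep (fst (snd q) 0)) \<in> carrier G"
    using fst.hom_closed[OF q] H_carrier h(1) rep_facts[OF perm_part[OF Q_in_W[OF q]], of 0] by auto
  have e: "fst q = cl (rep (fst (snd q) 0)) \<otimes>\<^bsub>G\<^esub> h" using h(2) c by (simp add: r0)
  show ?thesis
  proof
    assume "fst (snd q) 0 = 0" then show "fst q \<in> H" using e h(1) c by (simp add: r0)
  next
    assume "fst q \<in> H"
    then have "fst q \<otimes>\<^bsub>G\<^esub> inv\<^bsub>G\<^esub> h \<in> H"
      using subgroup.m_closed[OF H] subgroup.m_inv_closed[OF H h(1)] by blast
    moreover have "fst q \<otimes>\<^bsub>G\<^esub> inv\<^bsub>G\<^esub> h = cl (rep (fst (snd q) 0))"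
      using e c by (metis P.inv_solve_right)
    ultimately show "fst (snd q) 0 = 0" using rep_H perm_part[OF Q_in_W[OF q], of 0] by auto
  qed
qed

text \<open>Conjugation by a tree element moves the question from \<open>i\<close> to coset 0, where
  the trivial element of \<open>G\<close> lies in \<open>H\<close>.\<close>

lemma kernel_acts_trivially:
  assumes H: "subgroup H G" and q: "q \<in> carrier Q" "fst q = \<one>\<^bsub>G\<^esub>" and i: "i < 203"
  shows "fst (snd q) i = i"
proof -
  obtain t where t: "t \<in> carrier Q" "fst (snd t) 0 = i" using tree_element[OF i] by blast
  let ?c = "inv\<^bsub>Q\<^esub> t \<otimes>\<^bsub>Q\<^esub> (q \<otimes>\<^bsub>Q\<^esub> t)"
  have c: "?c \<in> carrier Q" by (intro Q.m_closed Q.inv_closed t(1) q(1))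
  have "fst ?c = \<one>\<^bsub>G\<^esub>"
    using fst.hom_mult[of "inv\<^bsub>Q\<^esub> t" "q \<otimes>\<^bsub>Q\<^esub> t"] fst.hom_mult[of q t] t q fst.hom_closed[OF t(1)]
    by (simp del: Q_mult Q_one add: Q.m_closed)
  then have "fst (snd ?c) 0 = 0" using fixes_base_iff[OF H c] subgroup.one_closed[OF H] by simp
  moreover have "t \<otimes>\<^bsub>Q\<^esub> ?c = q \<otimes>\<^bsub>Q\<^esub> t" using t q by (simp del: Q_mult Q_one flip: Q.m_assoc)
  ultimately show ?thesis
    using act_mult[of t ?c 0] act_mult[of q t 0] t by simp
qed

section \<open>Comparison of the two preimages\<close>

lemma word_lab: "i < 203 \<Longrightarrow> snd (snd (word ws)) i \<in> carrier A5"
  using lab_part[OF word_carrier] .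

lemma words_agree_iff:
  assumes i: "i < 203"
  shows "snd (snd (word word_u)) i = snd (snd (word word_v)) i \<longleftrightarrow> i \<in> {141,147,154,167,198}"
    and "fst (snd (word word_u)) i = fst (snd (word word_v)) i"
proof -
  have ok: "agree_ok i" using agree_ok i by (simp add: all_below_def)
  show p: "fst (snd (word word_u)) i = fst (snd (word word_v)) i"
    using ok word_act[OF i, of word_u 1] word_act[OF i, of word_v 1] by (simp add: agree_ok_def)
  have "agree i \<longleftrightarrow> (\<forall>a\<in>{1,2,3,4,5}. snd (snd (word word_u)) i a = snd (snd (word word_v)) i a)"
    using word_act[OF i] p unfolding agree_def by simp
  also have "\<dots> \<longleftrightarrow> snd (snd (word word_u)) i = snd (snd (word word_v)) i"
    using alt5_eqI[OF word_lab[OF i] word_lab[OF i]] by metis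
  finally show "snd (snd (word word_u)) i = snd (snd (word word_v)) i \<longleftrightarrow> i \<in> {141,147,154,167,198}"
    using ok unfolding agree_ok_def by blast
qed

lemma stabilizer_preimages_not_iso:
  assumes H: "subgroup H G" and iso: "G\<lparr>carrier := H\<rparr> \<cong> A5"
    and K1: "subgroup K1 G" "card K1 = 60" and nonconj: "\<not> conjugate_subgroups G H K1"
  shows "\<not> Q\<lparr>carrier := {q \<in> carrier Q. fst q \<in> K1}\<rparr> \<cong> Q\<lparr>carrier := {q \<in> carrier Q. fst q \<in> H}\<rparr>"
proof -
  interpret L: labelled_extension Q A5 G fst "\<lambda>q. fst (snd q)" "\<lambda>q. snd (snd q)" Idx 0
  proof (intro labelled_extension.intro labelled_extension_axioms.intro)
    show "simple_group A5" by (rule simple_alt5)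
    fix q r :: welt and i :: nat
    show "q \<in> carrier Q \<Longrightarrow> i \<in> Idx \<Longrightarrow> fst (snd q) i \<in> Idx"
      using perm_part Q_in_W by simp
    show "q \<in> carrier Q \<Longrightarrow> fst q = \<one>\<^bsub>G\<^esub> \<Longrightarrow> i \<in> Idx \<Longrightarrow> fst (snd q) i = i"
      using kernel_acts_trivially[OF H] by simp
    show "i \<in> Idx \<Longrightarrow> \<exists>q\<in>carrier Q. fst (snd q) 0 = i" using tree_element[of i] by (metis lessThan_iff)
    show "q \<in> carrier Q \<Longrightarrow> i \<in> Idx \<Longrightarrow> snd (snd q) i \<in> carrier A5"
      using lab_part Q_in_W by simp
    show "\<lbrakk>q \<in> carrier Q; r \<in> carrier Q; i \<in> Idx\<rbrakk> \<Longrightarrow>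
        snd (snd (q \<otimes>\<^bsub>Q\<^esub> r)) i = snd (snd q) (fst (snd r) i) \<otimes>\<^bsub>A5\<^esub> snd (snd r) i"
      by (simp add: lab_mult alt_group_mult)
    show "q = \<one>\<^bsub>Q\<^esub>" if q: "q \<in> carrier Q" "fst q = \<one>\<^bsub>G\<^esub>" "\<And>i. i \<in> Idx \<Longrightarrow> snd (snd q) i = \<one>\<^bsub>A5\<^esub>"
    proof -
      have "q = \<one>\<^bsub>W\<^esub>"
        by (rule W_eqI[OF Q_in_W[OF q(1)] W.one_closed])
          (use q kernel_acts_trivially[OF H q(1,2)] in \<open>simp_all add: wreath_one\<close>)
      then show ?thesis by simp
    qed
    fix s assume "s \<in> carrier A5"
    then show "\<exists>q\<in>carrier Q. fst (snd q) 0 = 0 \<and> snd (snd q) 0 = s"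
      unfolding loop_labels[symmetric] by blast
  qed (simp_all add: Q_group fst.group_hom_axioms finite_Q noncomm_alt5 act_mult)
  define w where "w = word word_u \<otimes>\<^bsub>Q\<^esub> inv\<^bsub>Q\<^esub> (word word_v)"
  define F :: "nat set" where "F = {141,147,154,167,198}"
  let ?pv = "fst (snd (word word_v))"
  \<comment> \<open>From \<open>w\<close> times \<open>word_v\<close> = \<open>word_u\<close>, the
    label of \<open>w\<close> at the image of \<open>i\<close> is trivial where the two words have
    equal labels at \<open>i\<close>; hence the trivial set is a translate of
    \<open>F\<close>.\<close>
  have lab_w: "snd (snd w) (?pv i) = \<one>\<^bsub>A5\<^esub> \<longleftrightarrow> i \<in> F" if i: "i < 203" for i
  proof -
    have "w \<otimes>\<^bsub>Q\<^esub> word word_v = word word_u"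
      using word_Q by (simp add: w_def Q.m_assoc del: Q_mult Q_one)
    then have "snd (snd w) (?pv i) \<otimes>\<^bsub>A5\<^esub> snd (snd (word word_v)) i = snd (snd (word word_u)) i"
      using L.lab_mult[of w "word word_v" i] i word_Q unfolding w_def by (simp del: Q_mult)
    moreover have "snd (snd w) (?pv i) \<in> carrier A5"
      using L.lab_closed[of w "?pv i"] L.act_closed[of "word word_v" i] i word_Q unfolding w_def by (simp del: Q_mult)
    ultimately show ?thesis
      using words_agree_iff(1)[OF i] word_lab[OF i] unfolding F_def by (metis A5.r_cancel_one A5.l_one)
  qed
  have Z: "{i \<in> Idx. snd (snd w) i = \<one>\<^bsub>A5\<^esub>} = ?pv ` F"
  proof -
    have pv: "?pv ` Idx = Idx" using L.act_surj[OF word_Q] .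
    have "F \<subseteq> Idx" by (auto simp: F_def)
    show ?thesis
    proof (intro equalityI subsetI)
      fix j assume j: "j \<in> {i \<in> Idx. snd (snd w) i = \<one>\<^bsub>A5\<^esub>}"
      then have "j \<in> ?pv ` Idx" unfolding pv by simp
      then obtain i where "i < 203" "j = ?pv i" by blast
      then show "j \<in> ?pv ` F" using lab_w[of i] j by simp
    next
      fix j assume "j \<in> ?pv ` F"
      then obtain i where "i \<in> F" "j = ?pv i" by blast
      then show "j \<in> {i \<in> Idx. snd (snd w) i = \<one>\<^bsub>A5\<^esub>}"
        using lab_w[of i] \<open>F \<subseteq> Idx\<close> pv by blast
    qed
  qed
  have cardF: "card (?pv ` F) = 5"
  proof -
    have "inj_on ?pv F" by (rule inj_on_subset[OF L.act_inj[OF word_Q]]) (auto simp: F_def)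
    then show ?thesis by (simp add: card_image) (simp add: F_def)
  qed
  interpret S: separated_extension Q A5 G fst "\<lambda>q. fst (snd q)" "\<lambda>q. snd (snd q)" Idx 0 w
  proof (intro separated_extension.intro L.labelled_extension_axioms separated_extension_axioms.intro)
    show "w \<in> carrier Q" unfolding w_def by (intro Q.m_closed Q.inv_closed word_Q)
    have "cl (wmat word_u) = cl (wmat word_v)"
    proof -
      have "wmat word_v \<in> mats" using wmat_SL2[of word_v] by (simp add: SL2_carrier)
      from word_mats(1) cl_mneg[OF this] show ?thesis by metis
    qed
    then have "fst (word word_u) = fst (word word_v)" by (simp only: fst_word)
    then show "fst w = \<one>\<^bsub>G\<^esub>"
      using fst.hom_mult[OF word_Q Q.inv_closed[OF word_Q]] fst.hom_inv[OF word_Q]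
        P.r_inv[OF fst.hom_closed[OF word_Q]] unfolding w_def by metis
    show "{i \<in> Idx. snd (snd w) i = \<one>\<^bsub>A5\<^esub>} \<noteq> {}" unfolding Z by (simp add: F_def)
    show "{i \<in> Idx. snd (snd w) i = \<one>\<^bsub>A5\<^esub>} \<noteq> Idx"
      unfolding Z using cardF by (metis card_lessThan numeral_eq_iff semiring_norm)
    fix d :: nat assume d: "d dvd card Idx" "d \<noteq> 1"
    \<comment> \<open>203 = 7 * 29.\<close>
    have "5 < d"
    proof (rule ccontr)
      assume "\<not> 5 < d"
      then have "d = 0 \<or> d = 1 \<or> d = 2 \<or> d = 3 \<or> d = 4 \<or> d = 5" by arith
      then show False using d by auto
    qed
    then show "card {i \<in> Idx. snd (snd w) i = \<one>\<^bsub>A5\<^esub>} < d" unfolding Z cardF .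
  qed
  let ?P = "{q \<in> carrier Q. fst q \<in> K1}"
  have stab: "L.stab = {q \<in> carrier Q. fst q \<in> H}"
    unfolding L.stab_def using fixes_base_iff[OF H] by blast
  have P: "subgroup ?P Q"
  proof (rule Q.subgroupI)
    show "?P \<noteq> {}" using Q.one_closed fst.hom_one subgroup.one_closed[OF K1(1)] by fastforce
  qed (auto simp del: Q_mult Q_one intro: subgroup.m_closed[OF K1(1)] subgroup.m_inv_closed[OF K1(1)])
  have KP: "L.K \<subseteq> ?P" using subgroup.one_closed[OF K1(1)] by (auto simp: L.K_iff)
  \<comment> \<open>A common fixed point \<open>i\<close> would put \<open>K1\<close> into the
    conjugate of \<open>H\<close> by \<open>rep i\<close>; equal orders make this an equality,
    against non-conjugacy.\<close>
  have moves: "\<exists>q\<in>?P. fst (snd q) i \<noteq> i" if i: "i \<in> Idx" for i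
  proof (rule ccontr)
    assume fix_i: "\<not> ?thesis"
    define r where "r = cl (rep i)"
    have r: "r \<in> carrier G" using rep_facts i by (simp add: r_def)
    have "K1 \<subseteq> (\<lambda>h. r \<otimes>\<^bsub>G\<^esub> h \<otimes>\<^bsub>G\<^esub> inv\<^bsub>G\<^esub> r) ` H"
    proof
      fix g assume g: "g \<in> K1"
      then have gG: "g \<in> carrier G" using subgroup.subset[OF K1(1)] by auto
      then obtain q where q: "q \<in> carrier Q" "fst q = g" using fst_surj by (metis imageE)
      then have "fst (snd q) i = i" using fix_i g by blast
      then have "\<exists>h\<in>H. g \<otimes>\<^bsub>G\<^esub> r = r \<otimes>\<^bsub>G\<^esub> h"
        using coset_relation[OF H q(1), of i] i q(2) unfolding r_def by simp
      then obtain h where h: "h \<in> H" "g \<otimes>\<^bsub>G\<^esub> r = r \<otimes>\<^bsub>G\<^esub> h" by blast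
      then have "h \<in> carrier G" using H_carrier by blast
      then have "g = r \<otimes>\<^bsub>G\<^esub> h \<otimes>\<^bsub>G\<^esub> inv\<^bsub>G\<^esub> r"
        using P.inv_solve_right[of g "r \<otimes>\<^bsub>G\<^esub> h" r] gG r h(2) by simp
      then show "g \<in> (\<lambda>h. r \<otimes>\<^bsub>G\<^esub> h \<otimes>\<^bsub>G\<^esub> inv\<^bsub>G\<^esub> r) ` H" using h(1) by blast
    qed
    moreover have "card ((\<lambda>h. r \<otimes>\<^bsub>G\<^esub> h \<otimes>\<^bsub>G\<^esub> inv\<^bsub>G\<^esub> r) ` H) \<le> card K1"
      using card_image_le[OF finite_H] card_H K1(2) by simp
    ultimately have "K1 = (\<lambda>h. r \<otimes>\<^bsub>G\<^esub> h \<otimes>\<^bsub>G\<^esub> inv\<^bsub>G\<^esub> r) ` H"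
      using finite_H by (intro card_seteq) auto
    then show False using nonconj r unfolding conjugate_subgroups_def by blast
  qed
  \<comment> \<open>The epimorphism through \<open>H\<close> is \<open>\<chi> \<circ> fst\<close>;
    since \<open>\<chi>\<close> is injective, its kernel lies in \<open>L.K\<close>.\<close>
  obtain \<chi> where \<chi>: "\<chi> \<in> hom (G\<lparr>carrier := H\<rparr>) A5" "bij_betw \<chi> H (carrier A5)"
    using iso by (auto simp: is_iso_def iso_def)
  have \<chi>1: "\<chi> \<one>\<^bsub>G\<^esub> = \<one>\<^bsub>A5\<^esub>"
    using hom_one[OF \<chi>(1) P.subgroup_imp_group[OF H] A5.is_group] by simp
  have "\<not> Q\<lparr>carrier := ?P\<rparr> \<cong> Q\<lparr>carrier := L.stab\<rparr>"
  proof (rule S.stabilizer_not_iso[OF P KP moves])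
    show "\<chi> \<circ> fst \<in> hom (Q\<lparr>carrier := L.stab\<rparr>) A5"
    proof (rule homI)
      fix q r assume "q \<in> carrier (Q\<lparr>carrier := L.stab\<rparr>)" "r \<in> carrier (Q\<lparr>carrier := L.stab\<rparr>)"
      then have qr: "q \<in> carrier Q" "r \<in> carrier Q" "fst q \<in> H" "fst r \<in> H" by (simp_all add: stab)
      show "(\<chi> \<circ> fst) q \<in> carrier A5" using bij_betwE[OF \<chi>(2)] qr by simp
      show "(\<chi> \<circ> fst) (q \<otimes>\<^bsub>Q\<lparr>carrier := L.stab\<rparr>\<^esub> r) = (\<chi> \<circ> fst) q \<otimes>\<^bsub>A5\<^esub> (\<chi> \<circ> fst) r"
        using hom_mult[OF \<chi>(1), of "fst q" "fst r"] qr fst.hom_mult[OF qr(1,2)] by simp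
    qed
    show "(\<chi> \<circ> fst) ` L.stab = carrier A5"
    proof -
      have "fst ` L.stab = H"
      proof (intro equalityI subsetI)
        fix h assume h: "h \<in> H"
        then have "h \<in> fst ` carrier Q" using fst_surj H_carrier by blast
        then show "h \<in> fst ` L.stab" using h unfolding stab by blast
      next
        fix h assume "h \<in> fst ` L.stab"
        then obtain q where "q \<in> L.stab" "h = fst q" by blast
        then show "h \<in> H" unfolding stab by simp
      qed
      then show ?thesis using \<chi>(2) by (metis bij_betw_imp_surj_on image_comp)
    qed
    fix q assume q: "q \<in> L.stab" "(\<chi> \<circ> fst) q = \<one>\<^bsub>A5\<^esub>"
    then have "fst q = \<one>\<^bsub>G\<^esub>"
      using inj_onD[OF bij_betw_imp_inj_on[OF \<chi>(2)], of "fst q" "\<one>\<^bsub>G\<^esub>"] \<chi>1 subgroup.one_closed[OF H]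
      by (simp add: stab)
    then show "q \<in> L.K" using q by (simp add: L.K_iff stab)
  qed
  then show ?thesis unfolding stab .
qed

theorem theorem1p7:
  fixes G1 G2 :: "(int \<times> int \<times> int \<times> int) set set"
  assumes "subgroup G1 (PSL2 29)" and "subgroup G2 (PSL2 29)"
    and "(PSL2 29)\<lparr>carrier := G1\<rparr> \<cong> alt_group 5"
    and "(PSL2 29)\<lparr>carrier := G2\<rparr> \<cong> alt_group 5"
    and "\<not> conjugate_subgroups (PSL2 29) G1 G2"
  shows "\<exists>(Q :: nat monoid) \<phi>. Gamma_quotient Q \<and> \<phi> \<in> hom Q (PSL2 29) \<and>
           \<phi> ` carrier Q = carrier (PSL2 29) \<and>
           \<not> (Q\<lparr>carrier := {q \<in> carrier Q. \<phi> q \<in> G1}\<rparr> \<cong> Q\<lparr>carrier := {q \<in> carrier Q. \<phi> q \<in> G2}\<rparr>)"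
proof -
  obtain M M' where M: "mmul M M' = E" "mmul M' M = E"
    and gens: "cl (conjm M M' A0) \<in> G1" "cl (conjm M M' B0) \<in> G1"
    using alt5_subgroup_generators[OF assms(1,3)] by blast
  define \<tau> where "\<tau> = (\<lambda>S. conjm M M' ` S)"
  have \<tau>: "\<tau> \<in> iso G G" using conjm_iso(1)[OF M] by (simp add: \<tau>_def)
  interpret \<tau>: group_hom G G \<tau> using \<tau> by unfold_locales (simp add: iso_def)
  have bij: "bij_betw \<tau> (carrier G) (carrier G)" using \<tau> by (simp add: iso_def)
  define V where "V K = {g \<in> carrier G. \<tau> g \<in> K}" for K
  have V_sub: "subgroup (V K) G" if "subgroup K G" for K
    unfolding V_def by (rule \<tau>.subgroup_preimage[OF that])
  have V_img: "\<tau> ` V K = K" if "subgroup K G" for K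
  proof (intro equalityI subsetI)
    fix k assume "k \<in> K"
    then have "k \<in> \<tau> ` carrier G" using subgroup.subset[OF that] bij by (auto simp: bij_betw_def)
    then show "k \<in> \<tau> ` V K" using \<open>k \<in> K\<close> unfolding V_def by blast
  next
    fix k assume "k \<in> \<tau> ` V K"
    then show "k \<in> K" unfolding V_def by blast
  qed
  have V_card: "card (V K) = card K" if "subgroup K G" for K
  proof -
    have "inj_on \<tau> (V K)"
      by (rule inj_on_subset[OF bij_betw_imp_inj_on[OF bij]]) (simp add: V_def Collect_subset)
    then show ?thesis using card_image V_img[OF that] by metis
  qed
  have card60: "card G1 = 60" "card G2 = 60"
    using iso_same_card[OF assms(3)] iso_same_card[OF assms(4)] card_alt5 by simp_all
  have A0B0: "A0 \<in> carrier (SL2 29)" "B0 \<in> carrier (SL2 29)"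
    by (simp_all add: A0_def B0_def SL2_carrier mats_def mdet_def mdet_int_def)
  have "cl A0 \<in> V G1" "cl B0 \<in> V G1"
    using gens A0B0 conjm_iso(2)[OF M] by (simp_all add: V_def \<tau>_def SL2_carrier)
  \<comment> \<open>The pullback of \<open>G1\<close> has order 60 and contains \<open>cl A0\<close>
    and \<open>cl B0\<close>, so it is the tabulated set; this shows that \<open>H\<close> is a
    subgroup.\<close>
  then have VH: "V G1 = H"
    by (rule H_unique[OF V_sub[OF assms(1)] V_card[OF assms(1), unfolded card60]])
  have H: "subgroup H G" using V_sub[OF assms(1)] VH by simp
  have H_iso: "G\<lparr>carrier := H\<rparr> \<cong> A5"
  proof -
    have "\<tau> ` H = G1" using V_img[OF assms(1)] unfolding VH .
    then show ?thesis using iso_trans[OF iso_restrict_carrier[OF \<tau> H_carrier]] assms(3) by simp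
  qed
  have nonconj: "\<not> conjugate_subgroups G H (V G2)"
  proof
    assume "conjugate_subgroups G H (V G2)"
    then obtain g where g: "g \<in> carrier G" "V G2 = (\<lambda>h. g \<otimes>\<^bsub>G\<^esub> h \<otimes>\<^bsub>G\<^esub> inv\<^bsub>G\<^esub> g) ` H"
      unfolding conjugate_subgroups_def by blast
    have "G2 = \<tau> ` (\<lambda>h. g \<otimes>\<^bsub>G\<^esub> h \<otimes>\<^bsub>G\<^esub> inv\<^bsub>G\<^esub> g) ` H" using V_img[OF assms(2)] g(2) by simp
    also have "\<dots> = (\<lambda>h. \<tau> g \<otimes>\<^bsub>G\<^esub> h \<otimes>\<^bsub>G\<^esub> inv\<^bsub>G\<^esub> (\<tau> g)) ` \<tau> ` H"
      unfolding image_image using g(1) H_carrier by (intro image_cong) auto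
    also have "\<tau> ` H = G1" using V_img[OF assms(1)] VH by simp
    finally show False using assms(5) g(1) \<tau>.hom_closed unfolding conjugate_subgroups_def by blast
  qed
  have not_iso: "\<not> Q\<lparr>carrier := {q \<in> carrier Q. fst q \<in> V G2}\<rparr> \<cong> Q\<lparr>carrier := {q \<in> carrier Q. fst q \<in> H}\<rparr>"
    using stabilizer_preimages_not_iso[OF H H_iso V_sub[OF assms(2)] _ nonconj] V_card[OF assms(2)] card60 by simp
  obtain R :: "nat monoid" and h where R: "group R" "h \<in> iso R Q"
    using iso_nat_monoid[OF Q_group finite_Q] by blast
  interpret R: group R by (rule R(1))
  \<comment> \<open>Twisting the projection by \<open>\<tau>\<close> makes the preimage of
    \<open>G1\<close> correspond to the preimage of \<open>H\<close> under \<open>fst\<close>, and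
    that of \<open>G2\<close> to the preimage of \<open>V G2\<close>.\<close>
  define \<phi> where "\<phi> = \<tau> \<circ> (fst \<circ> h)"
  have \<phi>_hom: "\<phi> \<in> hom R G"
    unfolding \<phi>_def using R(2) fst_hom \<tau>.homh by (intro hom_compose[of _ _ G] hom_compose[of _ _ Q]) (auto simp: iso_def)
  interpret \<phi>: group_hom R G \<phi> by unfold_locales (rule \<phi>_hom)
  have h_img: "h ` carrier R = carrier Q" using R(2) by (auto simp: iso_def bij_betw_def)
  have \<phi>_surj: "\<phi> ` carrier R = carrier G"
    unfolding \<phi>_def image_comp[symmetric] h_img fst_surj using bij by (simp add: bij_betw_def)
  define A where "A K = {r \<in> carrier R. \<phi> r \<in> K}" for K
  have hA: "h ` A K = {q \<in> carrier Q. fst q \<in> V K}" for K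
  proof (intro equalityI subsetI)
    fix q assume "q \<in> h ` A K"
    then obtain r where r: "r \<in> carrier R" "\<tau> (fst (h r)) \<in> K" "q = h r" by (unfold A_def \<phi>_def comp_def, blast)
    have "q \<in> carrier Q" unfolding h_img[symmetric] r(3) by (rule imageI[OF r(1)])
    then show "q \<in> {q \<in> carrier Q. fst q \<in> V K}"
      using r fst.hom_closed unfolding V_def by blast
  next
    fix q assume "q \<in> {q \<in> carrier Q. fst q \<in> V K}"
    then have q: "q \<in> carrier Q" "\<tau> (fst q) \<in> K" by (simp_all add: V_def)
    have "q \<in> h ` carrier R" unfolding h_img by (rule q(1))
    then obtain r where "r \<in> carrier R" "h r = q" by (metis imageE)
    then show "q \<in> h ` A K" using q unfolding A_def \<phi>_def comp_def by blast
  qed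
  have A_iso: "R\<lparr>carrier := A K\<rparr> \<cong> Q\<lparr>carrier := {q \<in> carrier Q. fst q \<in> V K}\<rparr>" for K
    using iso_restrict_carrier[OF R(2), of "A K"] unfolding hA by (simp add: A_def)
  have "\<not> R\<lparr>carrier := A G1\<rparr> \<cong> R\<lparr>carrier := A G2\<rparr>"
  proof
    assume iso: "R\<lparr>carrier := A G1\<rparr> \<cong> R\<lparr>carrier := A G2\<rparr>"
    have grp: "group (R\<lparr>carrier := A K\<rparr>)" if "subgroup K G" for K
      unfolding A_def by (rule R.subgroup_imp_group[OF \<phi>.subgroup_preimage[OF that]])
    have "Q\<lparr>carrier := {q \<in> carrier Q. fst q \<in> V G2}\<rparr> \<cong> R\<lparr>carrier := A G2\<rparr>"
      by (rule group.iso_sym[OF grp[OF assms(2)] A_iso])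
    also have "R\<lparr>carrier := A G2\<rparr> \<cong> R\<lparr>carrier := A G1\<rparr>"
      by (rule group.iso_sym[OF grp[OF assms(1)] iso])
    also have "R\<lparr>carrier := A G1\<rparr> \<cong> Q\<lparr>carrier := {q \<in> carrier Q. fst q \<in> V G1}\<rparr>"
      by (rule A_iso)
    finally show False using not_iso unfolding VH by simp
  qed
  moreover have "Gamma_quotient R"
    using Gamma_quotient_iso[OF Gamma_quotient_Q R(1)] R.iso_set_sym[OF R(2)] by blast
  ultimately show ?thesis using \<phi>_hom \<phi>_surj unfolding A_def by blast
qed

end
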